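(* Let $f : X\to B$ be a Lagrangian fibration of class $\mathcal{C}$. If $\phi_f : X\to X$ is an anti-symplectomorphism satisfying $f\circ\phi_f=f$, then $$\phi_f^2=\mathrm{Id}_X .$$ Furthermore, if $t : X\to X$ is a symplectomorphism such that $f\circ t=f$, then $$\phi_f\circ t^{-1}=t\circ\phi_f .$$
   Context: **General conventions.** Let $X$ be a symplectic manifold and $B$ a manifold of half the dimension. A continuous map $f:X\to B$ is a Lagrangian fibration if each fibre contains a relatively open dense subset that is a smooth Lagrangian submanifold of $X$. An anti-symplectomorphism of $(X,\omega)$ is a self-diffeomorphism $\phi$ with $\phi^*\omega=-\omega$. A Lagrangian section of $f$ is a continuous $\sigma:B\to X$ with $f\circ\sigma=\mathrm{id}_B$ whose image is a smooth Lagrangian submanifold and which is smooth over the part of $B$ over which $f$ is smooth. $\mathrm{Crit} f$ is the singular set of $f$, and the discriminant locus is the set of points of $B$ with singular fibre. The base of a proper Lagrangian submersion with connected fibres carries the integral affine structure given by action coordinates (transition maps in $\mathbb{R}^n\rtimes SL(n,\mathbb{Z})$). **Smooth local models.** (Nodal) A smooth proper Lagrangian fibration with connected fibres over an open disc in $\mathbb{R}^2$ with a single critical point $p$, lying over $0$, a neighbourhood of which is fibre-preservingly symplectomorphic to a neighbourhood of $(0,0)$ for $q:\mathbb{C}^2\to\mathbb{C}$, $q(z_1,z_2)=z_1\bar z_2$, with $z_1=y_1+iy_2$, $z_2=x_1+ix_2$, $\omega=\sum dx_j\wedge dy_j$. (Generic-singular) A smooth proper Lagrangian fibration with connected fibres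 over $D\times(0,1)$, $D$ an open disc, with discriminant $\{0\}\times(0,1)$, such that a neighbourhood of the critical set is fibre-preservingly symplectomorphic to a neighbourhood of the critical set of $(z_1,z_2,e^{i\theta},r)\mapsto(z_1\bar z_2,r)$ on $\mathbb{C}^2\times S^1\times(0,1)$ with the product symplectic form. (Positive) A smooth proper Lagrangian fibration with connected fibres over an open ball $B'\ni 0$ in $\mathbb{R}^3$, such that a neighbourhood of the critical set is fibre-preservingly symplectomorphic to a neighbourhood of $\mathrm{Crit}(F)\cap F^{-1}(B')$ for $F(z_1,z_2,z_3)=(\operatorname{Im} z_1z_2z_3,\ |z_1|^2-|z_2|^2,\ |z_1|^2-|z_3|^2)$ on $\mathbb{C}^3$ with standard symplectic form. Its discriminant is the tripod $\{b_1=0,b_2=b_3\ge0\}\cup\{b_1=b_2=0,b_3\le0\}\cup\{b_1=b_3=0,b_2\le0\}$. **Simple integral affine manifolds with singularities.** $(B,\Delta,\mathscr{A})$: $B$ is an $n$-manifold ($n=2,3$), $\Delta\subset B$ has codimension $2$, and $\mathscr{A}$ is an integral affine structure on $B-\Delta$. For $n=2$ it is simple if $\Delta$ is a discrete set of points near each of which $\mathscr{A}$ is isomorphic to the affine structure on the base of a nodal fibration. For $n=3$ it is simple if $\Delta$ is a graph with trivalent vertices, each labelled positive or negative, such that near edge points (resp. positive vertices) $\mathscr{A}$ is isomorphic to that on the base of a generic-singular (resp. positive) fibration, and near each negative vertex it is isomorphic to the following. Let $Y\subset\mathbb{R}^2$ be a union of three curves issuing from $0$, smooth away from $0$, which is the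 image of $\{x_2=0,x_3\le0\}\cup\{x_3=0,x_2\le0\}\cup\{x_2=x_3\ge0\}$ under a homeomorphism of $\mathbb{R}^2$ isotopic to the identity; let $C_0,C_1,C_2$ be the components of $\mathbb{R}^2\setminus Y$ corresponding to the regions where $\max(0,x_2,x_3)$ equals $0,x_2,x_3$, and $a_0=(0,0)$, $a_1=(1,0)$, $a_2=(0,1)$. On $\mathbb{R}^3\setminus(\{0\}\times Y)$ take standard coordinates on $\{x_1<0\}$ and on $\{x_1>0\}$, and near a point of $\{0\}\times C_i$ the chart equal to the identity for $x_1\le0$ and to $(x_1,(x_2,x_3)+x_1a_i)$ for $x_1\ge0$. (All local isomorphisms extend to homeomorphisms of neighbourhoods matching the discriminants.) **Negative fibrations.** On $\mathbb{C}^3$ let $\mu=\frac12(|z_1|^2-|z_2|^2)$, $\gamma(z_1,z_2)=z_1z_2/|z_1|$ if $\mu\ge0$ and $z_1z_2/|z_2|$ if $\mu<0$, $\pi(z)=(\gamma(z_1,z_2),z_3)$, $\mathrm{Log}(u_1,u_2)=(\log|u_1|,\log|u_2|)$. Let $\Psi(u_1,u_2)=\frac1{\sqrt2}(u_1-u_2,u_1+u_2-\sqrt2)$ and let $\Phi$ be a symplectomorphism of $\mathbb{C}^2$, commuting with complex conjugation, which for suitable constants $\epsilon,M>0$ equals $(-u_2,u_1-1)$ for $|u_1|^2+|u_2|^2\le\epsilon$, $(u_1-1,u_2-\sqrt2)$ for $|u_1|^2+|u_2-\sqrt2|^2\le\epsilon$, $\frac1{\sqrt2}(u_1-u_2,u_1+u_2)$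 for $|u_2|^2\ge M$, and $\Psi$ outside slightly larger regions. The model is $f_M=(\mu,\mathrm{Log}\circ\Phi\circ\pi)$ on $(\Phi\circ\pi)^{-1}((\mathbb{C}^* )^2)$; its discriminant is contained in $\{b_1=0\}$ and is a three-legged amoeba (of the line $v_1+v_2+1=0$) with the ends of the legs pinched to curves. A piecewise smooth Lagrangian fibration $f^-:X^-\to B^-$, $B^-\subseteq\mathbb{R}^3$ open, with discriminant $\Delta^-$, is a Lagrangian negative fibration if: (1) it is topologically conjugate to $f_M$ (homeomorphisms of total spaces and bases near the discriminants intertwine the maps); (2) there is a submanifold with boundary $D\subset B^-$ homeomorphic to a closed 2-disc such that $\Delta^-\cap(B^--D)$ is three disjoint one-dimensional segments and $f^-$ is smooth on $X^--(f^-)^{-1}(D)$; (3) the affine structure induced on $B^--(D\cup\Delta^-)$ is simple (that of a neighbourhood of a negative vertex); (4) it has a section whose image is a smooth Lagrangian submanifold disjoint from the singular set. **Class $\mathcal{C}$.** *Dimension 6.* Let $(B,\Delta,\mathscr{A})$ be a compact simple integral affine 3-manifold with singularities and $\mathcal{N}$ its set of negative vertices. A localized thickening $(\Delta_{\mathrm{th}},\{D_p\}_{p\in\mathcal{N}})$ consists of the closed set $\Delta_{\mathrm{th}}$ obtained from $\Delta$ by replacing a neighbourhood of each negative vertex with a three-legged planar amoeba with pinched legs, and for each $p\in\mathcal{N}$ a 2-disc $D_p$ containing the codimension-1 part of $\Delta_{\mathrm{th}}$ near $p$. Put $B_{\mathrm{th}}=B-(\Delta\cup\bigcup_p D_p)$,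 $X_{\mathrm{th}}=T^*B_{\mathrm{th}}/\Lambda$, where $\Lambda$ is the lattice generated by differentials of integral affine coordinates, with projection $f_{\mathrm{th}}$. A fibration $f:X\to B$ is of class $\mathcal{C}$ if $X$ is a smooth compact symplectic 6-manifold, $f$ is a piecewise smooth Lagrangian fibration, and for some such data: (i) $f$ is smooth except along $\bigcup_p f^{-1}(D_p)$; (ii) the discriminant locus of $f$ is $\Delta_{\mathrm{th}}$; (iii) there is a symplectomorphism $X_{\mathrm{th}}\to f^{-1}(B_{\mathrm{th}})$ covering the inclusion $B_{\mathrm{th}}\subset B$; (iv) $f$ is a positive fibration over a neighbourhood of each positive vertex, generic-singular over a neighbourhood of each edge point, and Lagrangian negative over a neighbourhood of each $D_p$; (v) $f$ has a section whose image is a smooth Lagrangian submanifold disjoint from $\mathrm{Crit} f$. *Dimension 4.* $f:X\to B$ is of class $\mathcal{C}$ if $X$ is a compact symplectic 4-manifold, $(B,\Delta,\mathscr{A})$ is a compact simple integral affine 2-manifold with singularities, $f$ restricted over $B-\Delta$ is isomorphic to $T^*(B-\Delta)/\Lambda\to B-\Delta$, $f$ is a nodal fibration over a neighbourhood of each point of $\Delta$, and $f$ has a Lagrangian section avoiding $\mathrm{Crit} f$. *)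

theory Defs
  imports "HOL-Analysis.Analysis"
begin

section \<open>Smooth manifolds\<close>

fun C_k_on :: "nat \<Rightarrow> ('a::real_normed_vector \<Rightarrow> 'b::real_normed_vector) \<Rightarrow> 'a set \<Rightarrow> bool" where
  "C_k_on 0 f S \<longleftrightarrow> continuous_on S f"
| "C_k_on (Suc k) f S \<longleftrightarrow> continuous_on S f \<and> (\<forall>x\<in>S. f differentiable (at x)) \<and>
     (\<forall>v. C_k_on k (\<lambda>x. frechet_derivative f (at x) v) S)"

text \<open>Only meant for open \<open>S\<close>, in finite-dimensional spaces.\<close>

definition smooth_on :: "'a::real_normed_vector set \<Rightarrow> ('a \<Rightarrow> 'b::real_normed_vector) \<Rightarrow> bool" where
  "smooth_on S f \<longleftrightarrow> (\<forall>k. C_k_on k f S)"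

text \<open>
  A manifold modelled on the Euclidean space \<open>'e\<close> is a topology together with an atlas (not
  necessarily maximal). In a chart \<open>(U, \<phi>)\<close> the values of \<open>\<phi>\<close> outside \<open>U\<close> are irrelevant.
\<close>

type_synonym ('a, 'e) chart = "'a set \<times> ('a \<Rightarrow> 'e)"

record ('a, 'e) manifold =
  mtop :: "'a topology"
  atlas :: "('a, 'e) chart set"

abbreviation points :: "('a, 'e, 'z) manifold_scheme \<Rightarrow> 'a set" where
  "points M \<equiv> topspace (mtop M)"

definition top_chart :: "'a topology \<Rightarrow> ('a, 'e::euclidean_space) chart \<Rightarrow> bool" where
  "top_chart T c \<longleftrightarrow> (case c of (U, \<phi>) \<Rightarrow> openin T U \<and> open (\<phi> ` U) \<and>
     homeomorphic_map (subtopology T U) (top_of_set (\<phi> ` U)) \<phi>)"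

definition smooth_manifold :: "('a, 'e::euclidean_space, 'z) manifold_scheme \<Rightarrow> bool" where
  "smooth_manifold M \<longleftrightarrow>
     Hausdorff_space (mtop M) \<and> second_countable (mtop M) \<and>
     (\<forall>c\<in>atlas M. top_chart (mtop M) c) \<and>
     (\<Union>(U, \<phi>)\<in>atlas M. U) = points M \<and>
     (\<forall>(U, \<phi>)\<in>atlas M. \<forall>(V, \<psi>)\<in>atlas M. smooth_on (\<phi> ` (U \<inter> V)) (\<psi> \<circ> inv_into U \<phi>))"

definition open_sub :: "('a, 'e, 'z) manifold_scheme \<Rightarrow> 'a set \<Rightarrow> ('a, 'e, 'z) manifold_scheme" where
  "open_sub M W = M\<lparr>mtop := subtopology (mtop M) W, atlas := (\<lambda>(U, \<phi>). (U \<inter> W, \<phi>)) ` atlas M\<rparr>"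

definition euclid :: "('e::euclidean_space, 'e) manifold" where
  "euclid = \<lparr>mtop = euclidean, atlas = {(UNIV, id)}\<rparr>"

text \<open>Smoothness of \<open>f\<close> on the open subset \<open>S\<close> of \<open>M\<close>.\<close>

definition smooth_map_on ::
  "('a, 'e::euclidean_space, 'z) manifold_scheme \<Rightarrow> ('b, 'f::euclidean_space, 'y) manifold_scheme \<Rightarrow>
   'a set \<Rightarrow> ('a \<Rightarrow> 'b) \<Rightarrow> bool" where
  "smooth_map_on M N S f \<longleftrightarrow>
     openin (mtop M) S \<and> continuous_map (subtopology (mtop M) S) (mtop N) f \<and>
     (\<forall>(U, \<phi>)\<in>atlas M. \<forall>(V, \<psi>)\<in>atlas N.
        smooth_on (\<phi> ` {x \<in> U \<inter> S. f x \<in> V}) (\<psi> \<circ> f \<circ> inv_into U \<phi>))"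

definition smooth_near ::
  "('a, 'e::euclidean_space, 'z) manifold_scheme \<Rightarrow> ('b, 'f::euclidean_space, 'y) manifold_scheme \<Rightarrow>
   ('a \<Rightarrow> 'b) \<Rightarrow> 'a \<Rightarrow> bool" where
  "smooth_near M N f x \<longleftrightarrow> (\<exists>W. x \<in> W \<and> smooth_map_on M N W f)"

definition diffeomorphism ::
  "('a, 'e::euclidean_space, 'z) manifold_scheme \<Rightarrow> ('b, 'f::euclidean_space, 'y) manifold_scheme \<Rightarrow>
   ('a \<Rightarrow> 'b) \<Rightarrow> bool" where
  "diffeomorphism M N f \<longleftrightarrow> bij_betw f (points M) (points N) \<and>
     smooth_map_on M N (points M) f \<and> smooth_map_on N M (points N) (inv_into (points M) f)"

definition smooth_chart :: "('a, 'e::euclidean_space, 'z) manifold_scheme \<Rightarrow> ('a, 'e) chart \<Rightarrow> bool" where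
  "smooth_chart M c \<longleftrightarrow> (case c of (U, u) \<Rightarrow> openin (mtop M) U \<and> open (u ` U) \<and>
     diffeomorphism (open_sub M U) (open_sub euclid (u ` U)) u)"

text \<open>The differential of \<open>f\<close> at \<open>x\<close> in the coordinates \<open>(U, \<phi>)\<close> of the source and \<open>\<psi>\<close> of the target.\<close>

definition coord_deriv ::
  "('a \<Rightarrow> 'b) \<Rightarrow> ('a, 'e::euclidean_space) chart \<Rightarrow> ('b \<Rightarrow> 'f::euclidean_space) \<Rightarrow> 'a \<Rightarrow> 'e \<Rightarrow> 'f" where
  "coord_deriv f c \<psi> x = (case c of (U, \<phi>) \<Rightarrow> frechet_derivative (\<psi> \<circ> f \<circ> inv_into U \<phi>) (at (\<phi> x)))"

text \<open>
  Near \<open>x\<close>, a diffeomorphism \<open>g\<close> of open subsets of the model space takes (the coordinate image of)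
  \<open>L\<close> to a \<open>k\<close>-dimensional linear subspace \<open>T\<close>, resp. to \<open>T\<close> or a closed half space of \<open>T\<close>.
\<close>

definition flattening :: "'e::euclidean_space set \<Rightarrow> ('e \<Rightarrow> 'e) \<Rightarrow> bool" where
  "flattening W g \<longleftrightarrow> open W \<and> open (g ` W) \<and> inj_on g W \<and> smooth_on W g \<and> smooth_on (g ` W) (inv_into W g)"

definition submanifold_at ::
  "('a, 'e::euclidean_space, 'z) manifold_scheme \<Rightarrow> nat \<Rightarrow> 'a set \<Rightarrow> 'a \<Rightarrow> bool" where
  "submanifold_at M k L x \<longleftrightarrow>
     (\<exists>(U, \<phi>)\<in>atlas M. x \<in> U \<and> (\<exists>W g T. \<phi> x \<in> W \<and> W \<subseteq> \<phi> ` U \<and> flattening W g \<and>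
        subspace T \<and> dim T = k \<and> g ` (W \<inter> \<phi> ` (U \<inter> L)) = g ` W \<inter> T))"

definition submanifold :: "('a, 'e::euclidean_space, 'z) manifold_scheme \<Rightarrow> nat \<Rightarrow> 'a set \<Rightarrow> bool" where
  "submanifold M k L \<longleftrightarrow> L \<subseteq> points M \<and> (\<forall>x\<in>L. submanifold_at M k L x)"

definition submanifold_with_boundary ::
  "('a, 'e::euclidean_space, 'z) manifold_scheme \<Rightarrow> nat \<Rightarrow> 'a set \<Rightarrow> bool" where
  "submanifold_with_boundary M k L \<longleftrightarrow> L \<subseteq> points M \<and>
     (\<forall>x\<in>L. \<exists>(U, \<phi>)\<in>atlas M. x \<in> U \<and> (\<exists>W g T a. \<phi> x \<in> W \<and> W \<subseteq> \<phi> ` U \<and> flattening W g \<and>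
        subspace T \<and> dim T = k \<and> g ` (W \<inter> \<phi> ` (U \<inter> L)) = g ` W \<inter> {y\<in>T. 0 \<le> a \<bullet> y}))"

text \<open>Velocities at \<open>x\<close>, in the coordinates \<open>(U, \<phi>)\<close>, of smooth curves contained in \<open>L\<close>.\<close>

definition tangent_set :: "('a, 'e::euclidean_space) chart \<Rightarrow> 'a set \<Rightarrow> 'a \<Rightarrow> 'e set" where
  "tangent_set c L x = (case c of (U, \<phi>) \<Rightarrow>
     {v. \<exists>\<gamma> \<epsilon>. 0 < \<epsilon> \<and> \<gamma> 0 = x \<and> (\<forall>t\<in>{-\<epsilon><..<\<epsilon>}. \<gamma> t \<in> U \<inter> L) \<and>
        smooth_on {-\<epsilon><..<\<epsilon>} (\<phi> \<circ> \<gamma>) \<and> ((\<phi> \<circ> \<gamma>) has_vector_derivative v) (at (0::real))})"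


section \<open>Symplectic manifolds\<close>

text \<open>
  A two-form is given by its coordinate expressions: \<open>form X \<phi> x v w\<close> is its value at \<open>x\<close> on the
  tangent vectors with components \<open>v\<close>, \<open>w\<close> in the chart with coordinate map \<open>\<phi>\<close>.
\<close>

record ('a, 'e) symp = "('a, 'e) manifold" +
  form :: "('a \<Rightarrow> 'e) \<Rightarrow> 'a \<Rightarrow> 'e \<Rightarrow> 'e \<Rightarrow> real"

text \<open>The last condition is closedness, \<open>d\<omega> = 0\<close>.\<close>

definition symplectic_manifold :: "('a, 'e::euclidean_space) symp \<Rightarrow> bool" where
  "symplectic_manifold X \<longleftrightarrow> smooth_manifold X \<and>
     (\<forall>(U, \<phi>)\<in>atlas X.
        (\<forall>x\<in>U. bilinear (form X \<phi> x) \<and> (\<forall>v. form X \<phi> x v v = 0) \<and>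
               (\<forall>v. (\<forall>w. form X \<phi> x v w = 0) \<longrightarrow> v = 0)) \<and>
        (\<forall>v w. smooth_on (\<phi> ` U) (\<lambda>y. form X \<phi> (inv_into U \<phi> y) v w)) \<and>
        (\<forall>(V, \<psi>)\<in>atlas X. \<forall>x\<in>U \<inter> V. \<forall>v w.
           form X \<psi> x (coord_deriv id (U, \<phi>) \<psi> x v) (coord_deriv id (U, \<phi>) \<psi> x w) = form X \<phi> x v w) \<and>
        (let \<omega> = (\<lambda>v w y. form X \<phi> (inv_into U \<phi> y) v w) in
         \<forall>x\<in>U. \<forall>a b c. frechet_derivative (\<omega> b c) (at (\<phi> x)) a + frechet_derivative (\<omega> c a) (at (\<phi> x)) b
             + frechet_derivative (\<omega> a b) (at (\<phi> x)) c = 0))"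

text \<open>\<open>F\<^sup>*\<omega>\<^sub>Y = c \<omega>\<^sub>X\<close>.\<close>

definition pulls_back_form ::
  "('a, 'e::euclidean_space) symp \<Rightarrow> ('b, 'f::euclidean_space) symp \<Rightarrow> real \<Rightarrow> ('a \<Rightarrow> 'b) \<Rightarrow> bool" where
  "pulls_back_form X Y c F \<longleftrightarrow>
     (\<forall>(U, \<phi>)\<in>atlas X. \<forall>(V, \<psi>)\<in>atlas Y. \<forall>x\<in>U. F x \<in> V \<longrightarrow> (\<forall>v w.
        form Y \<psi> (F x) (coord_deriv F (U, \<phi>) \<psi> x v) (coord_deriv F (U, \<phi>) \<psi> x w) = c * form X \<phi> x v w))"

definition symplectomorphism ::
  "('a, 'e::euclidean_space) symp \<Rightarrow> ('b, 'f::euclidean_space) symp \<Rightarrow> ('a \<Rightarrow> 'b) \<Rightarrow> bool" where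
  "symplectomorphism X Y F \<longleftrightarrow> diffeomorphism X Y F \<and> pulls_back_form X Y 1 F"

definition anti_symplectomorphism :: "('a, 'e::euclidean_space) symp \<Rightarrow> ('a \<Rightarrow> 'a) \<Rightarrow> bool" where
  "anti_symplectomorphism X F \<longleftrightarrow> diffeomorphism X X F \<and> pulls_back_form X X (-1) F"

text \<open>\<open>\<Sum> dx\<^sub>j \<and> dy\<^sub>j\<close> on \<open>\<real>\<^sup>n \<times> \<real>\<^sup>n\<close>, with points written \<open>(x, y)\<close>.\<close>

definition std_form :: "(real^'n) \<times> (real^'n) \<Rightarrow> (real^'n) \<times> (real^'n) \<Rightarrow> real" where
  "std_form v w = fst v \<bullet> snd w - snd v \<bullet> fst w"

text \<open>The symplectic manifold \<open>\<complex>\<^sup>n\<close>, with \<open>z\<^sub>j = x\<^sub>j + i y\<^sub>j\<close>.\<close>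

definition cspace :: "(complex^'n, (real^'n) \<times> (real^'n)) symp" where
  "cspace = \<lparr>mtop = euclidean, atlas = {(UNIV, \<lambda>z. (\<chi> j. Re (z $ j), \<chi> j. Im (z $ j)))},
     form = (\<lambda>_ _. std_form)\<rparr>"

definition lagrangian_submanifold :: "('a, (real^'n) \<times> (real^'n)) symp \<Rightarrow> 'a set \<Rightarrow> bool" where
  "lagrangian_submanifold X L \<longleftrightarrow> submanifold X CARD('n) L \<and>
     (\<forall>(U, \<phi>)\<in>atlas X. \<forall>x\<in>U \<inter> L. \<forall>v\<in>tangent_set (U, \<phi>) L x. \<forall>w\<in>tangent_set (U, \<phi>) L x.
        form X \<phi> x v w = 0)"


section \<open>Lagrangian fibrations\<close>

definition over :: "('a, 'e, 'z) manifold_scheme \<Rightarrow> ('a \<Rightarrow> 'b) \<Rightarrow> 'b set \<Rightarrow> 'a set" where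
  "over X f W = {x \<in> points X. f x \<in> W}"

definition lagrangian_fibration ::
  "('a, (real^'n) \<times> (real^'n)) symp \<Rightarrow> ('b, real^'n) manifold \<Rightarrow> ('a \<Rightarrow> 'b) \<Rightarrow> bool" where
  "lagrangian_fibration X B f \<longleftrightarrow>
     symplectic_manifold X \<and> smooth_manifold B \<and> continuous_map (mtop X) (mtop B) f \<and>
     (\<forall>b\<in>points B. \<exists>L. openin (subtopology (mtop X) (over X f {b})) L \<and>
        over X f {b} \<subseteq> mtop X closure_of L \<and> lagrangian_submanifold X L)"

text \<open>
  The singular set. Where \<open>f\<close> is smooth these are the points at which the differential is not
  surjective; a point near which \<open>f\<close> fails to be smooth is singular if the fibre through it is not a
  smooth submanifold of dimension \<open>n\<close> there (so the points across which a stitched fibration is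
  merely piecewise smooth need not be singular).
\<close>

definition crit ::
  "('a, (real^'n) \<times> (real^'n)) symp \<Rightarrow> ('b, real^'n) manifold \<Rightarrow> ('a \<Rightarrow> 'b) \<Rightarrow> 'a set" where
  "crit X B f = {x \<in> points X.
     if smooth_near X B f x
     then \<exists>(U, \<phi>)\<in>atlas X. \<exists>(V, \<psi>)\<in>atlas B. x \<in> U \<and> f x \<in> V \<and> \<not> surj (coord_deriv f (U, \<phi>) \<psi> x)
     else \<not> submanifold_at X CARD('n) (over X f {f x}) x}"

definition discriminant ::
  "('a, (real^'n) \<times> (real^'n)) symp \<Rightarrow> ('b, real^'n) manifold \<Rightarrow> ('a \<Rightarrow> 'b) \<Rightarrow> 'b set" where
  "discriminant X B f = f ` crit X B f"

text \<open>
  Away from the singular set, \<open>f\<close> is locally obtained by gluing finitely many smooth maps along a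
  finite closed cover. (At the singular set this fails already for the map \<open>\<gamma>\<close> below.)
\<close>

definition piecewise_smooth ::
  "('a, (real^'n) \<times> (real^'n)) symp \<Rightarrow> ('b, real^'n) manifold \<Rightarrow> ('a \<Rightarrow> 'b) \<Rightarrow> bool" where
  "piecewise_smooth X B f \<longleftrightarrow> continuous_map (mtop X) (mtop B) f \<and>
     (\<forall>x\<in>points X - crit X B f. \<exists>W \<F>. openin (mtop X) W \<and> x \<in> W \<and> finite \<F> \<and> W \<subseteq> \<Union>(fst ` \<F>) \<and>
        (\<forall>(C, g)\<in>\<F>. closedin (mtop X) C \<and> smooth_map_on X B W g \<and> (\<forall>y\<in>W \<inter> C. f y = g y)))"

definition smooth_proper_lagrangian_fibration ::
  "('a, (real^'n) \<times> (real^'n)) symp \<Rightarrow> ('b, real^'n) manifold \<Rightarrow> ('a \<Rightarrow> 'b) \<Rightarrow> bool" where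
  "smooth_proper_lagrangian_fibration X B f \<longleftrightarrow> lagrangian_fibration X B f \<and>
     smooth_map_on X B (points X) f \<and> proper_map (mtop X) (mtop B) f \<and>
     (\<forall>b\<in>points B. connectedin (mtop X) (over X f {b}))"

definition smooth_image_section ::
  "('a, (real^'n) \<times> (real^'n)) symp \<Rightarrow> ('b, real^'n) manifold \<Rightarrow> ('a \<Rightarrow> 'b) \<Rightarrow> ('b \<Rightarrow> 'a) \<Rightarrow> bool" where
  "smooth_image_section X B f \<sigma> \<longleftrightarrow> continuous_map (mtop B) (mtop X) \<sigma> \<and>
     (\<forall>b\<in>points B. f (\<sigma> b) = b) \<and> lagrangian_submanifold X (\<sigma> ` points B)"

definition lagrangian_section ::
  "('a, (real^'n) \<times> (real^'n)) symp \<Rightarrow> ('b, real^'n) manifold \<Rightarrow> ('a \<Rightarrow> 'b) \<Rightarrow> ('b \<Rightarrow> 'a) \<Rightarrow> bool" where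
  "lagrangian_section X B f \<sigma> \<longleftrightarrow> smooth_image_section X B f \<sigma> \<and>
     (\<forall>V. openin (mtop B) V \<and> smooth_map_on X B (over X f V) f \<longrightarrow> smooth_map_on B X V \<sigma>)"

text \<open>
  A neighbourhood of \<open>K\<close> in \<open>X\<close> is fibre-preservingly symplectomorphic to a neighbourhood of \<open>K'\<close>
  in \<open>X'\<close>; the bases are identified by a local diffeomorphism \<open>\<psi>\<close>.
\<close>

definition fibre_symplectomorphic_near ::
  "('a, (real^'n) \<times> (real^'n)) symp \<Rightarrow> ('b, real^'n) manifold \<Rightarrow> ('a \<Rightarrow> 'b) \<Rightarrow> 'a set \<Rightarrow>
   ('c, (real^'n) \<times> (real^'n)) symp \<Rightarrow> ('d, real^'n) manifold \<Rightarrow> ('c \<Rightarrow> 'd) \<Rightarrow> 'c set \<Rightarrow> bool" where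
  "fibre_symplectomorphic_near X B f K X' B' f' K' \<longleftrightarrow>
     (\<exists>U U' V V' \<Psi> \<psi>. openin (mtop X) U \<and> K \<subseteq> U \<and> openin (mtop X') U' \<and> K' \<subseteq> U' \<and>
        openin (mtop B) V \<and> f ` U \<subseteq> V \<and> openin (mtop B') V' \<and>
        symplectomorphism (open_sub X U) (open_sub X' U') \<Psi> \<and> \<Psi> ` K = K' \<and>
        diffeomorphism (open_sub B V) (open_sub B' V') \<psi> \<and> (\<forall>x\<in>U. f' (\<Psi> x) = \<psi> (f x)))"


section \<open>Smooth local models\<close>

text \<open>The plane curve formed by the three legs of the tropical line; it occurs in all vertex models.\<close>

definition leg :: "nat \<Rightarrow> (real^2) set" where
  "leg i = (if i = 0 then {w. w $ 1 = 0 \<and> w $ 2 \<le> 0}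
            else if i = 1 then {w. w $ 2 = 0 \<and> w $ 1 \<le> 0}
            else {w. w $ 1 = w $ 2 \<and> 0 \<le> w $ 1})"

definition tripod :: "(real^2) set" where
  "tripod = leg 0 \<union> leg 1 \<union> leg 2"

definition tail :: "real^3 \<Rightarrow> real^2" where
  "tail b = vector [b $ 2, b $ 3]"

text \<open>\<open>{0} \<times> S\<close>, for a subset \<open>S\<close> of the \<open>(b\<^sub>2, b\<^sub>3)\<close>-plane.\<close>

definition in_plane :: "(real^2) set \<Rightarrow> (real^3) set" where
  "in_plane S = {b. b $ 1 = 0 \<and> tail b \<in> S}"

text \<open>\<open>\<complex>\<^sup>2\<close> with \<open>z\<^sub>1 = y\<^sub>1 + i y\<^sub>2\<close>, \<open>z\<^sub>2 = x\<^sub>1 + i x\<^sub>2\<close> and \<open>\<omega> = \<Sum> dx\<^sub>j \<and> dy\<^sub>j\<close>.\<close>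

definition nodal_space :: "(complex^2, (real^2) \<times> (real^2)) symp" where
  "nodal_space = \<lparr>mtop = euclidean,
     atlas = {(UNIV, \<lambda>z. (vector [Re (z $ 2), Im (z $ 2)], vector [Re (z $ 1), Im (z $ 1)]))},
     form = (\<lambda>_ _. std_form)\<rparr>"

definition nodal_map :: "complex^2 \<Rightarrow> real^2" where
  "nodal_map z = (let w = z $ 1 * cnj (z $ 2) in vector [Re w, Im w])"

text \<open>In the following predicates \<open>B'\<close> is the base, an open subset of \<open>\<real>\<^sup>2\<close> or \<open>\<real>\<^sup>3\<close>.\<close>

definition nodal_fibration ::
  "('a, (real^2) \<times> (real^2)) symp \<Rightarrow> (real^2) set \<Rightarrow> ('a \<Rightarrow> real^2) \<Rightarrow> bool" where
  "nodal_fibration X B' f \<longleftrightarrow>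
     (\<exists>r>0. B' = ball 0 r) \<and> smooth_proper_lagrangian_fibration X (open_sub euclid B') f \<and>
     (\<exists>p. crit X (open_sub euclid B') f = {p} \<and> f p = 0 \<and>
        fibre_symplectomorphic_near X (open_sub euclid B') f {p} nodal_space euclid nodal_map {0})"

text \<open>
  \<open>\<complex>\<^sup>2 \<times> S\<^sup>1 \<times> (0,1)\<close> with the product symplectic form, \<open>dr \<and> d\<theta>\<close> on the second factor. The charts
  are the local inverses of the parametrisation \<open>generic_param\<close> on \<open>{(x, y). 0 < x\<^sub>3 < 1}\<close>, with
  \<open>r = x\<^sub>3\<close> and \<open>\<theta> = y\<^sub>3\<close>.
\<close>

definition generic_param :: "(real^3) \<times> (real^3) \<Rightarrow> (complex^2) \<times> complex \<times> real" where
  "generic_param p = (case p of (x, y) \<Rightarrow>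
     (vector [Complex (y $ 1) (y $ 2), Complex (x $ 1) (x $ 2)], cis (y $ 3), x $ 3))"

definition generic_space :: "((complex^2) \<times> complex \<times> real, (real^3) \<times> (real^3)) symp" where
  "generic_space = \<lparr>mtop = top_of_set (UNIV \<times> sphere 0 1 \<times> {0<..<1}),
     atlas = {(generic_param ` W, inv_into W generic_param) | W.
       open W \<and> W \<subseteq> {(x, y). 0 < x $ 3 \<and> x $ 3 < 1} \<and> inj_on generic_param W},
     form = (\<lambda>_ _. std_form)\<rparr>"

definition generic_map :: "(complex^2) \<times> complex \<times> real \<Rightarrow> real^3" where
  "generic_map p = (case p of (z, e, r) \<Rightarrow>
     (let w = z $ 1 * cnj (z $ 2) in vector [Re w, Im w, r]))"

definition generic_singular_fibration ::
  "('a, (real^3) \<times> (real^3)) symp \<Rightarrow> (real^3) set \<Rightarrow> ('a \<Rightarrow> real^3) \<Rightarrow> bool" where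
  "generic_singular_fibration X B' f \<longleftrightarrow>
     (\<exists>\<rho>>0. B' = {b. (b $ 1)\<^sup>2 + (b $ 2)\<^sup>2 < \<rho>\<^sup>2 \<and> 0 < b $ 3 \<and> b $ 3 < 1}) \<and>
     smooth_proper_lagrangian_fibration X (open_sub euclid B') f \<and>
     discriminant X (open_sub euclid B') f = {b. b $ 1 = 0 \<and> b $ 2 = 0 \<and> 0 < b $ 3 \<and> b $ 3 < 1} \<and>
     fibre_symplectomorphic_near X (open_sub euclid B') f (crit X (open_sub euclid B') f)
       generic_space euclid generic_map (crit generic_space euclid generic_map)"

definition positive_map :: "complex^3 \<Rightarrow> real^3" where
  "positive_map z = vector [Im (z $ 1 * z $ 2 * z $ 3),
     (norm (z $ 1))\<^sup>2 - (norm (z $ 2))\<^sup>2, (norm (z $ 1))\<^sup>2 - (norm (z $ 3))\<^sup>2]"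

definition positive_fibration ::
  "('a, (real^3) \<times> (real^3)) symp \<Rightarrow> (real^3) set \<Rightarrow> ('a \<Rightarrow> real^3) \<Rightarrow> bool" where
  "positive_fibration X B' f \<longleftrightarrow>
     (\<exists>c r. B' = ball c r) \<and> 0 \<in> B' \<and> smooth_proper_lagrangian_fibration X (open_sub euclid B') f \<and>
     discriminant X (open_sub euclid B') f = in_plane tripod \<inter> B' \<and>
     fibre_symplectomorphic_near X (open_sub euclid B') f (crit X (open_sub euclid B') f)
       cspace euclid positive_map (crit cspace euclid positive_map \<inter> positive_map -` B')"

text \<open>The fibration \<open>f\<close> is of type \<open>\<P>\<close> over some neighbourhood of \<open>K\<close>.\<close>

definition type_near ::
  "(('a, (real^'n) \<times> (real^'n)) symp \<Rightarrow> (real^'n) set \<Rightarrow> ('a \<Rightarrow> real^'n) \<Rightarrow> bool) \<Rightarrow>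
   ('a, (real^'n) \<times> (real^'n)) symp \<Rightarrow> ('b, real^'n) manifold \<Rightarrow> ('a \<Rightarrow> 'b) \<Rightarrow> 'b set \<Rightarrow> bool" where
  "type_near \<P> X B f K \<longleftrightarrow>
     (\<exists>N \<beta>. openin (mtop B) N \<and> K \<subseteq> N \<and> smooth_chart B (N, \<beta>) \<and>
        \<P> (open_sub X (over X f N)) (\<beta> ` N) (\<beta> \<circ> f))"


section \<open>Integral affine structures\<close>

definition integral_matrix :: "real^'n^'n \<Rightarrow> bool" where
  "integral_matrix A \<longleftrightarrow> (\<forall>i j. A $ i $ j \<in> \<int>)"

text \<open>Near \<open>x\<close>, \<open>v \<circ> h\<close> and \<open>u\<close> differ by an element of \<open>\<real>\<^sup>n \<rtimes> SL(n,\<int>)\<close>.\<close>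

definition affinely_related ::
  "'b topology \<Rightarrow> ('b \<Rightarrow> 'c) \<Rightarrow> ('b \<Rightarrow> real^'n) \<Rightarrow> ('c \<Rightarrow> real^'n) \<Rightarrow> 'b \<Rightarrow> bool" where
  "affinely_related T h u v x \<longleftrightarrow>
     (\<exists>W A a. openin T W \<and> x \<in> W \<and> integral_matrix A \<and> det A = 1 \<and> (\<forall>y\<in>W. v (h y) = A *v u y + a))"

definition integral_affine_atlas :: "'b topology \<Rightarrow> 'b set \<Rightarrow> ('b, real^'n) chart set \<Rightarrow> bool" where
  "integral_affine_atlas T W \<A> \<longleftrightarrow>
     openin T W \<and> (\<forall>c\<in>\<A>. top_chart T c) \<and> (\<Union>(U, u)\<in>\<A>. U) = W \<and>
     (\<forall>(U, u)\<in>\<A>. \<forall>(V, v)\<in>\<A>. \<forall>x\<in>U \<inter> V. affinely_related T id u v x)"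

definition restrict_atlas :: "('b, 'e) chart set \<Rightarrow> 'b set \<Rightarrow> ('b, 'e) chart set" where
  "restrict_atlas \<A> W = (\<lambda>(U, u). (U \<inter> W, u)) ` \<A>"

text \<open>
  A covector at \<open>b\<close> is given by its components \<open>\<xi> u\<close> in each chart \<open>(U, u)\<close> around \<open>b\<close>
  (with \<open>\<xi> u = 0\<close> for the other \<open>u\<close>).
\<close>

definition covectors :: "('b, real^'n) chart set \<Rightarrow> 'b \<Rightarrow> (('b \<Rightarrow> real^'n) \<Rightarrow> real^'n) set" where
  "covectors \<A> b = {\<xi>.
     (\<forall>(U, u)\<in>\<A>. \<forall>(V, v)\<in>\<A>. b \<in> U \<inter> V \<longrightarrow> (\<forall>w. \<xi> u \<bullet> w = \<xi> v \<bullet> coord_deriv id (U, u) v b w)) \<and>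
     (\<forall>u. (\<nexists>U. (U, u) \<in> \<A> \<and> b \<in> U) \<longrightarrow> \<xi> u = 0)}"

text \<open>The fibre at \<open>b\<close> of \<open>\<Lambda>\<close>: the integral combinations \<open>\<Sum> k\<^sub>i du\<^sub>i\<close>, which have components \<open>k\<^sub>i\<close> in \<open>u\<close>.\<close>

definition period_lattice :: "('b, real^'n) chart set \<Rightarrow> 'b \<Rightarrow> (('b \<Rightarrow> real^'n) \<Rightarrow> real^'n) set" where
  "period_lattice \<A> b = {\<xi> \<in> covectors \<A> b. \<forall>(U, u)\<in>\<A>. b \<in> U \<longrightarrow> (\<forall>i. \<xi> u $ i \<in> \<int>)}"

definition lattice_coset ::
  "('b, real^'n) chart set \<Rightarrow> 'b \<Rightarrow> (('b \<Rightarrow> real^'n) \<Rightarrow> real^'n) \<Rightarrow> (('b \<Rightarrow> real^'n) \<Rightarrow> real^'n) set" where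
  "lattice_coset \<A> b \<xi> = {\<lambda>u. \<xi> u + l u | l. l \<in> period_lattice \<A> b}"

text \<open>
  The quotient \<open>T\<^sup>*W/\<Lambda>\<close> for an integral affine manifold \<open>W\<close> with atlas \<open>\<A>\<close>, as a set of pairs (base
  point, coset). For \<open>(U, u) \<in> \<A>\<close>, \<open>cotangent_param\<close> sends \<open>(x, y)\<close> to the class of \<open>\<Sum> y\<^sub>i du\<^sub>i\<close> at the
  point with coordinates \<open>x\<close>; these maps define the quotient topology, and their local inverses are
  the charts. The form \<open>\<Sum> dx\<^sub>j \<and> dy\<^sub>j\<close> is the canonical one; the opposite sign convention gives a
  fibrewise isomorphic symplectic manifold (negate \<open>y\<close>).
\<close>

type_synonym ('b, 'n) torus_point = "'b \<times> (('b \<Rightarrow> real^'n) \<Rightarrow> real^'n) set"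

definition cotangent_param ::
  "('b, real^'n) chart set \<Rightarrow> ('b, real^'n) chart \<Rightarrow> (real^'n) \<times> (real^'n) \<Rightarrow> ('b, 'n) torus_point" where
  "cotangent_param \<A> c p = (case (c, p) of ((U, u), (x, y)) \<Rightarrow>
     (let b = inv_into U u x in (b, lattice_coset \<A> b (THE \<xi>. \<xi> \<in> covectors \<A> b \<and> \<xi> u = y))))"

definition cotangent_quotient ::
  "('b, real^'n) chart set \<Rightarrow> (('b, 'n) torus_point, (real^'n) \<times> (real^'n)) symp" where
  "cotangent_quotient \<A> = \<lparr>
     mtop = topology (\<lambda>S.
       S \<subseteq> (SIGMA b:(\<Union>(U, u)\<in>\<A>. U). lattice_coset \<A> b ` covectors \<A> b) \<and>
       (\<forall>(U, u)\<in>\<A>. open {p \<in> u ` U \<times> UNIV. cotangent_param \<A> (U, u) p \<in> S})),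
     atlas = {(cotangent_param \<A> (U, u) ` W, inv_into W (cotangent_param \<A> (U, u))) | U u W.
       (U, u) \<in> \<A> \<and> open W \<and> W \<subseteq> u ` U \<times> UNIV \<and> inj_on (cotangent_param \<A> (U, u)) W},
     form = (\<lambda>_ _. std_form)\<rparr>"

text \<open>
  \<open>(U, u)\<close> is a system of action coordinates: locally on \<open>U\<close>, \<open>f\<close> is symplectomorphic over the base to
  \<open>T\<^sup>*U/\<langle>du\<^sub>1, \<dots>, du\<^sub>n\<rangle>\<close>, i.e. \<open>u\<close> can be completed by angle coordinates of period one.
\<close>

definition action_chart ::
  "('a, (real^'n) \<times> (real^'n)) symp \<Rightarrow> ('b, real^'n) manifold \<Rightarrow> ('a \<Rightarrow> 'b) \<Rightarrow> ('b, real^'n) chart \<Rightarrow> bool" where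
  "action_chart X B f c \<longleftrightarrow> smooth_chart B c \<and>
     (case c of (U, u) \<Rightarrow> \<forall>b\<in>U. \<exists>V \<Theta>. openin (mtop B) V \<and> b \<in> V \<and> V \<subseteq> U \<and>
        symplectomorphism (cotangent_quotient {(V, u)}) (open_sub X (over X f V)) \<Theta> \<and>
        (\<forall>p\<in>points (cotangent_quotient {(V, u)}). f (\<Theta> p) = fst p))"

text \<open>\<open>\<A>\<close> is an atlas of the integral affine structure induced by \<open>f\<close> on the open subset \<open>W\<close> of the base.\<close>

definition induced_affine_structure ::
  "('a, (real^'n) \<times> (real^'n)) symp \<Rightarrow> ('b, real^'n) manifold \<Rightarrow> ('a \<Rightarrow> 'b) \<Rightarrow> 'b set \<Rightarrow>
   ('b, real^'n) chart set \<Rightarrow> bool" where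
  "induced_affine_structure X B f W \<A> \<longleftrightarrow>
     integral_affine_atlas (mtop B) W \<A> \<and> (\<forall>c\<in>\<A>. action_chart X B f c)"

text \<open>Local isomorphism at \<open>x\<close>, \<open>x'\<close>, extending to a homeomorphism matching the discriminants.\<close>

definition affine_local_iso ::
  "'b topology \<Rightarrow> 'b set \<Rightarrow> ('b, real^'n) chart set \<Rightarrow> 'b \<Rightarrow>
   'c topology \<Rightarrow> 'c set \<Rightarrow> ('c, real^'n) chart set \<Rightarrow> 'c \<Rightarrow> bool" where
  "affine_local_iso T \<Delta> \<A> x T' \<Delta>' \<A>' x' \<longleftrightarrow>
     (\<exists>N N' h. openin T N \<and> x \<in> N \<and> openin T' N' \<and>
        homeomorphic_map (subtopology T N) (subtopology T' N') h \<and> h x = x' \<and> h ` (N \<inter> \<Delta>) = N' \<inter> \<Delta>' \<and>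
        (\<forall>(U, u)\<in>\<A>. \<forall>(U', u')\<in>\<A>'. \<forall>y\<in>N \<inter> U. h y \<in> U' \<longrightarrow> affinely_related (subtopology T N) h u u' y))"

text \<open>
  Affine structure on the base of a fibration of type \<open>\<P>\<close>. The total space of the fibration is
  existentially quantified; as a second countable Hausdorff manifold it has at most the cardinality of
  the continuum, so its points may be taken in the type \<open>(real^'n) \<times> (real^'n)\<close>. Its topology is
  unrelated to the one of that type.
\<close>

definition affine_model ::
  "(((real^'n) \<times> (real^'n), (real^'n) \<times> (real^'n)) symp \<Rightarrow> (real^'n) set \<Rightarrow>
     ((real^'n) \<times> (real^'n) \<Rightarrow> real^'n) \<Rightarrow> bool) \<Rightarrow>
   (real^'n) set \<Rightarrow> (real^'n) set \<Rightarrow> (real^'n, real^'n) chart set \<Rightarrow> bool" where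
  "affine_model \<P> B' \<Delta>' \<A>' \<longleftrightarrow>
     (\<exists>X f. \<P> X B' f \<and> \<Delta>' = discriminant X (open_sub euclid B') f \<and>
        induced_affine_structure X (open_sub euclid B') f (B' - \<Delta>') \<A>')"

definition simple_affine_2manifold ::
  "('b, real^2) manifold \<Rightarrow> 'b set \<Rightarrow> ('b, real^2) chart set \<Rightarrow> bool" where
  "simple_affine_2manifold B \<Delta> \<A> \<longleftrightarrow>
     smooth_manifold B \<and> closedin (mtop B) \<Delta> \<and>
     (\<forall>x\<in>\<Delta>. \<exists>U. openin (mtop B) U \<and> U \<inter> \<Delta> = {x}) \<and>
     integral_affine_atlas (mtop B) (points B - \<Delta>) \<A> \<and>
     (\<forall>x\<in>\<Delta>. \<exists>B' \<Delta>' \<A>'. affine_model nodal_fibration B' \<Delta>' \<A>' \<and>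
        affine_local_iso (mtop B) \<Delta> \<A> x (top_of_set B') \<Delta>' \<A>' 0)"

text \<open>
  The negative vertex. \<open>g\<close> is a homeomorphism of the plane isotopic to the identity, \<open>Y = g ` tripod\<close>;
  the component \<open>C\<^sub>i\<close> is the image under \<open>g\<close> of the region where \<open>max(0, x\<^sub>2, x\<^sub>3)\<close> is uniquely
  attained by its \<open>i\<close>-th entry.
\<close>

definition negative_curve_map :: "(real^2 \<Rightarrow> real^2) \<Rightarrow> bool" where
  "negative_curve_map g \<longleftrightarrow>
     (\<exists>H. continuous_on ({0..1::real} \<times> UNIV) (\<lambda>(t, w). H t w) \<and> H 0 = id \<and> H 1 = g \<and>
        (\<forall>t\<in>{0..1}. homeomorphic_map euclidean euclidean (H t))) \<and>
     g 0 = 0 \<and> (\<forall>i<3. submanifold euclid 1 (g ` leg i - {0}))"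

definition tropical_region :: "nat \<Rightarrow> (real^2) set" where
  "tropical_region i = (if i = 0 then {w. w $ 1 < 0 \<and> w $ 2 < 0}
            else if i = 1 then {w. 0 < w $ 1 \<and> w $ 2 < w $ 1}
            else {w. 0 < w $ 2 \<and> w $ 1 < w $ 2})"

definition shear_vector :: "nat \<Rightarrow> real^3" where
  "shear_vector i = (if i = 0 then 0 else if i = 1 then vector [0, 1, 0] else vector [0, 0, 1])"

definition negative_affine_atlas :: "(real^2 \<Rightarrow> real^2) \<Rightarrow> (real^3, real^3) chart set" where
  "negative_affine_atlas g = {({b. b $ 1 < 0}, id), ({b. 0 < b $ 1}, id)} \<union>
     {({b. tail b \<in> g ` tropical_region i}, \<lambda>b. if b $ 1 \<le> 0 then b else b + b $ 1 *\<^sub>R shear_vector i) | i.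
        i < 3}"

text \<open>\<open>P\<close> and \<open>N\<close> are the sets of positive and negative vertices of the graph \<open>\<Delta>\<close>.\<close>

definition simple_affine_3manifold ::
  "('b, real^3) manifold \<Rightarrow> 'b set \<Rightarrow> 'b set \<Rightarrow> 'b set \<Rightarrow> ('b, real^3) chart set \<Rightarrow> bool" where
  "simple_affine_3manifold B \<Delta> P N \<A> \<longleftrightarrow>
     smooth_manifold B \<and> closedin (mtop B) \<Delta> \<and> P \<subseteq> \<Delta> \<and> N \<subseteq> \<Delta> \<and> P \<inter> N = {} \<and>
     integral_affine_atlas (mtop B) (points B - \<Delta>) \<A> \<and>
     (\<forall>x\<in>\<Delta> - (P \<union> N). \<exists>B' \<Delta>' \<A>' x'. affine_model generic_singular_fibration B' \<Delta>' \<A>' \<and>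
        affine_local_iso (mtop B) \<Delta> \<A> x (top_of_set B') \<Delta>' \<A>' x') \<and>
     (\<forall>x\<in>P. \<exists>B' \<Delta>' \<A>'. affine_model positive_fibration B' \<Delta>' \<A>' \<and>
        affine_local_iso (mtop B) \<Delta> \<A> x (top_of_set B') \<Delta>' \<A>' 0) \<and>
     (\<forall>x\<in>N. \<exists>g. negative_curve_map g \<and>
        affine_local_iso (mtop B) \<Delta> \<A> x euclidean (in_plane (g ` tripod)) (negative_affine_atlas g) 0)"


section \<open>Negative fibrations\<close>

definition mu :: "complex^3 \<Rightarrow> real" where
  "mu z = ((norm (z $ 1))\<^sup>2 - (norm (z $ 2))\<^sup>2) / 2"

definition gamma :: "complex^3 \<Rightarrow> complex" where
  "gamma z = (if mu z \<ge> 0 then z $ 1 * z $ 2 / of_real (norm (z $ 1))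
              else z $ 1 * z $ 2 / of_real (norm (z $ 2)))"

definition reduce :: "complex^3 \<Rightarrow> complex^2" where
  "reduce z = vector [gamma z, z $ 3]"

definition conj_vec :: "complex^2 \<Rightarrow> complex^2" where
  "conj_vec u = (\<chi> i. cnj (u $ i))"

text \<open>
  The symplectomorphism \<open>\<Phi>\<close>; it equals \<open>\<Psi>\<close> outside the slightly larger regions defined by \<open>\<epsilon>' > \<epsilon>\<close> and
  \<open>M' < M\<close>, which are still required to be pairwise disjoint.
\<close>

definition leg_pinching_map :: "(complex^2 \<Rightarrow> complex^2) \<Rightarrow> bool" where
  "leg_pinching_map \<Phi> \<longleftrightarrow> symplectomorphism cspace cspace \<Phi> \<and> (\<forall>u. \<Phi> (conj_vec u) = conj_vec (\<Phi> u)) \<and>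
     (\<exists>\<epsilon> \<epsilon>' M M'. 0 < \<epsilon> \<and> \<epsilon> < \<epsilon>' \<and> 0 < M' \<and> M' < M \<and>
        2 * sqrt \<epsilon>' < sqrt 2 \<and> sqrt 2 + sqrt \<epsilon>' < sqrt M' \<and>
        (\<forall>u. (norm (u $ 1))\<^sup>2 + (norm (u $ 2))\<^sup>2 \<le> \<epsilon> \<longrightarrow> \<Phi> u = vector [- (u $ 2), u $ 1 - 1]) \<and>
        (\<forall>u. (norm (u $ 1))\<^sup>2 + (norm (u $ 2 - sqrt 2))\<^sup>2 \<le> \<epsilon> \<longrightarrow>
             \<Phi> u = vector [u $ 1 - 1, u $ 2 - sqrt 2]) \<and>
        (\<forall>u. M \<le> (norm (u $ 2))\<^sup>2 \<longrightarrow>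
             \<Phi> u = vector [(u $ 1 - u $ 2) / sqrt 2, (u $ 1 + u $ 2) / sqrt 2]) \<and>
        (\<forall>u. \<epsilon>' < (norm (u $ 1))\<^sup>2 + (norm (u $ 2))\<^sup>2 \<and> \<epsilon>' < (norm (u $ 1))\<^sup>2 + (norm (u $ 2 - sqrt 2))\<^sup>2 \<and>
             (norm (u $ 2))\<^sup>2 < M' \<longrightarrow>
             \<Phi> u = vector [(u $ 1 - u $ 2) / sqrt 2, (u $ 1 + u $ 2 - sqrt 2) / sqrt 2]))"

definition negative_model_space ::
  "(complex^2 \<Rightarrow> complex^2) \<Rightarrow> (complex^3, (real^3) \<times> (real^3)) symp" where
  "negative_model_space \<Phi> = open_sub cspace {z. \<Phi> (reduce z) $ 1 \<noteq> 0 \<and> \<Phi> (reduce z) $ 2 \<noteq> 0}"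

definition negative_model_map :: "(complex^2 \<Rightarrow> complex^2) \<Rightarrow> complex^3 \<Rightarrow> real^3" where
  "negative_model_map \<Phi> z =
     vector [mu z, ln (norm (\<Phi> (reduce z) $ 1)), ln (norm (\<Phi> (reduce z) $ 2))]"

definition topologically_conjugate_near_discriminants ::
  "('a, (real^'n) \<times> (real^'n)) symp \<Rightarrow> ('b, real^'n) manifold \<Rightarrow> ('a \<Rightarrow> 'b) \<Rightarrow>
   ('c, (real^'n) \<times> (real^'n)) symp \<Rightarrow> ('d, real^'n) manifold \<Rightarrow> ('c \<Rightarrow> 'd) \<Rightarrow> bool" where
  "topologically_conjugate_near_discriminants X B f X' B' f' \<longleftrightarrow>
     (\<exists>N N' H h. openin (mtop B) N \<and> discriminant X B f \<subseteq> N \<and>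
        openin (mtop B') N' \<and> discriminant X' B' f' \<subseteq> N' \<and>
        homeomorphic_map (subtopology (mtop X) (over X f N)) (subtopology (mtop X') (over X' f' N')) H \<and>
        homeomorphic_map (subtopology (mtop B) N) (subtopology (mtop B') N') h \<and>
        (\<forall>x\<in>over X f N. f' (H x) = h (f x)) \<and> h ` discriminant X B f = discriminant X' B' f')"

text \<open>
  \<open>h\<close> identifies the base, outside the disc \<open>D\<close>, with a neighbourhood \<open>V\<close> of the vertex in the affine
  model of a negative vertex; the vertex lies on \<open>h ` D\<close>, and the discriminants agree outside \<open>D\<close>.
\<close>

definition lagrangian_negative_fibration ::
  "('a, (real^3) \<times> (real^3)) symp \<Rightarrow> (real^3) set \<Rightarrow> ('a \<Rightarrow> real^3) \<Rightarrow> bool" where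
  "lagrangian_negative_fibration X B' f \<longleftrightarrow>
     (let B = open_sub euclid B'; \<Delta> = discriminant X B f in
      open B' \<and> lagrangian_fibration X B f \<and> piecewise_smooth X B f \<and>
      (\<exists>\<Phi>. leg_pinching_map \<Phi> \<and>
         topologically_conjugate_near_discriminants X B f
           (negative_model_space \<Phi>) euclid (negative_model_map \<Phi>)) \<and>
      (\<exists>D. submanifold_with_boundary B 2 D \<and> D homeomorphic cball (0::real^2) 1 \<and>
         (\<exists>s :: nat \<Rightarrow> (real^3) set. (\<Union>i<3. s i) = \<Delta> - D \<and> disjoint_family_on s {..<3} \<and>
            (\<forall>i<3. openin (top_of_set (\<Delta> - D)) (s i) \<and> s i homeomorphic {0<..<1::real})) \<and>
         smooth_map_on X B (points X - over X f D) f \<and>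
         (\<exists>g h V \<A>. negative_curve_map g \<and> open V \<and> 0 \<in> h ` D \<and>
            homeomorphic_map (top_of_set B') (top_of_set V) h \<and>
            h ` (\<Delta> - D) = V \<inter> in_plane (g ` tripod) - h ` D \<and>
            induced_affine_structure X B f (B' - (D \<union> \<Delta>)) \<A> \<and>
            (\<forall>(U, u)\<in>\<A>. \<forall>(U', u')\<in>negative_affine_atlas g. \<forall>y\<in>U. h y \<in> U' \<longrightarrow>
               affinely_related (top_of_set B') h u u' y))) \<and>
      (\<exists>\<sigma>. smooth_image_section X B f \<sigma> \<and> \<sigma> ` B' \<inter> crit X B f = {}))"


section \<open>The class of fibrations\<close>

text \<open>The amoeba of the line \<open>v\<^sub>1 + v\<^sub>2 + 1 = 0\<close>. It contains \<open>tripod\<close>, which runs down the middle of its legs.\<close>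

definition line_amoeba :: "(real^2) set" where
  "line_amoeba = {vector [ln (norm v\<^sub>1), ln (norm v\<^sub>2)] | v\<^sub>1 v\<^sub>2 :: complex.
     v\<^sub>1 \<noteq> 0 \<and> v\<^sub>2 \<noteq> 0 \<and> v\<^sub>1 + v\<^sub>2 + 1 = 0}"

definition amoeba_body :: "real \<Rightarrow> (real^2) set" where
  "amoeba_body r = line_amoeba \<inter> cball 0 r"

definition pinched_amoeba :: "real \<Rightarrow> (real^2) set" where
  "pinched_amoeba r = amoeba_body r \<union> tripod"

text \<open>
  \<open>Nb p\<close> is the neighbourhood of the negative vertex \<open>p\<close> in which the trivalent graph \<open>\<Delta>\<close> is replaced
  by a pinched amoeba, both up to homeomorphisms of \<open>Nb p\<close> with \<open>\<real>\<^sup>3\<close>; the two-dimensional part of the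
  amoeba is contained in the disc \<open>D p\<close>, outside of which nothing changes.
\<close>

definition localized_thickening ::
  "'b topology \<Rightarrow> 'b set \<Rightarrow> 'b set \<Rightarrow> 'b set \<Rightarrow> 'b set \<Rightarrow> ('b \<Rightarrow> 'b set) \<Rightarrow> bool" where
  "localized_thickening T \<Delta> P N \<Delta>th D \<longleftrightarrow>
     closedin T \<Delta>th \<and> \<Delta>th - (\<Union>p\<in>N. D p) = \<Delta> - (\<Union>p\<in>N. D p) \<and>
     (\<exists>Nb. disjoint_family_on Nb N \<and>
        (\<forall>p\<in>N. openin T (Nb p) \<and> Nb p \<inter> (P \<union> N) = {p} \<and>
           p \<in> D p \<and> D p \<subseteq> Nb p \<and> subtopology T (D p) homeomorphic_space top_of_set (cball (0::real^2) 1) \<and>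
           (\<exists>k. homeomorphic_map (subtopology T (Nb p)) euclidean k \<and> k p = 0 \<and>
              k ` (Nb p \<inter> \<Delta>) = in_plane tripod) \<and>
           (\<exists>k r. 0 < r \<and> homeomorphic_map (subtopology T (Nb p)) euclidean k \<and>
              k ` (Nb p \<inter> \<Delta>th) = in_plane (pinched_amoeba r) \<and>
              in_plane (amoeba_body r) \<subseteq> k ` D p)))"

text \<open>
  Over \<open>W\<close>, where the affine charts are smooth charts of \<open>B\<close>, \<open>f\<close> is symplectomorphic to \<open>T\<^sup>*W/\<Lambda>\<close> by a
  map covering the inclusion of \<open>W\<close>.
\<close>

definition cotangent_quotient_over ::
  "('a, (real^'n) \<times> (real^'n)) symp \<Rightarrow> ('b, real^'n) manifold \<Rightarrow> ('a \<Rightarrow> 'b) \<Rightarrow>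
   ('b, real^'n) chart set \<Rightarrow> 'b set \<Rightarrow> bool" where
  "cotangent_quotient_over X B f \<A> W \<longleftrightarrow>
     (\<forall>c\<in>restrict_atlas \<A> W. smooth_chart B c) \<and>
     (\<exists>\<Theta>. symplectomorphism (cotangent_quotient (restrict_atlas \<A> W)) (open_sub X (over X f W)) \<Theta> \<and>
        (\<forall>p\<in>points (cotangent_quotient (restrict_atlas \<A> W)). f (\<Theta> p) = fst p))"

definition class_C_dim6 ::
  "('a, (real^3) \<times> (real^3)) symp \<Rightarrow> ('b, real^3) manifold \<Rightarrow> ('a \<Rightarrow> 'b) \<Rightarrow> bool" where
  "class_C_dim6 X B f \<longleftrightarrow>
     lagrangian_fibration X B f \<and> piecewise_smooth X B f \<and>
     compact_space (mtop X) \<and> compact_space (mtop B) \<and>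
     (\<exists>\<Delta> P N \<A> \<Delta>th D.
        simple_affine_3manifold B \<Delta> P N \<A> \<and> localized_thickening (mtop B) \<Delta> P N \<Delta>th D \<and>
        smooth_map_on X B (points X - over X f (\<Union>p\<in>N. D p)) f \<and>
        discriminant X B f = \<Delta>th \<and>
        cotangent_quotient_over X B f \<A> (points B - (\<Delta> \<union> (\<Union>p\<in>N. D p))) \<and>
        (\<forall>p\<in>P. type_near positive_fibration X B f {p}) \<and>
        (\<forall>x\<in>\<Delta> - (P \<union> N) - (\<Union>p\<in>N. D p). type_near generic_singular_fibration X B f {x}) \<and>
        (\<forall>p\<in>N. type_near lagrangian_negative_fibration X B f (D p)) \<and>
        (\<exists>\<sigma>. smooth_image_section X B f \<sigma> \<and> \<sigma> ` points B \<inter> crit X B f = {}))"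

definition class_C_dim4 ::
  "('a, (real^2) \<times> (real^2)) symp \<Rightarrow> ('b, real^2) manifold \<Rightarrow> ('a \<Rightarrow> 'b) \<Rightarrow> bool" where
  "class_C_dim4 X B f \<longleftrightarrow>
     lagrangian_fibration X B f \<and> compact_space (mtop X) \<and> compact_space (mtop B) \<and>
     (\<exists>\<Delta> \<A>. simple_affine_2manifold B \<Delta> \<A> \<and>
        cotangent_quotient_over X B f \<A> (points B - \<Delta>) \<and>
        (\<forall>x\<in>\<Delta>. type_near nodal_fibration X B f {x}) \<and>
        (\<exists>\<sigma>. lagrangian_section X B f \<sigma> \<and> \<sigma> ` points B \<inter> crit X B f = {}))"

end

theory Submission
  imports Defs
begin

text \<open>
  Over the integral affine part \<open>W\<close> of the base, \<open>f\<close> is \<open>T\<^sup>*W/\<Lambda> \<rightarrow> W\<close>. A map over the identity of \<open>W\<close>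
  that multiplies \<open>\<Sum> dx\<^sub>i \<and> dy\<^sub>i\<close> by \<open>s\<close> has fibre derivative \<open>s\<close>, so on each torus it is
  \<open>y \<mapsto> a + s y\<close>. Hence \<open>\<phi>\<close> is \<open>y \<mapsto> a - y\<close> and \<open>t\<close> is \<open>y \<mapsto> a' + y\<close>; both \<open>\<phi>\<^sup>2 = id\<close> and
  \<open>\<phi> = t \<phi> t\<close> hold on these tori, and by continuity everywhere once the tori are dense in \<open>X\<close>.

  In dimension 4 density holds because a fibre has a dense part that is a surface. In dimension 6,
  the complement of \<open>W\<close> has empty interior, so it suffices that \<open>f\<close> maps no nonempty open set \<open>G\<close>
  onto a set without interior. If \<open>f\<close> is smooth on \<open>G\<close>, either it is a submersion somewhere, or near
  a point of maximal rank the fibres contain discs of dimension greater than 3, against the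
  Lagrangian condition. Where \<open>f\<close> is not even piecewise smooth, the topological model of a negative
  fibration is used instead.
\<close>

section \<open>Fibres of maps of non-maximal rank\<close>

text \<open>The factor \<open>s\<close> in the fibre derivative comes from pairing a vertical vector
  with a horizontal one: the base component of the derivative is the identity, so only the vertical
  block enters. The resulting formula is proved first on small balls, since a chart of the quotient
  sees less than one period. The constant \<open>a\<close> is determined only up to an integer
  vector, so the local formulas are joined by a connectedness argument.

  Density is the real obstacle: a merely continuous \<open>f\<close> could collapse an open set into
  the discriminant or into a disc. A fibre is known to be a submanifold only on a dense part, whose
  points cannot be prescribed. The rank argument therefore has to produce discs through all points
  of a fibre in some open set; the dense part meets that set, and invariance of dimension bounds the
  disc through such a point.\<close>

lemma linear_inj_on_if_dim_le_dim_image: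
  fixes f :: "'a::euclidean_space \<Rightarrow> 'b::euclidean_space"
  assumes "linear f" and "subspace V" and "dim V \<le> dim (f ` V)"
  shows "inj_on f V"
proof -
  obtain B where B: "B \<subseteq> V" "independent B" "V \<subseteq> span B" "card B = dim V"
    using basis_exists by blast
  have "finite B"
    using B(2) finiteI_independent by blast
  have V: "V = span B"
    using B \<open>subspace V\<close> by (simp add: span_subspace)
  have image: "f ` V = span (f ` B)"
    by (simp add: V \<open>linear f\<close> linear_span_image)
  have "dim (f ` V) \<le> card (f ` B)"
    using \<open>finite B\<close> by (simp add: image span_card_ge_dim span_superset)
  then have "card B \<le> card (f ` B)"
    using assms(3) B(4) by linarith
  then have card: "card (f ` B) = card B"
    using card_image_le[OF \<open>finite B\<close>] le_antisym by blast
  have "independent (f ` B)"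
  proof (rule card_le_dim_spanning)
    show "f ` B \<subseteq> f ` V" using B(1) by blast
    show "f ` V \<subseteq> span (f ` B)" by (simp add: image)
    show "finite (f ` B)" using \<open>finite B\<close> by simp
    show "card (f ` B) \<le> dim (f ` V)" using assms(3) B(4) card by simp
  qed
  then show ?thesis
    unfolding V using linear_inj_on_span_independent_image[OF \<open>linear f\<close>] eq_card_imp_inj_on[OF \<open>finite B\<close> card]
    by blast
qed

text \<open>\<open>C_k_on\<close> controls the derivative one direction at a time. In finite
  dimension this already gives continuity in operator norm, the form in which the inverse function
  theorem takes its derivative.\<close>

lemma blinfun_differentialE:
  fixes F :: "'e::euclidean_space \<Rightarrow> 'f::euclidean_space"
  assumes "C_k_on 1 F S"
  obtains D where "\<And>p. p \<in> S \<Longrightarrow> (F has_derivative blinfun_apply (D p)) (at p)"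
    and "\<And>p. p \<in> S \<Longrightarrow> blinfun_apply (D p) = frechet_derivative F (at p)"
    and "continuous_on S D"
proof -
  have F: "F differentiable (at p)" if "p \<in> S" for p
    using assms that by simp
  have cont: "continuous_on S (\<lambda>p. frechet_derivative F (at p) v)" for v
    using assms by simp
  define D where "D p = Blinfun (frechet_derivative F (at p))" for p
  have D: "blinfun_apply (D p) = frechet_derivative F (at p)" if "p \<in> S" for p
    unfolding D_def
    by (meson F bounded_linear_Blinfun_apply frechet_derivative_works has_derivative_bounded_linear that)
  show thesis
  proof (rule that)
    show "(F has_derivative blinfun_apply (D p)) (at p)" if "p \<in> S" for p
      using D F frechet_derivative_works that by metis
    show "continuous_on S D"
      by (rule continuous_on_blinfun_componentwise) (use cont D in \<open>simp cong: continuous_on_cong\<close>)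
  qed (use D in auto)
qed

text \<open>An injectively parametrised topological disc inside the fibre of \<open>f\<close>
  through \<open>x\<close>. The parameter domain is an open part of a subspace \<open>K\<close>,
  since its dimension is that of a kernel and is not fixed by a type. Only continuity and
  injectivity are recorded because the disc is used through invariance of dimension.\<close>

definition fibre_disc ::
  "'a topology \<Rightarrow> ('a \<Rightarrow> 'b) \<Rightarrow> 'g::euclidean_space set \<Rightarrow> 'g set \<Rightarrow> ('g \<Rightarrow> 'a) \<Rightarrow> 'a \<Rightarrow> bool" where
  "fibre_disc T f K A j x \<longleftrightarrow> subspace K \<and> openin (top_of_set K) A \<and> continuous_map (top_of_set A) T j \<and>
     inj_on j A \<and> x \<in> j ` A \<and> (\<forall>a\<in>A. f (j a) = f x)"

text \<open>
  At a point \<open>p0\<close> of maximal rank choose a generalised inverse \<open>M\<close> of \<open>D = F'(p0)\<close>. The map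
  \<open>G p = M (F p) + (p - M (D p))\<close> has derivative \<open>id\<close> at \<open>p0\<close>, and in the coordinates \<open>G\<close> the map \<open>F\<close> does
  not depend on the directions of \<open>ker D\<close>, because its rank cannot exceed that of \<open>M \<circ> F\<close>.
\<close>

proposition degenerate_map_fibres:
  fixes F :: "'e::euclidean_space \<Rightarrow> 'f::euclidean_space"
  assumes "open S" and "S \<noteq> {}" and F: "C_k_on 1 F S"
    and nonsurj: "\<And>p. p \<in> S \<Longrightarrow> \<not> surj (frechet_derivative F (at p))"
  obtains S' where "open S'" "S' \<noteq> {}" "S' \<subseteq> S"
    and "\<And>p. p \<in> S' \<Longrightarrow> \<exists>K A j. fibre_disc euclidean F (K :: 'e set) A j p \<and> j ` A \<subseteq> S' \<and>
      DIM('e) < dim K + DIM('f)"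
proof -
  obtain D where D: "\<And>p. p \<in> S \<Longrightarrow> (F has_derivative blinfun_apply (D p)) (at p)"
    and D_eq: "\<And>p. p \<in> S \<Longrightarrow> blinfun_apply (D p) = frechet_derivative F (at p)"
    and contD: "continuous_on S D"
    using blinfun_differentialE[OF F] by blast
  have linD: "linear (blinfun_apply (D p))" for p
    using blinfun.bounded_linear_right bounded_linear.linear by blast
  obtain p0 where p0: "p0 \<in> S" and max: "\<And>p. p \<in> S \<Longrightarrow> dim (range (D p)) \<le> dim (range (D p0))"
  proof -
    obtain p where "p \<in> S" using \<open>S \<noteq> {}\<close> by blast
    then have "\<exists>p. p \<in> S \<and> (\<forall>q. q \<in> S \<longrightarrow> dim (range (D q)) \<le> dim (range (D p)))"
      by (rule ex_has_greatest_nat[where b = "Suc DIM('f)"]) (simp_all add: dim_subset_UNIV less_Suc_eq_le)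
    then show thesis using that by blast
  qed
  define d where "d = blinfun_apply (D p0)"
  have lind: "linear d" by (simp add: d_def linD)
  obtain M0 where M0: "linear M0" "\<And>w. w \<in> range d \<Longrightarrow> d (M0 w) = w"
    using linear_exists_right_inverse_on[OF lind subspace_UNIV] by auto
  \<comment> \<open>\<open>M0\<close> inverts \<open>d\<close> only on the range of
    \<open>d\<close>. The sandwich is a reflexive generalised inverse: d M d = d and M d M =
    M.\<close>
  define M where "M = M0 \<circ> d \<circ> M0"
  have linM: "linear M"
    unfolding M_def by (intro linear_compose M0(1) lind)
  have dM: "d (M (d v)) = d v" for v
    by (simp add: M_def M0(2))
  have dM_inj: "M w = 0" if "d (M w) = 0" for w
    using that M0 by (simp add: M_def linear_0)
  define K where "K = {v. d v = 0}"
  have subK: "subspace K"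
    unfolding K_def using lind by (rule linear_subspace_kernel)
  have "\<not> surj d"
    using nonsurj[OF p0] D_eq[OF p0] by (simp add: d_def)
  then have rank: "dim (range d) < DIM('f)"
    by (metis dim_eq_full dim_subset_UNIV lind linear_subspace_image nat_less_le span_eq_iff subspace_UNIV)
  \<comment> \<open>The kernel has the dimension of the source minus the rank, and the rank is below
    the dimension of the target because \<open>d\<close> is not onto. The strictness is what later
    contradicts the Lagrangian dimension.\<close>
  have "DIM('e) < dim K + DIM('f)"
  proof -
    have "UNIV = {x + y |x y. x \<in> K \<and> y \<in> range (M \<circ> d)}"
    proof -
      have "\<exists>x y. v = x + y \<and> x \<in> K \<and> y \<in> range (M \<circ> d)" for v
        by (rule exI[of _ "v - M (d v)"], rule exI[of _ "M (d v)"])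
          (auto simp: K_def linear_diff[OF lind] dM)
      then show ?thesis by blast
    qed
    moreover have "subspace (range (M \<circ> d))"
      by (intro linear_subspace_image linear_compose lind linM subspace_UNIV)
    ultimately have "DIM('e) \<le> dim K + dim (range (M \<circ> d))"
      using dim_sums_Int[OF subK, of "range (M \<circ> d)"] by (metis dim_UNIV le_add1)
    moreover have "dim (range (M \<circ> d)) \<le> dim (range d)"
      using dim_image_le[OF linM, of "range d"] by (simp add: image_comp)
    ultimately show ?thesis using rank by linarith
  qed
  define Q where "Q v = v - M (d v)" for v
  have linQ: "linear Q"
    unfolding Q_def using linear_compose_sub[OF linear_id linear_compose[OF lind linM]] by (simp add: o_def)
  have dQ: "d (Q v) = 0" for v
    by (simp add: Q_def linear_diff[OF lind] dM)
  define G where "G p = M (F p) + Q p" for p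
  define G' where "G' p = (Blinfun M o\<^sub>L D p) + Blinfun Q" for p
  have blM: "blinfun_apply (Blinfun M) = M" and blQ: "blinfun_apply (Blinfun Q) = Q"
    using linM linQ by (auto simp: bounded_linear_Blinfun_apply linear_conv_bounded_linear)
  have G'_apply: "blinfun_apply (G' p) v = M (D p v) + Q v" for p v
    by (simp add: G'_def blM blQ blinfun.add_left)
  have derG: "(G has_derivative blinfun_apply (G' p)) (at p)" if "p \<in> S" for p
  proof -
    have "((\<lambda>p. M (F p) + Q p) has_derivative (\<lambda>v. M (D p v) + Q v)) (at p)"
      by (intro derivative_intros has_derivative_compose[OF D[OF that]] linear_imp_has_derivative linM linQ
          bounded_linear.has_derivative[OF _ D[OF that]])
        (use linM in \<open>simp_all add: linear_conv_bounded_linear\<close>)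
    moreover have "blinfun_apply (G' p) = (\<lambda>v. M (D p v) + Q v)"
      by (simp add: fun_eq_iff G'_apply)
    ultimately show ?thesis by (simp add: G_def[abs_def])
  qed
  have contG': "continuous_on S G'"
    unfolding G'_def by (intro continuous_intros contD)
  \<comment> \<open>At \<open>p0\<close> the summand \<open>M (D p0 v)\<close> cancels the
    correction in \<open>Q v\<close>, so the inverse function theorem applies to
    \<open>G\<close>.\<close>
  have "id_blinfun o\<^sub>L G' p0 = id_blinfun"
    by (rule blinfun_eqI) (simp add: G'_apply d_def[symmetric] Q_def)
  then obtain U V g g' where ift: "open U" "U \<subseteq> S" "p0 \<in> U" "open V" "G p0 \<in> V" "homeomorphism U V G g"
    "\<And>y. y \<in> V \<Longrightarrow> (g has_derivative (g' y)) (at y)"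
    "\<And>y. y \<in> V \<Longrightarrow> g' y = inv (blinfun_apply (G' (g y)))"
    "\<And>y. y \<in> V \<Longrightarrow> bij (blinfun_apply (G' (g y)))"
    using inverse_function_theorem[OF \<open>open S\<close> derG contG' p0] by blast
  have gV: "g y \<in> S" if "y \<in> V" for y
    using ift(2,6) that by (auto simp: homeomorphism_def)
  \<comment> \<open>As \<open>d\<close> kills \<open>Q\<close>, surjectivity of
    \<open>G' (g y)\<close> shows that d M maps the range of \<open>D (g y)\<close> onto at least
    the range of \<open>d\<close>. By maximality of the rank at \<open>p0\<close> the former is not
    larger, so d M is injective on it. For \<kappa> in \<open>K\<close> the vector
    \<open>g' y \<kappa>\<close> is sent by \<open>G' (g y)\<close> to \<kappa>, which
    \<open>d\<close> kills; injectivity then forces \<open>D (g y)\<close> to kill that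
    vector.\<close>
  have kernel: "D (g y) (g' y \<kappa>) = 0" if "y \<in> V" and "\<kappa> \<in> K" for y \<kappa>
  proof -
    let ?D = "blinfun_apply (D (g y))"
    have bij: "bij (blinfun_apply (G' (g y)))" using ift(9) that by blast
    have "range d \<subseteq> (\<lambda>x. d (M x)) ` range ?D"
    proof
      fix w assume "w \<in> range d"
      then obtain v0 where "w = d v0" by blast
      obtain v where v: "M (?D v) + Q v = M (d v0)"
        using bij unfolding bij_def surj_def G'_apply by metis
      then have "d (M (?D v)) = d (M (d v0))"
        by (metis add.right_neutral dQ lind linear_add v)
      then show "w \<in> (\<lambda>x. d (M x)) ` range ?D"
        using \<open>w = d v0\<close> dM by (auto simp: image_iff intro!: exI[of _ v])
    qed
    then have "dim (range ?D) \<le> dim ((\<lambda>x. d (M x)) ` range ?D)"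
      using max[OF gV[OF \<open>y \<in> V\<close>]] dim_subset unfolding d_def by (meson le_trans)
    moreover have "linear (\<lambda>x. d (M x))"
      using linear_compose[OF linM lind] by (simp add: o_def)
    ultimately have inj: "inj_on (\<lambda>x. d (M x)) (range ?D)"
      by (intro linear_inj_on_if_dim_le_dim_image linear_subspace_image linD subspace_UNIV)
    have "blinfun_apply (G' (g y)) (g' y \<kappa>) = \<kappa>"
      using bij ift(8)[OF \<open>y \<in> V\<close>] by (simp add: bij_is_surj surj_f_inv_f)
    then have "d (M (?D (g' y \<kappa>))) + d (Q (g' y \<kappa>)) = d \<kappa>"
      by (metis G'_apply lind linear_add)
    then have "d (M (?D (g' y \<kappa>))) = d (M 0)"
      using \<open>\<kappa> \<in> K\<close> by (simp add: K_def dQ linear_0[OF linM] linear_0[OF lind])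
    then show ?thesis
      using inj linear_0[OF linD] by (metis (mono_tags, lifting) inj_onD rangeI)
  qed
  \<comment> \<open>A ball, because constancy of \<open>F\<close> on a disc is obtained by
    differentiating along the segment from \<open>z\<close> to \<open>z + a\<close>, which must not
    leave \<open>V\<close>.\<close>
  obtain r where r: "r > 0" "ball (G p0) r \<subseteq> V"
    using ift(4,5) open_contains_ball by blast
  define S' where "S' = g ` ball (G p0) r"
  have homg: "homeomorphism V U g G"
    using ift(6) homeomorphism_sym by blast
  have "open S'"
  proof -
    have "openin (top_of_set U) S'"
      unfolding S'_def by (rule homeomorphism_imp_open_map[OF homg]) (simp add: r(2) open_subset)
    then show ?thesis using ift(1) openin_open_trans by blast
  qed
  moreover have "S' \<noteq> {}" using r(1) by (simp add: S'_def)
  moreover have "S' \<subseteq> S" using gV r(2) by (auto simp: S'_def)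
  moreover have "\<exists>K A j. fibre_disc euclidean F (K :: 'e set) A j p \<and> j ` A \<subseteq> S' \<and>
      DIM('e) < dim K + DIM('f)" if p: "p \<in> S'" for p
  proof -
    obtain z where z: "z \<in> ball (G p0) r" "p = g z" using p unfolding S'_def by blast
    define A where "A = K \<inter> (\<lambda>\<kappa>. z + \<kappa>) -` ball (G p0) r"
    define j where "j \<kappa> = g (z + \<kappa>)" for \<kappa>
    have AV: "z + \<kappa> \<in> V" if "\<kappa> \<in> A" for \<kappa> using that r(2) by (auto simp: A_def)
    have "open ((\<lambda>\<kappa>. z + \<kappa>) -` ball (G p0) r)"
      by (intro open_vimage continuous_intros) auto
    then have "openin (top_of_set K) A"
      unfolding A_def by (rule openin_open_Int)
    moreover have "continuous_on A j"
    proof -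
      have "continuous_on V g" using homg homeomorphism_def by blast
      then show ?thesis
        unfolding j_def by (rule continuous_on_compose2) (use AV in \<open>auto intro!: continuous_intros\<close>)
    qed
    moreover have "inj_on j A"
    proof (rule inj_onI)
      fix x y assume "x \<in> A" "y \<in> A" "j x = j y"
      then have "z + x = z + y"
        using AV homeomorphism_apply1[OF homg] unfolding j_def by metis
      then show "x = y" by simp
    qed
    moreover have "p \<in> j ` A"
    proof (rule image_eqI)
      show "p = j 0" by (simp add: j_def z(2))
      show "0 \<in> A" using z(1) subspace_0[OF subK] by (simp add: A_def)
    qed
    moreover have "j ` A \<subseteq> S'" by (auto simp: A_def j_def S'_def)
    moreover have "F (j a) = F p" if "a \<in> A" for a
    proof -
      have seg: "z + t *\<^sub>R a \<in> V" if "t \<in> {0..1}" for t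
      proof -
        have "(1 - t) *\<^sub>R z + t *\<^sub>R (z + a) \<in> ball (G p0) r"
          using z(1) \<open>a \<in> A\<close> that by (intro convexD_alt[OF convex_ball]) (auto simp: A_def)
        then show ?thesis using r(2) by (auto simp: algebra_simps)
      qed
      have aK: "a \<in> K" using \<open>a \<in> A\<close> by (simp add: A_def)
      have "((\<lambda>t. F (g (z + t *\<^sub>R a))) has_derivative (\<lambda>h. 0)) (at t within {0..1})" if "t \<in> {0..1}" for t
      proof -
        have "((\<lambda>t. z + t *\<^sub>R a) has_derivative (\<lambda>h. h *\<^sub>R a)) (at t)"
          by (auto intro!: derivative_eq_intros)
        from has_derivative_compose[OF has_derivative_compose[OF this ift(7)[OF seg[OF that]]]
            D[OF gV[OF seg[OF that]]]]
        have "((\<lambda>t. F (g (z + t *\<^sub>R a))) has_derivative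
            (\<lambda>h. D (g (z + t *\<^sub>R a)) (g' (z + t *\<^sub>R a) (h *\<^sub>R a)))) (at t)" .
        moreover have "D (g (z + t *\<^sub>R a)) (g' (z + t *\<^sub>R a) (h *\<^sub>R a)) = 0" for h
          using kernel[OF seg[OF that]] subspace_scale[OF subK aK] by blast
        ultimately show ?thesis by (simp add: has_derivative_at_withinI)
      qed
      then obtain c where "\<And>t. t \<in> {0..1} \<Longrightarrow> F (g (z + t *\<^sub>R a)) = c"
        using has_derivative_zero_constant[of "{0..1::real}" "\<lambda>t. F (g (z + t *\<^sub>R a))"] by auto
      from this[of 0] this[of 1] show ?thesis by (simp add: j_def z(2))
    qed
    ultimately have "fibre_disc euclidean F K A j p" and "j ` A \<subseteq> S'"
      using subK by (simp_all add: fibre_disc_def)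
    then show ?thesis
      using \<open>DIM('e) < dim K + DIM('f)\<close> by blast
  qed
  ultimately show thesis using that by blast
qed

section \<open>Open images of Lagrangian fibrations\<close>

lemma top_chartD:
  assumes "top_chart T (U, \<phi>)"
  shows "openin T U" and "open (\<phi> ` U)" and "inj_on \<phi> U"
    and "continuous_map (subtopology T U) euclidean \<phi>"
    and "continuous_map (top_of_set (\<phi> ` U)) T (inv_into U \<phi>)"
proof -
  show U: "openin T U" and "open (\<phi> ` U)" using assms by (auto simp: top_chart_def)
  have hom: "homeomorphic_map (subtopology T U) (top_of_set (\<phi> ` U)) \<phi>"
    using assms by (auto simp: top_chart_def)
  have topU: "topspace (subtopology T U) = U"
    using openin_subset[OF U] by (simp add: Int_absorb1)
  show inj: "inj_on \<phi> U"
    using homeomorphic_imp_injective_map[OF hom] by (simp only: topU)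
  show "continuous_map (subtopology T U) euclidean \<phi>"
    using homeomorphic_imp_continuous_map[OF hom] continuous_map_into_fulltopology by blast
  obtain g where g: "homeomorphic_maps (subtopology T U) (top_of_set (\<phi> ` U)) \<phi> g"
    using hom homeomorphic_map_maps by blast
  then have gc: "continuous_map (top_of_set (\<phi> ` U)) (subtopology T U) g"
    by (simp add: homeomorphic_maps_def)
  have "g y = inv_into U \<phi> y" if y: "y \<in> \<phi> ` U" for y
  proof -
    obtain x where x: "x \<in> U" "y = \<phi> x" using y by blast
    then show ?thesis
      using g inj topU by (simp add: homeomorphic_maps_def)
  qed
  then have "continuous_map (top_of_set (\<phi> ` U)) (subtopology T U) (inv_into U \<phi>)"
    using gc by (auto intro: continuous_map_eq)
  then show "continuous_map (top_of_set (\<phi> ` U)) T (inv_into U \<phi>)"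
    using continuous_map_into_fulltopology by blast
qed

lemma top_chart_open_image:
  assumes "top_chart T (U, \<phi>)" and "openin T G" and "G \<subseteq> U"
  shows "open (\<phi> ` G)"
proof -
  have "homeomorphic_map (subtopology T U) (top_of_set (\<phi> ` U)) \<phi>"
    using assms by (auto simp: top_chart_def)
  moreover have "openin (subtopology T U) G"
    using assms(2,3) openin_subtopology by blast
  ultimately have "openin (top_of_set (\<phi> ` U)) (\<phi> ` G)"
    using homeomorphic_imp_open_map open_map_def by blast
  then show ?thesis
    using top_chartD(2)[OF assms(1)] openin_open_trans by blast
qed

lemma top_chart_open_vimage:
  assumes "top_chart T (U, \<phi>)" and "open W"
  shows "openin T {x \<in> U. \<phi> x \<in> W}"
proof -
  have "openin (subtopology T U) {x \<in> topspace (subtopology T U). \<phi> x \<in> W}"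
    by (rule openin_continuous_map_preimage[OF top_chartD(4)[OF assms(1)]]) (use assms(2) in simp)
  moreover have "topspace (subtopology T U) = U"
    using openin_subset[OF top_chartD(1)[OF assms(1)]] by (simp add: Int_absorb1)
  ultimately have "openin (subtopology T U) {x \<in> U. \<phi> x \<in> W}" by (simp only:)
  then show ?thesis
    using top_chartD(1)[OF assms(1)] openin_trans_full by blast
qed

text \<open>In flattening coordinates of \<open>L\<close> the disc becomes a continuous injection of
  an open part of \<open>K\<close> into the \<open>k\<close>-dimensional subspace \<open>T\<close>,
  and invariance of dimension applies.\<close>

lemma fibre_disc_dim_le:
  fixes K :: "'g::euclidean_space set"
  assumes charts: "\<And>c. c \<in> atlas M \<Longrightarrow> top_chart (mtop M) c" and "submanifold_at M k L x"
    and disc: "fibre_disc (mtop M) f K A j x" and L: "j ` A \<subseteq> L"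
  shows "dim K \<le> k"
proof -
  have K: "subspace K" and A: "openin (top_of_set K) A"
    and j: "continuous_map (top_of_set A) (mtop M) j" "inj_on j A" "x \<in> j ` A" "j ` A \<subseteq> L"
    using disc L by (auto simp: fibre_disc_def)
  obtain U \<phi> W g T where c: "(U, \<phi>) \<in> atlas M" "x \<in> U" "\<phi> x \<in> W" "W \<subseteq> \<phi> ` U" "flattening W g"
    "subspace T" "dim T = k" "g ` (W \<inter> \<phi> ` (U \<inter> L)) = g ` W \<inter> T"
    using assms(2) unfolding submanifold_at_def by auto
  have g: "open W" "inj_on g W" "continuous_on W g"
    using c(5) by (auto simp: flattening_def smooth_on_def dest: spec[of _ 0])
  note chart = charts[OF c(1)]
  \<comment> \<open>Only the part of the disc that lands in the flattening neighbourhood is kept; it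
    still passes through \<open>x\<close>.\<close>
  define A' where "A' = {a \<in> A. j a \<in> {x \<in> U. \<phi> x \<in> W}}"
  have "openin (top_of_set A) A'"
    using openin_continuous_map_preimage[OF j(1) top_chart_open_vimage[OF chart g(1)]] by (simp add: A'_def)
  then have "openin (top_of_set K) A'"
    using A openin_trans by blast
  moreover have "continuous_on A' (g \<circ> (\<phi> \<circ> j))"
  proof -
    have "continuous_map (top_of_set A') (subtopology (mtop M) U) j"
      unfolding continuous_map_in_subtopology
      using continuous_map_from_subtopology_mono[OF j(1), of A'] by (auto simp: A'_def)
    then have "continuous_on A' (\<phi> \<circ> j)"
      using continuous_map_compose top_chartD(4)[OF chart] by fastforce
    moreover have "(\<phi> \<circ> j) ` A' \<subseteq> W" by (auto simp: A'_def)
    ultimately show ?thesis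
      using g(3) continuous_on_compose continuous_on_subset by blast
  qed
  moreover have "g \<circ> (\<phi> \<circ> j) \<in> A' \<rightarrow> T"
  proof
    fix a assume a: "a \<in> A'"
    then have "\<phi> (j a) \<in> W \<inter> \<phi> ` (U \<inter> L)"
      using j(4) by (auto simp: A'_def)
    then show "(g \<circ> (\<phi> \<circ> j)) a \<in> T" using c(8) by auto
  qed
  moreover have "inj_on (g \<circ> (\<phi> \<circ> j)) A'"
  proof (rule inj_onI)
    fix a b assume ab: "a \<in> A'" "b \<in> A'" "(g \<circ> (\<phi> \<circ> j)) a = (g \<circ> (\<phi> \<circ> j)) b"
    then have "\<phi> (j a) = \<phi> (j b)"
      using g(2) by (auto simp: A'_def dest: inj_onD)
    then have "j a = j b"
      using ab top_chartD(3)[OF chart] by (auto simp: A'_def dest: inj_onD)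
    then show "a = b"
      using ab j(2) by (auto simp: A'_def dest: inj_onD)
  qed
  moreover have "A' \<noteq> {}"
    using j(3) c(2,3) by (auto simp: A'_def)
  ultimately have "dim K \<le> dim T"
    using invariance_of_dimension_subspaces K c(6) by blast
  then show ?thesis using c(7) by simp
qed

lemma lagrangian_fibration_charts:
  assumes "lagrangian_fibration X B f"
  shows "c \<in> atlas X \<Longrightarrow> top_chart (mtop X) c" and "c' \<in> atlas B \<Longrightarrow> top_chart (mtop B) c'"
    and "x \<in> points X \<Longrightarrow> \<exists>U \<phi>. (U, \<phi>) \<in> atlas X \<and> x \<in> U"
    and "b \<in> points B \<Longrightarrow> \<exists>V \<psi>. (V, \<psi>) \<in> atlas B \<and> b \<in> V"
    and "x \<in> points X \<Longrightarrow> f x \<in> points B"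
proof -
  have X: "smooth_manifold X" and B: "smooth_manifold B" and f: "continuous_map (mtop X) (mtop B) f"
    using assms by (auto simp: lagrangian_fibration_def symplectic_manifold_def)
  show "c \<in> atlas X \<Longrightarrow> top_chart (mtop X) c" and "c' \<in> atlas B \<Longrightarrow> top_chart (mtop B) c'"
    using X B by (simp_all add: smooth_manifold_def)
  have "points X = (\<Union>(U, \<phi>)\<in>atlas X. U)" and "points B = (\<Union>(V, \<psi>)\<in>atlas B. V)"
    using X B by (simp_all add: smooth_manifold_def)
  then show "x \<in> points X \<Longrightarrow> \<exists>U \<phi>. (U, \<phi>) \<in> atlas X \<and> x \<in> U"
    and "b \<in> points B \<Longrightarrow> \<exists>V \<psi>. (V, \<psi>) \<in> atlas B \<and> b \<in> V"
    by auto
  show "x \<in> points X \<Longrightarrow> f x \<in> points B"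
    using continuous_map_image_subset_topspace[OF f] by blast
qed

text \<open>The discs are required at every point of the fibre inside \<open>G\<close>: only a dense
  part \<open>L\<close> of the fibre is a submanifold, and density yields some point of
  \<open>G\<close> in \<open>L\<close>, not a chosen one.\<close>

lemma lagrangian_fibre_no_large_disc:
  fixes X :: "('a, (real^'n) \<times> (real^'n)) symp" and B :: "('b, real^'n) manifold"
  assumes fib: "lagrangian_fibration X B f" and "openin (mtop X) G" and "x0 \<in> G"
    and disc: "\<And>x. x \<in> G \<Longrightarrow> f x = f x0 \<Longrightarrow>
      \<exists>(K :: 'g::euclidean_space set) A j. fibre_disc (mtop X) f K A j x \<and> CARD('n) < dim K"
  shows False
proof -
  have "x0 \<in> points X" using assms(2,3) openin_subset by blast
  then obtain L where L: "openin (subtopology (mtop X) (over X f {f x0})) L"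
    "over X f {f x0} \<subseteq> mtop X closure_of L" "lagrangian_submanifold X L"
    using fib lagrangian_fibration_charts(5)[OF fib] unfolding lagrangian_fibration_def by blast
  then obtain H where H: "openin (mtop X) H" "L = H \<inter> over X f {f x0}"
    by (auto simp: openin_subtopology)
  have "x0 \<in> mtop X closure_of L"
    using L(2) \<open>x0 \<in> points X\<close> by (auto simp: over_def)
  then obtain x where x: "x \<in> G" "x \<in> L"
    using assms(2,3) by (auto simp: in_closure_of)
  then have "f x = f x0" using H(2) by (simp add: over_def)
  then obtain K :: "'g set" and A j where kaj: "fibre_disc (mtop X) f K A j x" "CARD('n) < dim K"
    using disc[OF x(1)] by blast
  \<comment> \<open>\<open>L\<close> is only relatively open in the fibre, so the disc is cut down
    to the open set \<open>H\<close> that defines it; being contained in the fibre, what remains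
    lies in \<open>L\<close>.\<close>
  define A' where "A' = {a \<in> A. j a \<in> H}"
  have j: "continuous_map (top_of_set A) (mtop X) j" "openin (top_of_set K) A"
    using kaj(1) by (simp_all add: fibre_disc_def)
  have "openin (top_of_set A) A'"
    using openin_continuous_map_preimage[OF j(1) H(1)] by (simp add: A'_def)
  then have "openin (top_of_set K) A'"
    using j(2) openin_trans by blast
  moreover have "continuous_map (top_of_set A') (mtop X) j"
    using j(1) by (rule continuous_map_from_subtopology_mono) (auto simp: A'_def)
  moreover have "inj_on j A'"
    using kaj(1) by (auto simp: fibre_disc_def A'_def intro: inj_on_subset)
  moreover have "x \<in> j ` A'"
    using kaj(1) x(2) H(2) by (auto simp: fibre_disc_def A'_def)
  ultimately have "fibre_disc (mtop X) f K A' j x"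
    using kaj(1) by (simp add: fibre_disc_def A'_def)
  moreover have "j ` A' \<subseteq> L"
    using kaj(1) H openin_subset[OF H(1)] \<open>f x = f x0\<close> by (auto simp: fibre_disc_def A'_def over_def)
  moreover have "submanifold_at X CARD('n) L x"
    using L(3) x(2) by (auto simp: lagrangian_submanifold_def submanifold_def)
  ultimately have "dim K \<le> CARD('n)"
    using fibre_disc_dim_le[OF lagrangian_fibration_charts(1)[OF fib]] by blast
  then show False using kaj(2) by simp
qed

text \<open>A coordinate neighbourhood inside a fibre would be a disc of twice the allowed
  dimension.\<close>

lemma lagrangian_fibre_interior_empty:
  fixes X :: "('a, (real^'n) \<times> (real^'n)) symp" and B :: "('b, real^'n) manifold"
  assumes fib: "lagrangian_fibration X B f" and G: "openin (mtop X) G" and sub: "G \<subseteq> over X f {b}"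
  shows "G = {}"
proof (rule ccontr)
  assume "G \<noteq> {}"
  then obtain x0 where x0: "x0 \<in> G" by blast
  show False
  proof (rule lagrangian_fibre_no_large_disc[OF fib G x0])
    fix x assume x: "x \<in> G"
    then obtain U \<phi> where c: "(U, \<phi>) \<in> atlas X" "x \<in> U"
      using lagrangian_fibration_charts(3)[OF fib] openin_subset[OF G] by blast
    note chart = lagrangian_fibration_charts(1)[OF fib c(1)]
    let ?A = "\<phi> ` (U \<inter> G)" and ?j = "inv_into U \<phi>"
    have "open ?A"
      using top_chart_open_image[OF chart, of "U \<inter> G"] G top_chartD(1)[OF chart] by blast
    then have A: "openin (top_of_set UNIV) ?A" by simp
    have j: "continuous_map (top_of_set ?A) (mtop X) ?j"
      using top_chartD(5)[OF chart] by (rule continuous_map_from_subtopology_mono) blast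
    have inj: "inj_on ?j ?A"
      by (rule inj_on_inv_into) blast
    have "x \<in> ?j ` ?A" and "\<forall>a\<in>?A. f (?j a) = f x"
      using x c(2) top_chartD(3)[OF chart] sub by (auto simp: over_def image_image)
    then have "fibre_disc (mtop X) f UNIV ?A ?j x"
      using A j inj by (simp add: fibre_disc_def)
    moreover have "CARD('n) < dim (UNIV :: ((real^'n) \<times> (real^'n)) set)"
      by (simp add: dim_UNIV)
    ultimately show "\<exists>(K :: ((real^'n) \<times> (real^'n)) set) A j. fibre_disc (mtop X) f K A j x \<and> CARD('n) < dim K"
      by blast
  qed
qed

text \<open>The smooth map \<open>g\<close> is separate from \<open>f\<close> so that the result
  applies to one piece of a piecewise smooth fibration: \<open>f\<close> itself may fail to be
  smooth nearby, but on \<open>G\<close> its fibres are those of \<open>g\<close>.\<close>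

proposition smooth_lagrangian_fibration_image_interior:
  fixes X :: "('a, (real^'n) \<times> (real^'n)) symp" and B :: "('b, real^'n) manifold"
  assumes fib: "lagrangian_fibration X B f" and g: "smooth_map_on X B W g"
    and G: "openin (mtop X) G" "G \<noteq> {}" "G \<subseteq> W" and fg: "\<And>x. x \<in> G \<Longrightarrow> f x = g x"
  obtains V where "openin (mtop B) V" "V \<noteq> {}" "V \<subseteq> f ` G"
proof -
  obtain x0 where x0: "x0 \<in> G" using G(2) by blast
  then have "x0 \<in> points X" using G(1) openin_subset by blast
  then obtain U \<phi> where c: "(U, \<phi>) \<in> atlas X" "x0 \<in> U"
    using lagrangian_fibration_charts(3)[OF fib] by blast
  obtain V \<psi> where d: "(V, \<psi>) \<in> atlas B" "f x0 \<in> V"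
    using lagrangian_fibration_charts(4,5)[OF fib] \<open>x0 \<in> points X\<close> by blast
  note chart = lagrangian_fibration_charts(1)[OF fib c(1)]
  note bchart = lagrangian_fibration_charts(2)[OF fib d(1)]
  define G' where "G' = {x \<in> U \<inter> G. f x \<in> V}"
  define S where "S = \<phi> ` G'"
  define F where "F = \<psi> \<circ> g \<circ> inv_into U \<phi>"
  have contf: "continuous_map (mtop X) (mtop B) f"
    using fib by (simp add: lagrangian_fibration_def)
  have openG': "openin (mtop X) G'"
  proof -
    have "G' = (U \<inter> G) \<inter> {x \<in> points X. f x \<in> V}"
      using openin_subset[OF G(1)] by (auto simp: G'_def)
    then show ?thesis
      using openin_continuous_map_preimage[OF contf top_chartD(1)[OF bchart]] top_chartD(1)[OF chart] G(1)
      by (simp add: openin_Int)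
  qed
  have inv: "inv_into U \<phi> (\<phi> x) = x" if "x \<in> U" for x
    using that top_chartD(3)[OF chart] by simp
  have openS: "open S"
    unfolding S_def using top_chart_open_image[OF chart openG'] by (auto simp: G'_def)
  have neS: "S \<noteq> {}" using x0 c d by (auto simp: S_def G'_def)
  have "smooth_on (\<phi> ` {x \<in> U \<inter> W. g x \<in> V}) F"
    using g c(1) d(1) unfolding smooth_map_on_def F_def by fast
  then have "C_k_on 1 F (\<phi> ` {x \<in> U \<inter> W. g x \<in> V})"
    by (simp add: smooth_on_def)
  moreover have "S \<subseteq> \<phi> ` {x \<in> U \<inter> W. g x \<in> V}"
    using G(3) fg by (force simp: S_def G'_def)
  ultimately have F: "C_k_on 1 F S"
    using continuous_on_subset[of "\<phi> ` {x \<in> U \<inter> W. g x \<in> V}" _ S] by auto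
  show thesis
  proof (cases "\<exists>p\<in>S. surj (frechet_derivative F (at p))")
    case True
    then obtain p where p: "p \<in> S" "surj (frechet_derivative F (at p))" by blast
    have der: "(F has_derivative frechet_derivative F (at p)) (at p)"
      using F p(1) frechet_derivative_works by auto
    then have "linear (frechet_derivative F (at p))"
      using has_derivative_bounded_linear bounded_linear.linear by blast
    \<comment> \<open>One surjective differential is enough: a right inverse of it feeds the open
      mapping theorem, which makes \<open>F p\<close> an interior point of the image of
      \<open>S\<close>.\<close>
    then obtain g' where "linear g'" "frechet_derivative F (at p) \<circ> g' = id"
      using linear_surjective_right_inverse p(2) by blast
    then have "F p \<in> interior (F ` S)"
      using F p(1) openS der
      by (intro sussmann_open_mapping[of S F p _ g' S])
        (auto simp: linear_conv_bounded_linear interior_open)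
    then obtain V' where V': "open V'" "F p \<in> V'" "V' \<subseteq> F ` S"
      using interiorE by blast
    show thesis
    proof (rule that)
      show "openin (mtop B) {y \<in> V. \<psi> y \<in> V'}"
        by (rule top_chart_open_vimage[OF bchart V'(1)])
      obtain x where "x \<in> G'" "p = \<phi> x" using p(1) by (auto simp: S_def)
      then have "f x \<in> {y \<in> V. \<psi> y \<in> V'}"
        using V'(2) inv fg by (auto simp: F_def G'_def)
      then show "{y \<in> V. \<psi> y \<in> V'} \<noteq> {}" by blast
      show "{y \<in> V. \<psi> y \<in> V'} \<subseteq> f ` G"
      proof
        fix y assume y: "y \<in> {y \<in> V. \<psi> y \<in> V'}"
        then obtain x where x: "x \<in> G'" "\<psi> y = F (\<phi> x)" using V'(3) by (auto simp: S_def)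
        then have "\<psi> y = \<psi> (f x)" using inv fg by (auto simp: F_def G'_def)
        then have "y = f x"
          using y x(1) top_chartD(3)[OF bchart] by (auto simp: G'_def dest: inj_onD)
        then show "y \<in> f ` G" using x(1) by (auto simp: G'_def)
      qed
    qed
  next
    case False
    \<comment> \<open>The differential is nowhere onto. With source dimension 2n and target
      dimension n the discs have dimension above n, and every point of \<open>S'\<close> carries
      one, as the argument by density requires.\<close>
    obtain S' where S': "open S'" "S' \<noteq> {}" "S' \<subseteq> S"
      and disc: "\<And>p. p \<in> S' \<Longrightarrow> \<exists>(K :: ((real^'n) \<times> (real^'n)) set) A j. fibre_disc euclidean F K A j p \<and>
        j ` A \<subseteq> S' \<and> DIM((real^'n) \<times> (real^'n)) < dim K + DIM(real^'n)"
      using degenerate_map_fibres[OF openS neS F] False by blast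
    have S'_U: "S' \<subseteq> \<phi> ` U" using S'(3) by (auto simp: S_def G'_def)
    have inG': "inv_into U \<phi> p \<in> G'" if "p \<in> S'" for p
      using that S'(3) inv by (auto simp: S_def G'_def)
    have F_eq: "F p = \<psi> (f (inv_into U \<phi> p))" if "p \<in> S'" for p
      using inG'[OF that] fg by (simp add: F_def G'_def)
    obtain p1 where p1: "p1 \<in> S'" using S'(2) by blast
    let ?H = "{x \<in> U. \<phi> x \<in> S'}" and ?x1 = "inv_into U \<phi> p1"
    have "?x1 \<in> ?H" using p1 S'_U by (auto simp: f_inv_into_f inv_into_into)
    have False
    proof (rule lagrangian_fibre_no_large_disc[OF fib top_chart_open_vimage[OF chart S'(1)] \<open>?x1 \<in> ?H\<close>])
      fix x assume x: "x \<in> ?H" "f x = f ?x1"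
      then obtain K :: "((real^'n) \<times> (real^'n)) set" and A j where
        kaj: "fibre_disc euclidean F K A j (\<phi> x)" "j ` A \<subseteq> S'"
          "DIM((real^'n) \<times> (real^'n)) < dim K + DIM(real^'n)"
        using disc[of "\<phi> x"] by blast
      let ?j = "inv_into U \<phi> \<circ> j"
      have "continuous_map (top_of_set A) (mtop X) ?j"
      proof (rule continuous_map_compose)
        show "continuous_map (top_of_set A) (top_of_set (\<phi> ` U)) j"
          using kaj(1,2) S'_U by (auto simp: fibre_disc_def continuous_map_in_subtopology)
      qed (rule top_chartD(5)[OF chart])
      moreover have "inj_on ?j A"
        using kaj(1,2) S'_U by (intro comp_inj_on inj_on_inv_into) (auto simp: fibre_disc_def)
      moreover have "x \<in> ?j ` A"
      proof -
        obtain a where "a \<in> A" "j a = \<phi> x" using kaj(1) by (auto simp: fibre_disc_def)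
        then show ?thesis using x(1) inv by (intro image_eqI[of x _ a]) auto
      qed
      moreover have "f (?j a) = f x" if a: "a \<in> A" for a
      proof -
        have ja: "j a \<in> S'" using a kaj(2) by blast
        have "F (j a) = F (\<phi> x)" using kaj(1) a by (auto simp: fibre_disc_def)
        then have "\<psi> (f (?j a)) = \<psi> (f x)"
          using F_eq[OF ja] F_eq[of "\<phi> x"] x(1) inv by simp
        moreover have "f (?j a) \<in> V" using inG'[OF ja] by (simp add: G'_def)
        moreover have "f x \<in> V" using inG'[of "\<phi> x"] x(1) inv by (simp add: G'_def)
        ultimately show "f (?j a) = f x"
          using top_chartD(3)[OF bchart] by (auto dest: inj_onD)
      qed
      ultimately have "fibre_disc (mtop X) f K A ?j x"
        using kaj(1) by (simp add: fibre_disc_def)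
      moreover have "CARD('n) < dim K" using kaj(3) by simp
      ultimately show "\<exists>(K :: ((real^'n) \<times> (real^'n)) set) A j. fibre_disc (mtop X) f K A j x \<and> CARD('n) < dim K"
        by blast
    qed
    then show thesis by simp
  qed
qed

section \<open>The torus bundle of an integral affine manifold\<close>

locale integral_affine =
  fixes T :: "'b topology" and W :: "'b set" and \<A> :: "('b, real^'n) chart set"
  assumes affine_atlas: "integral_affine_atlas T W \<A>"
begin

lemma chart: "c \<in> \<A> \<Longrightarrow> top_chart T c"
  using affine_atlas by (simp add: integral_affine_atlas_def)

lemma inv_chart: "(U, u) \<in> \<A> \<Longrightarrow> b \<in> U \<Longrightarrow> inv_into U u (u b) = b"
  using top_chartD(3)[OF chart] by simp

lemma transitionE:
  assumes "(U, u) \<in> \<A>" and "(V, v) \<in> \<A>" and "b \<in> U" and "b \<in> V"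
  obtains A a G where "integral_matrix A" and "openin T G" and "b \<in> G" and "G \<subseteq> U \<inter> V"
    and "\<And>y. y \<in> G \<Longrightarrow> v y = A *v u y + a" and "\<And>y. y \<in> G \<Longrightarrow> coord_deriv id (U, u) v y = (*v) A"
proof -
  have "affinely_related T id u v b"
    using affine_atlas assms unfolding integral_affine_atlas_def by fast
  then obtain H A a where H: "openin T H" "b \<in> H" "integral_matrix A" "\<And>y. y \<in> H \<Longrightarrow> v y = A *v u y + a"
    unfolding affinely_related_def by auto
  define G where "G = H \<inter> (U \<inter> V)"
  have G: "openin T G"
    unfolding G_def using H(1) top_chartD(1)[OF chart] assms(1,2) by blast
  have deriv: "coord_deriv id (U, u) v y = (*v) A" if "y \<in> G" for y
  proof -
    have open_image: "open (u ` G)"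
      using top_chart_open_image[OF chart[OF assms(1)] G] by (auto simp: G_def)
    have "((\<lambda>x. A *v x + a) has_derivative (*v) A) (at (u y))"
      by (auto intro!: derivative_eq_intros linear_imp_has_derivative)
    then have "((v \<circ> id \<circ> inv_into U u) has_derivative (*v) A) (at (u y))"
      using open_image imageI[OF that]
      by (rule has_derivative_transform_within_open) (use H(4) inv_chart[OF assms(1)] in \<open>auto simp: G_def\<close>)
    then show ?thesis
      by (simp add: coord_deriv_def frechet_derivative_at[symmetric])
  qed
  show thesis
  proof (rule that)
    show "b \<in> G" "G \<subseteq> U \<inter> V" using H(2) assms(3,4) by (auto simp: G_def)
    show "v y = A *v u y + a" if "y \<in> G" for y using H(4) that by (simp add: G_def)
  qed (use H(3) G deriv in auto)
qed

lemma transition_linear: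
  assumes "(U, u) \<in> \<A>" and "(V, v) \<in> \<A>" and "b \<in> U" and "b \<in> V"
  shows "linear (coord_deriv id (U, u) v b)"
proof -
  obtain A where "coord_deriv id (U, u) v b = (*v) A"
    by (rule transitionE[OF assms], rule that)
  then show ?thesis by simp
qed

text \<open>The chain rule, carried out on explicit affine maps: the composite and the direct
  transition agree on an open set of coordinates, and their derivatives at \<open>u b\<close> are
  compared by uniqueness.\<close>

lemma transition_cocycle:
  assumes "(U, u) \<in> \<A>" "(V, v) \<in> \<A>" "(V', w) \<in> \<A>" and "b \<in> U" "b \<in> V" "b \<in> V'"
  shows "coord_deriv id (V, v) w b (coord_deriv id (U, u) v b x) = coord_deriv id (U, u) w b x"
proof -
  obtain A1 a1 G1 where 1: "openin T G1" "b \<in> G1" "G1 \<subseteq> U \<inter> V" "\<And>y. y \<in> G1 \<Longrightarrow> v y = A1 *v u y + a1"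
    "\<And>y. y \<in> G1 \<Longrightarrow> coord_deriv id (U, u) v y = (*v) A1"
    by (rule transitionE[OF assms(1,2,4,5)], rule that)
  obtain A2 a2 G2 where 2: "openin T G2" "b \<in> G2" "G2 \<subseteq> V \<inter> V'" "\<And>y. y \<in> G2 \<Longrightarrow> w y = A2 *v v y + a2"
    "\<And>y. y \<in> G2 \<Longrightarrow> coord_deriv id (V, v) w y = (*v) A2"
    by (rule transitionE[OF assms(2,3,5,6)], rule that)
  obtain A3 a3 G3 where 3: "openin T G3" "b \<in> G3" "G3 \<subseteq> U \<inter> V'" "\<And>y. y \<in> G3 \<Longrightarrow> w y = A3 *v u y + a3"
    "\<And>y. y \<in> G3 \<Longrightarrow> coord_deriv id (U, u) w y = (*v) A3"
    by (rule transitionE[OF assms(1,3,4,6)], rule that)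
  let ?G = "G1 \<inter> G2 \<inter> G3"
  have "openin T ?G" using 1(1) 2(1) 3(1) by blast
  then have open_image: "open (u ` ?G)"
    using top_chart_open_image[OF chart[OF assms(1)]] 1(3) by blast
  have ub: "u b \<in> u ` ?G" using 1(2) 2(2) 3(2) by blast
  have "((\<lambda>x. A1 *v x + a1) has_derivative (*v) A1) (at (u b))"
    by (auto intro!: derivative_eq_intros linear_imp_has_derivative)
  from has_derivative_compose[OF this linear_imp_has_derivative[OF matrix_vector_mul_linear[of A2]]]
  have "((\<lambda>x. A2 *v (A1 *v x + a1) + a2) has_derivative (\<lambda>x. A2 *v (A1 *v x))) (at (u b))"
    by (rule has_derivative_add_const)
  then have "((\<lambda>x. A3 *v x + a3) has_derivative (\<lambda>x. A2 *v (A1 *v x))) (at (u b))"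
    using open_image ub
  proof (rule has_derivative_transform_within_open)
    fix x assume "x \<in> u ` ?G"
    then obtain y where "y \<in> ?G" "x = u y" by blast
    then show "A2 *v (A1 *v x + a1) + a2 = A3 *v x + a3"
      using 1(4)[of y] 2(4)[of y] 3(4)[of y] by simp
  qed
  moreover have "((\<lambda>x. A3 *v x + a3) has_derivative (*v) A3) (at (u b))"
    by (auto intro!: derivative_eq_intros linear_imp_has_derivative)
  ultimately have "(\<lambda>x. A2 *v (A1 *v x)) = (*v) A3"
    by (rule has_derivative_unique)
  then show ?thesis
    using 1(2,5) 2(2,5) 3(2,5) by (metis (no_types))
qed

text \<open>Components of a covector are indexed by the coordinate map alone, while the atlas may
  contain one map with several domains. This makes the passage between such charts harmless.\<close>

lemma transition_id:
  assumes "(U, u) \<in> \<A>" and "(V, u) \<in> \<A>" and "b \<in> U" and "b \<in> V"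
  shows "coord_deriv id (U, u) u b x = x"
proof -
  have open_image: "open (u ` U)" using top_chartD(2)[OF chart[OF assms(1)]] .
  have "((\<lambda>x. x) has_derivative (\<lambda>x. x)) (at (u b))" by simp
  then have "((u \<circ> id \<circ> inv_into U u) has_derivative (\<lambda>x. x)) (at (u b))"
    using open_image imageI[OF assms(3)]
    by (rule has_derivative_transform_within_open) (use inv_chart[OF assms(1)] in auto)
  then show ?thesis
    by (simp add: coord_deriv_def frechet_derivative_at[symmetric])
qed

section \<open>Covectors and the period lattice\<close>

lemma covectorsI:
  assumes "\<And>U u V v w. (U, u) \<in> \<A> \<Longrightarrow> (V, v) \<in> \<A> \<Longrightarrow> b \<in> U \<Longrightarrow> b \<in> V \<Longrightarrow>
      \<xi> u \<bullet> w = \<xi> v \<bullet> coord_deriv id (U, u) v b w"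
    and "\<And>u. \<nexists>U. (U, u) \<in> \<A> \<and> b \<in> U \<Longrightarrow> \<xi> u = 0"
  shows "\<xi> \<in> covectors \<A> b"
  unfolding covectors_def by (auto intro!: assms)

lemma covector_transition:
  assumes "(U, u) \<in> \<A>" and "(V, v) \<in> \<A>" and "b \<in> U" and "b \<in> V" and "\<xi> \<in> covectors \<A> b"
  shows "\<xi> u \<bullet> w = \<xi> v \<bullet> coord_deriv id (U, u) v b w"
proof -
  have "\<forall>(U, u)\<in>\<A>. \<forall>(V, v)\<in>\<A>. b \<in> U \<inter> V \<longrightarrow> (\<forall>w. \<xi> u \<bullet> w = \<xi> v \<bullet> coord_deriv id (U, u) v b w)"
    using assms(5) by (simp add: covectors_def)
  from bspec[OF this assms(1)]
  have "\<forall>(V, v)\<in>\<A>. b \<in> U \<inter> V \<longrightarrow> (\<forall>w. \<xi> u \<bullet> w = \<xi> v \<bullet> coord_deriv id (U, u) v b w)"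
    by simp
  from bspec[OF this assms(2)] show ?thesis using assms(3,4) by simp
qed

text \<open>One component fixes the others around \<open>b\<close> by pairing with transitions; the
  remaining entries are pinned by the default value 0 in \<open>covectors\<close>.\<close>

lemma covector_eqI:
  assumes "(U, u) \<in> \<A>" and "b \<in> U" and "\<xi> \<in> covectors \<A> b" and "\<eta> \<in> covectors \<A> b" and "\<xi> u = \<eta> u"
  shows "\<xi> = \<eta>"
proof
  fix v
  show "\<xi> v = \<eta> v"
  proof (cases "\<exists>V. (V, v) \<in> \<A> \<and> b \<in> V")
    case True
    then obtain V where "(V, v) \<in> \<A>" "b \<in> V" by blast
    then have "\<xi> v \<bullet> w = \<eta> v \<bullet> w" for w
      using covector_transition assms by metis
    then show ?thesis using vector_eq_rdot by blast
  qed (use assms(3,4) in \<open>auto simp: covectors_def\<close>)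
qed

text \<open>The component in a chart \<open>v\<close> is the prescribed \<open>y\<close> pulled back
  by the adjoint of the transition from \<open>v\<close> to \<open>u\<close>.\<close>

lemma covector_exists:
  assumes "(U, u) \<in> \<A>" and "b \<in> U"
  shows "\<exists>\<xi>\<in>covectors \<A> b. \<xi> u = y"
proof -
  \<comment> \<open>\<open>S v\<close> picks some domain of \<open>v\<close> around
    \<open>b\<close>. The cocycle rule shows below that the choice does not affect the
    pairing.\<close>
  define S where "S v = (SOME V. (V, v) \<in> \<A> \<and> b \<in> V)" for v
  define \<xi> where "\<xi> v = (if \<exists>V. (V, v) \<in> \<A> \<and> b \<in> V then adjoint (coord_deriv id (S v, v) u b) y else 0)" for v
  have S: "(S v, v) \<in> \<A>" "b \<in> S v" if "(V, v) \<in> \<A>" "b \<in> V" for V v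
    unfolding S_def using someI[of "\<lambda>V. (V, v) \<in> \<A> \<and> b \<in> V"] that by auto
  have \<xi>: "\<xi> v \<bullet> w = y \<bullet> coord_deriv id (V, v) u b w" if V: "(V, v) \<in> \<A>" "b \<in> V" for V v w
  proof -
    have "\<xi> v \<bullet> w = y \<bullet> coord_deriv id (S v, v) u b w"
      using adjoint_works[OF transition_linear[OF S(1)[OF V] assms(1) S(2)[OF V] assms(2)], of w y] V
      by (auto simp: \<xi>_def inner_commute)
    also have "coord_deriv id (S v, v) u b w = coord_deriv id (V, v) u b w"
      using transition_cocycle[OF V(1) S(1)[OF V] assms(1) V(2) S(2)[OF V] assms(2), of w]
        transition_id[OF V(1) S(1)[OF V] V(2) S(2)[OF V]] by simp
    finally show ?thesis .
  qed
  have "\<xi> v \<bullet> w = \<xi> v' \<bullet> coord_deriv id (V, v) v' b w"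
    if "(V, v) \<in> \<A>" "(V', v') \<in> \<A>" "b \<in> V" "b \<in> V'" for V v V' v' w
    using \<xi> that transition_cocycle[OF that(1,2) assms(1) that(3,4) assms(2)] by simp
  moreover have "\<xi> v = 0" if "\<nexists>V. (V, v) \<in> \<A> \<and> b \<in> V" for v
    using that unfolding \<xi>_def by (rule if_not_P)
  ultimately have "\<xi> \<in> covectors \<A> b"
    by (rule covectorsI)
  moreover have "\<xi> u \<bullet> w = y \<bullet> w" for w
    using \<xi>[OF assms] transition_id[OF assms(1,1,2,2)] by simp
  then have "\<xi> u = y" using vector_eq_rdot by blast
  ultimately show ?thesis by blast
qed

definition covector :: "('b \<Rightarrow> real^'n) \<Rightarrow> 'b \<Rightarrow> real^'n \<Rightarrow> ('b \<Rightarrow> real^'n) \<Rightarrow> real^'n" where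
  "covector u b y = (THE \<xi>. \<xi> \<in> covectors \<A> b \<and> \<xi> u = y)"

lemma
  assumes "(U, u) \<in> \<A>" and "b \<in> U"
  shows covector_in: "covector u b y \<in> covectors \<A> b" and covector_component: "covector u b y u = y"
proof -
  have "\<exists>!\<xi>. \<xi> \<in> covectors \<A> b \<and> \<xi> u = y"
    using covector_exists[OF assms] covector_eqI[OF assms] by metis
  from theI'[OF this] show "covector u b y \<in> covectors \<A> b" "covector u b y u = y"
    by (simp_all add: covector_def)
qed

lemma covector_unique:
  assumes "(U, u) \<in> \<A>" and "b \<in> U" and "\<xi> \<in> covectors \<A> b"
  shows "covector u b (\<xi> u) = \<xi>"
  using covector_eqI[OF assms(1,2) covector_in[OF assms(1,2)] assms(3)] covector_component[OF assms(1,2)]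
  by simp

lemma covectors_diff:
  assumes "\<xi> \<in> covectors \<A> b" and "\<eta> \<in> covectors \<A> b"
  shows "(\<lambda>u. \<xi> u - \<eta> u) \<in> covectors \<A> b"
proof -
  have "(\<xi> u - \<eta> u) \<bullet> w = (\<xi> v - \<eta> v) \<bullet> coord_deriv id (U, u) v b w"
    if "(U, u) \<in> \<A>" "(V, v) \<in> \<A>" "b \<in> U" "b \<in> V" for U u V v w
    using covector_transition[OF that assms(1)] covector_transition[OF that assms(2)]
    by (simp add: inner_diff_left)
  moreover have "\<xi> u - \<eta> u = 0" if "\<nexists>U. (U, u) \<in> \<A> \<and> b \<in> U" for u
    using assms that unfolding covectors_def by simp
  ultimately show ?thesis
    by (rule covectorsI)
qed

text \<open>Integrality passes between charts: the i-th component in \<open>v\<close> is the pairing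
  of \<open>\<xi> u\<close> with the i-th column of an integral matrix.\<close>

lemma period_lattice_iff:
  assumes "(U, u) \<in> \<A>" and "b \<in> U"
  shows "\<xi> \<in> period_lattice \<A> b \<longleftrightarrow> \<xi> \<in> covectors \<A> b \<and> (\<forall>i. \<xi> u $ i \<in> \<int>)"
proof
  assume "\<xi> \<in> period_lattice \<A> b"
  then show "\<xi> \<in> covectors \<A> b \<and> (\<forall>i. \<xi> u $ i \<in> \<int>)"
    using assms unfolding period_lattice_def by fast
next
  assume \<xi>: "\<xi> \<in> covectors \<A> b \<and> (\<forall>i. \<xi> u $ i \<in> \<int>)"
  have "\<xi> v $ i \<in> \<int>" if V: "(V, v) \<in> \<A>" "b \<in> V" for V v i
  proof -
    obtain A where A: "integral_matrix A" "coord_deriv id (V, v) u b = (*v) A"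
      by (rule transitionE[OF V(1) assms(1) V(2) assms(2)], rule that)
    have "\<xi> v $ i = \<xi> u \<bullet> (A *v axis i 1)"
      using covector_transition[OF V(1) assms(1) V(2) assms(2), of \<xi> "axis i 1"] \<xi> A(2)
      by (simp add: inner_axis)
    also have "\<dots> = (\<Sum>k\<in>UNIV. \<xi> u $ k * A $ k $ i)"
      by (simp add: inner_vec_def matrix_vector_mult_basis column_def)
    also have "\<dots> \<in> \<int>"
      using \<xi> A(1) by (intro Ints_sum Ints_mult) (auto simp: integral_matrix_def)
    finally show ?thesis .
  qed
  then show "\<xi> \<in> period_lattice \<A> b"
    using \<xi> by (auto simp: period_lattice_def)
qed

lemma lattice_coset_eq_iff:
  assumes "(U, u) \<in> \<A>" and "b \<in> U" and \<xi>: "\<xi> \<in> covectors \<A> b" and \<eta>: "\<eta> \<in> covectors \<A> b"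
  shows "lattice_coset \<A> b \<xi> = lattice_coset \<A> b \<eta> \<longleftrightarrow> (\<forall>i. (\<xi> u - \<eta> u) $ i \<in> \<int>)"
proof
  have zero: "(\<lambda>_. 0) \<in> period_lattice \<A> b"
    by (auto simp: period_lattice_def covectors_def)
  assume "lattice_coset \<A> b \<xi> = lattice_coset \<A> b \<eta>"
  moreover have "\<xi> \<in> lattice_coset \<A> b \<xi>"
    unfolding lattice_coset_def by (rule CollectI, rule exI[of _ "\<lambda>_. 0"]) (use zero in auto)
  ultimately obtain l where "\<xi> = (\<lambda>u. \<eta> u + l u)" "l \<in> period_lattice \<A> b"
    by (auto simp: lattice_coset_def)
  then show "\<forall>i. (\<xi> u - \<eta> u) $ i \<in> \<int>"
    using period_lattice_iff[OF assms(1,2)] by simp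
next
  assume int: "\<forall>i. (\<xi> u - \<eta> u) $ i \<in> \<int>"
  \<comment> \<open>Proved for arbitrary covectors, so that both inclusions follow by exchanging
    them. An element \<open>\<xi> + l\<close> of the first coset is rewritten as
    \<open>\<eta> + (l - (\<eta> - \<xi>))\<close>.\<close>
  have sub: "lattice_coset \<A> b \<xi> \<subseteq> lattice_coset \<A> b \<eta>"
    if "\<xi> \<in> covectors \<A> b" "\<eta> \<in> covectors \<A> b" "\<forall>i. (\<xi> u - \<eta> u) $ i \<in> \<int>" for \<xi> \<eta>
  proof
    fix \<zeta> assume "\<zeta> \<in> lattice_coset \<A> b \<xi>"
    then obtain l where l: "\<zeta> = (\<lambda>u. \<xi> u + l u)" "l \<in> period_lattice \<A> b"
      by (auto simp: lattice_coset_def)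
    have "(\<lambda>_. 0) \<in> covectors \<A> b" by (auto simp: covectors_def)
    then have "(\<lambda>u. \<eta> u - \<xi> u) \<in> covectors \<A> b" and "(\<lambda>u. l u - (\<eta> u - \<xi> u)) \<in> covectors \<A> b"
      using l(2) that(1,2) by (auto intro!: covectors_diff simp: period_lattice_def)
    moreover have "(l u - (\<eta> u - \<xi> u)) $ i \<in> \<int>" for i
    proof -
      have "(l u - (\<eta> u - \<xi> u)) $ i = l u $ i + (\<xi> u - \<eta> u) $ i" by simp
      then show ?thesis
        using that(3) l(2) period_lattice_iff[OF assms(1,2)] by (metis Ints_add)
    qed
    ultimately have lat: "(\<lambda>u. l u - (\<eta> u - \<xi> u)) \<in> period_lattice \<A> b"
      using period_lattice_iff[OF assms(1,2)] by blast
    show "\<zeta> \<in> lattice_coset \<A> b \<eta>"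
      unfolding lattice_coset_def
      by (rule CollectI, rule exI[of _ "\<lambda>u. l u - (\<eta> u - \<xi> u)"]) (simp add: lat l(1) fun_eq_iff)
  qed
  have "\<forall>i. (\<eta> u - \<xi> u) $ i \<in> \<int>"
  proof
    fix i
    have "(\<eta> u - \<xi> u) $ i = - ((\<xi> u - \<eta> u) $ i)" by simp
    then show "(\<eta> u - \<xi> u) $ i \<in> \<int>" using int by (metis Ints_minus)
  qed
  then show "lattice_coset \<A> b \<xi> = lattice_coset \<A> b \<eta>"
    using sub \<xi> \<eta> int by blast
qed

section \<open>The torus parametrisation and the quotient topology\<close>

lemma param_eq:
  assumes "(U, u) \<in> \<A>" and "b \<in> U"
  shows "cotangent_param \<A> (U, u) (u b, y) = (b, lattice_coset \<A> b (covector u b y))"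
  using inv_chart[OF assms] by (simp add: cotangent_param_def covector_def Let_def)

lemma fst_param:
  assumes "(U, u) \<in> \<A>" and "fst p \<in> u ` U"
  shows "fst (cotangent_param \<A> (U, u) p) = inv_into U u (fst p)"
  using assms param_eq[OF assms(1)] inv_chart[OF assms(1)] by (cases p) auto

text \<open>Hence the fibre coordinate \<open>y\<close> lives on a torus with all periods one; the
  radius 1/2 used for charts later comes from here.\<close>

lemma param_eq_iff:
  assumes "(U, u) \<in> \<A>" and "x \<in> u ` U" and "x' \<in> u ` U"
  shows "cotangent_param \<A> (U, u) (x, y) = cotangent_param \<A> (U, u) (x', y') \<longleftrightarrow>
    x = x' \<and> (\<forall>i. (y - y') $ i \<in> \<int>)"
proof -
  obtain b b' where b: "b \<in> U" "x = u b" "b' \<in> U" "x' = u b'" using assms(2,3) by blast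
  have inj: "u b = u b' \<longleftrightarrow> b = b'"
    using b top_chartD(3)[OF chart[OF assms(1)]] by (auto dest: inj_onD)
  show ?thesis
    using b assms(1) inj param_eq[OF assms(1)] lattice_coset_eq_iff[OF assms(1) b(1)]
      covector_in[OF assms(1)] covector_component[OF assms(1)]
    by (metis fst_conv snd_conv)
qed

abbreviation "Q \<equiv> cotangent_quotient \<A>"

text \<open>\<open>topology\<close> returns the intended open sets only for a predicate closed under
  binary intersections and arbitrary unions, which is checked here through preimages under the
  parametrisations.\<close>

lemma openin_cotangent_quotient:
  "openin (mtop Q) S \<longleftrightarrow> S \<subseteq> (SIGMA b:W. lattice_coset \<A> b ` covectors \<A> b) \<and>
     (\<forall>(U, u)\<in>\<A>. open {p \<in> u ` U \<times> UNIV. cotangent_param \<A> (U, u) p \<in> S})"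
proof -
  have W: "W = (\<Union>(U, u)\<in>\<A>. U)" using affine_atlas by (simp add: integral_affine_atlas_def)
  have "istopology (\<lambda>S. S \<subseteq> (SIGMA b:W. lattice_coset \<A> b ` covectors \<A> b) \<and>
     (\<forall>(U, u)\<in>\<A>. open {p \<in> u ` U \<times> UNIV. cotangent_param \<A> (U, u) p \<in> S}))"
    unfolding istopology_def
  proof (intro conjI allI impI)
    fix S S' assume S: "S \<subseteq> (SIGMA b:W. lattice_coset \<A> b ` covectors \<A> b) \<and>
       (\<forall>(U, u)\<in>\<A>. open {p \<in> u ` U \<times> UNIV. cotangent_param \<A> (U, u) p \<in> S})"
      and S': "S' \<subseteq> (SIGMA b:W. lattice_coset \<A> b ` covectors \<A> b) \<and>
       (\<forall>(U, u)\<in>\<A>. open {p \<in> u ` U \<times> UNIV. cotangent_param \<A> (U, u) p \<in> S'})"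
    then show "S \<inter> S' \<subseteq> (SIGMA b:W. lattice_coset \<A> b ` covectors \<A> b)" by blast
    show "\<forall>(U, u)\<in>\<A>. open {p \<in> u ` U \<times> UNIV. cotangent_param \<A> (U, u) p \<in> S \<inter> S'}"
    proof clarify
      fix U u assume c: "(U, u) \<in> \<A>"
      have "{p \<in> u ` U \<times> UNIV. cotangent_param \<A> (U, u) p \<in> S \<inter> S'} =
        {p \<in> u ` U \<times> UNIV. cotangent_param \<A> (U, u) p \<in> S} \<inter> {p \<in> u ` U \<times> UNIV. cotangent_param \<A> (U, u) p \<in> S'}"
        by blast
      then show "open {p \<in> u ` U \<times> UNIV. cotangent_param \<A> (U, u) p \<in> S \<inter> S'}"
        using S S' c by (auto intro!: open_Int)
    qed
  next
    fix \<K> assume \<K>: "\<forall>S\<in>\<K>. S \<subseteq> (SIGMA b:W. lattice_coset \<A> b ` covectors \<A> b) \<and>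
       (\<forall>(U, u)\<in>\<A>. open {p \<in> u ` U \<times> UNIV. cotangent_param \<A> (U, u) p \<in> S})"
    then show "\<Union>\<K> \<subseteq> (SIGMA b:W. lattice_coset \<A> b ` covectors \<A> b)" by blast
    show "\<forall>(U, u)\<in>\<A>. open {p \<in> u ` U \<times> UNIV. cotangent_param \<A> (U, u) p \<in> \<Union>\<K>}"
    proof clarify
      fix U u assume c: "(U, u) \<in> \<A>"
      have "{p \<in> u ` U \<times> UNIV. cotangent_param \<A> (U, u) p \<in> \<Union>\<K>} =
        (\<Union>S\<in>\<K>. {p \<in> u ` U \<times> UNIV. cotangent_param \<A> (U, u) p \<in> S})"
        by blast
      then show "open {p \<in> u ` U \<times> UNIV. cotangent_param \<A> (U, u) p \<in> \<Union>\<K>}"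
        using \<K> c by (auto intro!: open_UN)
    qed
  qed
  then show ?thesis
    by (simp add: cotangent_quotient_def W[symmetric] topology_inverse')
qed

lemma param_in:
  assumes "(U, u) \<in> \<A>" and "fst p \<in> u ` U"
  shows "cotangent_param \<A> (U, u) p \<in> (SIGMA b:W. lattice_coset \<A> b ` covectors \<A> b)"
proof -
  obtain b where b: "b \<in> U" "fst p = u b" using assms(2) by blast
  have "b \<in> W" using affine_atlas assms(1) b(1) by (auto simp: integral_affine_atlas_def)
  then show ?thesis
    using param_eq[OF assms(1) b(1), of "snd p"] b(2) covector_in[OF assms(1) b(1)] by (cases p) auto
qed

lemma points_cotangent_quotient: "points Q = (SIGMA b:W. lattice_coset \<A> b ` covectors \<A> b)" (is "_ = ?C")
proof
  have "openin (mtop Q) ?C"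
    unfolding openin_cotangent_quotient
  proof (intro conjI ballI, goal_cases)
    case (2 c)
    obtain U u where c: "c = (U, u)" by force
    have "{p \<in> u ` U \<times> UNIV. cotangent_param \<A> (U, u) p \<in> ?C} = u ` U \<times> UNIV"
      using param_in[of U u] 2 c by auto
    then show ?case
      using top_chartD(2)[OF chart] 2 c by (auto intro!: open_Times)
  qed auto
  then show "?C \<subseteq> points Q" by (rule openin_subset)
  show "points Q \<subseteq> ?C"
    using openin_cotangent_quotient[of "points Q"] by blast
qed

lemma param_in_points:
  "(U, u) \<in> \<A> \<Longrightarrow> fst p \<in> u ` U \<Longrightarrow> cotangent_param \<A> (U, u) p \<in> points Q"
  by (simp only: points_cotangent_quotient param_in)

lemma param_surj:
  assumes "(U, u) \<in> \<A>" and "q \<in> points Q" and "fst q \<in> U"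
  obtains y where "q = cotangent_param \<A> (U, u) (u (fst q), y)"
proof -
  obtain \<xi> where \<xi>: "\<xi> \<in> covectors \<A> (fst q)" "snd q = lattice_coset \<A> (fst q) \<xi>"
    using assms(2) unfolding points_cotangent_quotient by auto
  have "q = cotangent_param \<A> (U, u) (u (fst q), \<xi> u)"
    using param_eq[OF assms(1,3)] covector_unique[OF assms(1,3) \<xi>(1)] \<xi>(2) by (simp add: prod_eq_iff)
  then show thesis by (rule that)
qed

text \<open>Openness has to be tested in every chart, not only in \<open>U\<close>. In another chart
  the preimage is covered by open sets on which a lift of the coordinate change, corrected by an
  integral translation, lands in \<open>O'\<close>.\<close>

lemma openin_param_image:
  assumes c: "(U, u) \<in> \<A>" and "open O'" and "O' \<subseteq> u ` U \<times> UNIV"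
  shows "openin (mtop Q) (cotangent_param \<A> (U, u) ` O')"
  unfolding openin_cotangent_quotient
proof (intro conjI ballI, goal_cases)
  case 1
  show ?case
  proof (rule image_subsetI)
    fix p assume "p \<in> O'"
    then have "fst p \<in> u ` U" using assms(3) by auto
    then show "cotangent_param \<A> (U, u) p \<in> (SIGMA b:W. lattice_coset \<A> b ` covectors \<A> b)"
      by (rule param_in[OF c])
  qed
next
  case (2 d)
  obtain V v where d: "d = (V, v)" by force
  then have dA: "(V, v) \<in> \<A>" using 2 by simp
  let ?P = "{p \<in> v ` V \<times> UNIV. cotangent_param \<A> (V, v) p \<in> cotangent_param \<A> (U, u) ` O'}"
  have "\<exists>N. open N \<and> p \<in> N \<and> N \<subseteq> ?P" if p: "p \<in> ?P" for p
  proof -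
    obtain b y where b: "b \<in> V" "p = (v b, y)" using p by auto
    obtain p1 where p1: "p1 \<in> O'" "cotangent_param \<A> (V, v) p = cotangent_param \<A> (U, u) p1"
      using p by auto
    obtain b1 y1 where b1: "b1 \<in> U" "p1 = (u b1, y1)" using p1(1) assms(3) by auto
    have "b1 = b" using p1(2) b b1 param_eq[OF dA] param_eq[OF c] by simp
    obtain A a G where tr: "openin T G" "b \<in> G" "G \<subseteq> U \<inter> V" "\<And>y. y \<in> G \<Longrightarrow> coord_deriv id (U, u) v y = (*v) A"
      by (rule transitionE[OF c dA b1(1)[unfolded \<open>b1 = b\<close>] b(1)], rule that)
    \<comment> \<open>The transition matrix \<open>A\<close> from \<open>u\<close> to
      \<open>v\<close> acts on components in the opposite direction, as a row-vector
      product.\<close>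
    have par: "cotangent_param \<A> (V, v) (v b', y') = cotangent_param \<A> (U, u) (u b', y' v* A)"
      if b': "b' \<in> G" for b' y'
    proof -
      have b'_in: "b' \<in> U" "b' \<in> V" using b' tr(3) by auto
      let ?\<xi> = "covector v b' y'"
      have \<xi>: "?\<xi> \<in> covectors \<A> b'" using covector_in[OF dA b'_in(2)] .
      have "?\<xi> u \<bullet> w = (y' v* A) \<bullet> w" for w
        using covector_transition[OF c dA b'_in \<xi>] covector_component[OF dA b'_in(2)] tr(4)[OF b']
        by (simp add: dot_lmul_matrix)
      then have "?\<xi> u = y' v* A" using vector_eq_rdot by blast
      then show ?thesis
        using param_eq[OF dA b'_in(2)] param_eq[OF c b'_in(1)] covector_unique[OF c b'_in(1) \<xi>] by simp
    qed
    \<comment> \<open>\<open>p\<close> and \<open>p1\<close> represent the same coset, so after the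
      coordinate change their fibre coordinates differ by an integer vector. Subtracting it makes
      \<theta> send \<open>p\<close> to \<open>p1\<close> itself, hence into
      \<open>O'\<close>.\<close>
    define k where "k = y v* A - y1"
    have k: "k $ i \<in> \<int>" for i
    proof -
      have "cotangent_param \<A> (U, u) (u b, y v* A) = cotangent_param \<A> (U, u) (u b, y1)"
        using p1(2) b(2) b1(2) \<open>b1 = b\<close> par[OF tr(2)] by simp
      then show ?thesis
        using param_eq_iff[OF c, of "u b" "u b"] b1(1) \<open>b1 = b\<close> by (simp add: k_def)
    qed
    define \<theta> where "\<theta> q = (u (inv_into V v (fst q)), snd q v* A - k)" for q
    have open_vG: "open (v ` G)"
      using top_chart_open_image[OF chart[OF dA] tr(1)] tr(3) by blast
    have "continuous_map (top_of_set (v ` G)) (subtopology T U) (inv_into V v)"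
      unfolding continuous_map_in_subtopology
    proof
      show "continuous_map (top_of_set (v ` G)) T (inv_into V v)"
        using top_chartD(5)[OF chart[OF dA]] by (rule continuous_map_from_subtopology_mono) (use tr(3) in blast)
      show "inv_into V v \<in> topspace (top_of_set (v ` G)) \<rightarrow> U"
        using tr(3) inv_chart[OF dA] by (auto simp: subset_iff)
    qed
    from continuous_map_compose[OF this top_chartD(4)[OF chart[OF c]]]
    have cont: "continuous_on (v ` G) (\<lambda>x. u (inv_into V v x))" by (simp add: o_def)
    have "continuous_on (v ` G \<times> UNIV) (\<lambda>q. u (inv_into V v (fst q)))"
      by (rule continuous_on_compose2[OF cont]) (auto intro!: continuous_intros)
    moreover have "continuous_on (v ` G \<times> UNIV) (\<lambda>q. transpose A *v snd q)"
      by (rule continuous_on_compose2[OF matrix_vector_mult_linear_continuous_on[of UNIV]])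
        (auto intro!: continuous_intros)
    ultimately have "continuous_on (v ` G \<times> UNIV) \<theta>"
      unfolding \<theta>_def by (auto intro!: continuous_on_Pair continuous_on_diff)
    then have "open ((v ` G \<times> UNIV) \<inter> \<theta> -` O')"
      using open_vG assms(2) continuous_open_preimage open_Times open_UNIV by blast
    moreover have "p \<in> (v ` G \<times> UNIV) \<inter> \<theta> -` O'"
      using b tr(2) p1(1) b1 \<open>b1 = b\<close> inv_chart[OF dA b(1)] by (auto simp: \<theta>_def k_def)
    moreover have "(v ` G \<times> UNIV) \<inter> \<theta> -` O' \<subseteq> ?P"
    proof
      fix q assume q: "q \<in> (v ` G \<times> UNIV) \<inter> \<theta> -` O'"
      then obtain b' y' where b': "b' \<in> G" "q = (v b', y')" by auto
      then have b'_in: "b' \<in> U" "b' \<in> V" using tr(3) by auto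
      have "cotangent_param \<A> (V, v) q = cotangent_param \<A> (U, u) (\<theta> q)"
        using par[OF b'(1)] b'(2) inv_chart[OF dA b'_in(2)] param_eq_iff[OF c, of "u b'" "u b'"] b'_in(1) k
        by (simp add: \<theta>_def)
      then show "q \<in> ?P" using q b'_in b'(2) by auto
    qed
    ultimately show ?thesis by blast
  qed
  then have "open ?P" by (subst open_subopen) blast
  then show ?case by (simp add: d)
qed

end

section \<open>Conformally symplectic maps over the identity\<close>

lemma open_sub_simps [simp]:
  "mtop (open_sub M G) = subtopology (mtop M) G"
  "atlas (open_sub M G) = (\<lambda>(U, \<phi>). (U \<inter> G, \<phi>)) ` atlas M"
  "form (open_sub X G) = form X"
  by (simp_all add: open_sub_def)

lemma smooth_map_on_has_derivative:
  assumes "smooth_map_on M N S h" and "(U, \<phi>) \<in> atlas M" and "(V, \<psi>) \<in> atlas N" and "x \<in> U" "x \<in> S" "h x \<in> V"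
  shows "((\<psi> \<circ> h \<circ> inv_into U \<phi>) has_derivative coord_deriv h (U, \<phi>) \<psi> x) (at (\<phi> x))"
proof -
  have "\<forall>(U, \<phi>)\<in>atlas M. \<forall>(V, \<psi>)\<in>atlas N. smooth_on (\<phi> ` {x \<in> U \<inter> S. h x \<in> V}) (\<psi> \<circ> h \<circ> inv_into U \<phi>)"
    using assms(1) by (simp add: smooth_map_on_def)
  from bspec[OF this assms(2)]
  have "\<forall>(V, \<psi>)\<in>atlas N. smooth_on (\<phi> ` {x \<in> U \<inter> S. h x \<in> V}) (\<psi> \<circ> h \<circ> inv_into U \<phi>)" by simp
  from bspec[OF this assms(3)]
  have "C_k_on 1 (\<psi> \<circ> h \<circ> inv_into U \<phi>) (\<phi> ` {x \<in> U \<inter> S. h x \<in> V})"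
    by (simp add: smooth_on_def)
  then have "(\<psi> \<circ> h \<circ> inv_into U \<phi>) differentiable (at (\<phi> x))"
    using assms(4-6) by auto
  then show ?thesis
    by (simp add: coord_deriv_def frechet_derivative_works)
qed

lemma pulls_back_formD:
  assumes "pulls_back_form X Y c h" and "(U, \<phi>) \<in> atlas X" and "(V, \<psi>) \<in> atlas Y" and "x \<in> U" "h x \<in> V"
  shows "form Y \<psi> (h x) (coord_deriv h (U, \<phi>) \<psi> x v) (coord_deriv h (U, \<phi>) \<psi> x w) = c * form X \<phi> x v w"
proof -
  have "\<forall>(U, \<phi>)\<in>atlas X. \<forall>(V, \<psi>)\<in>atlas Y. \<forall>x\<in>U. h x \<in> V \<longrightarrow> (\<forall>v w.
        form Y \<psi> (h x) (coord_deriv h (U, \<phi>) \<psi> x v) (coord_deriv h (U, \<phi>) \<psi> x w) = c * form X \<phi> x v w)"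
    using assms(1) by (simp only: pulls_back_form_def)
  from bspec[OF this assms(2)]
  have "\<forall>(V, \<psi>)\<in>atlas Y. \<forall>x\<in>U. h x \<in> V \<longrightarrow> (\<forall>v w.
        form Y \<psi> (h x) (coord_deriv h (U, \<phi>) \<psi> x v) (coord_deriv h (U, \<phi>) \<psi> x w) = c * form X \<phi> x v w)"
    by simp
  from bspec[OF this assms(3)] show ?thesis using assms(4,5) by simp
qed

lemma smooth_map_on_points_continuous:
  "smooth_map_on M N (points M) h \<Longrightarrow> continuous_map (mtop M) (mtop N) h"
  by (simp add: smooth_map_on_def)

text \<open>Pair the vertical \<open>(0, w)\<close> with the horizontal \<open>(v, 0)\<close>. The
  image of the vertical vector has no base component, which kills the unknown term
  \<open>snd (D (v, 0))\<close> and leaves the product of \<open>v\<close> with the vertical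
  block.\<close>

lemma std_form_scaling_vertical:
  fixes D :: "(real^'n) \<times> (real^'n) \<Rightarrow> (real^'n) \<times> (real^'n)"
  assumes "\<And>v w. std_form (D v) (D w) = s * std_form v w" and "\<And>v. fst (D v) = fst v"
  shows "snd (D (0, w)) = s *\<^sub>R w"
proof -
  have "v \<bullet> snd (D (0, w)) = v \<bullet> (s *\<^sub>R w)" for v
    using assms(1)[of "(v, 0)" "(0, w)"] assms(2) by (simp add: std_form_def)
  then show ?thesis using vector_eq_ldot by blast
qed

context integral_affine
begin

text \<open>Points of a ball of radius 1/2 are less than 1 apart, so two of them cannot differ by a
  nonzero integer vector.\<close>

lemma param_chart:
  fixes y :: "real^'n"
  assumes c: "(U, u) \<in> \<A>"
  defines "O' \<equiv> u ` U \<times> ball y (1/2)"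
  shows "open O'" and "inj_on (cotangent_param \<A> (U, u)) O'"
    and "(cotangent_param \<A> (U, u) ` O', inv_into O' (cotangent_param \<A> (U, u))) \<in> atlas Q"
proof -
  show op: "open O'"
    unfolding O'_def using top_chartD(2)[OF chart[OF c]] by (intro open_Times) auto
  show inj: "inj_on (cotangent_param \<A> (U, u)) O'"
  proof (rule inj_onI)
    fix p p' assume p: "p \<in> O'" "p' \<in> O'" "cotangent_param \<A> (U, u) p = cotangent_param \<A> (U, u) p'"
    obtain x y1 x' y2 where xy: "p = (x, y1)" "p' = (x', y2)" by (metis surj_pair)
    then have *: "x = x'" "\<And>i. (y1 - y2) $ i \<in> \<int>"
      using param_eq_iff[OF c, of x x' y1 y2] p by (auto simp: O'_def)
    have "dist y1 y2 < 1"
      using p(1,2) dist_triangle_half_r[of y y1 1 y2] by (simp add: xy O'_def)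
    then have "\<bar>(y1 - y2) $ i\<bar> < 1" for i
      using component_le_norm_cart[of "y1 - y2" i] by (simp add: dist_norm)
    then have "(y1 - y2) $ i = 0" for i
      using *(2) Ints_nonzero_abs_less1 by blast
    then have "y1 = y2" by (simp add: vec_eq_iff)
    then show "p = p'" using * xy by simp
  qed
  have "O' \<subseteq> u ` U \<times> UNIV" by (auto simp: O'_def)
  then show "(cotangent_param \<A> (U, u) ` O', inv_into O' (cotangent_param \<A> (U, u))) \<in> atlas Q"
    using c op inj unfolding cotangent_quotient_def by auto
qed

text \<open>The charts of \<open>Q\<close> are local inverses of the parametrisation. Undoing the
  inverse expresses the derivative of \<Theta> directly in the parameters, where the form of
  \<open>Q\<close> is \<open>std_form\<close>.\<close>

lemma symplectomorphism_param:
  fixes Y :: "('a, (real^'n) \<times> (real^'n)) symp"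
  assumes c: "(U, u) \<in> \<A>" and \<Theta>: "symplectomorphism Q Y \<Theta>" and d: "(V, \<psi>) \<in> atlas Y"
    and p: "fst p \<in> u ` U" "\<Theta> (cotangent_param \<A> (U, u) p) \<in> V"
  obtains D where "((\<lambda>q. \<psi> (\<Theta> (cotangent_param \<A> (U, u) q))) has_derivative D) (at p)"
    and "\<And>v w. form Y \<psi> (\<Theta> (cotangent_param \<A> (U, u) p)) (D v) (D w) = std_form v w"
proof -
  let ?\<pi> = "cotangent_param \<A> (U, u)"
  define O' where "O' = u ` U \<times> ball (snd p) (1/2)"
  note O' = param_chart[OF c, of "snd p", folded O'_def]
  have pO: "p \<in> O'" using p(1) by (cases p) (auto simp: O'_def)
  have smooth: "smooth_map_on Q Y (points Q) \<Theta>" and form: "pulls_back_form Q Y 1 \<Theta>"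
    using \<Theta> by (auto simp: symplectomorphism_def diffeomorphism_def)
  have inv: "inv_into O' ?\<pi> (?\<pi> q) = q" if "q \<in> O'" for q
    using that O'(2) by simp
  have pts: "?\<pi> p \<in> points Q" using param_in_points[OF c p(1)] .
  let ?D = "coord_deriv \<Theta> (?\<pi> ` O', inv_into O' ?\<pi>) \<psi> (?\<pi> p)"
  have "((\<psi> \<circ> \<Theta> \<circ> inv_into (?\<pi> ` O') (inv_into O' ?\<pi>)) has_derivative ?D) (at p)"
    using smooth_map_on_has_derivative[OF smooth O'(3) d imageI[OF pO] pts p(2)] inv[OF pO] by simp
  then have "((\<lambda>q. \<psi> (\<Theta> (?\<pi> q))) has_derivative ?D) (at p)"
    using O'(1) pO
    by (rule has_derivative_transform_within_open)
      (simp add: inv_into_inv_into_eq[OF inj_on_imp_bij_betw[OF O'(2)]])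
  moreover have "form Y \<psi> (\<Theta> (?\<pi> p)) (?D v) (?D w) = std_form v w" for v w
    using pulls_back_formD[OF form O'(3) d imageI[OF pO] p(2)] by (simp add: cotangent_quotient_def)
  ultimately show thesis by (rule that)
qed

text \<open>In the parameters, conjugating \<open>F\<close> by \<Theta> gives a map \<open>G\<close>
  that fixes the base coordinate and multiplies \<open>std_form\<close> by \<open>s\<close>. Its
  vertical derivative is therefore \<open>s\<close>, so the vertical part of \<open>G\<close> minus
  \<open>s\<close> times \<open>y\<close> is constant on a ball. The ball must be small because its
  image has to stay in one chart of the quotient.\<close>

lemma conformal_fibre_map_local:
  fixes X :: "('a, (real^'n) \<times> (real^'n)) symp"
  assumes X: "smooth_manifold X"
    and \<Theta>: "symplectomorphism Q (open_sub X (over X f W)) \<Theta>" and f\<Theta>: "\<And>q. q \<in> points Q \<Longrightarrow> f (\<Theta> q) = fst q"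
    and F: "smooth_map_on X X (points X) F" "pulls_back_form X X s F" "\<And>x. x \<in> points X \<Longrightarrow> f (F x) = f x"
    and c: "(U, u) \<in> \<A>" and b: "b \<in> U"
  shows "\<exists>\<epsilon>>0. \<exists>a. \<forall>y\<in>ball y0 \<epsilon>.
    F (\<Theta> (cotangent_param \<A> (U, u) (u b, y))) = \<Theta> (cotangent_param \<A> (U, u) (u b, a + s *\<^sub>R y))"
proof -
  let ?\<Omega> = "over X f W" and ?\<pi> = "cotangent_param \<A> (U, u)"
  let ?Y = "open_sub X ?\<Omega>"
  have ptsY: "topspace (subtopology (mtop X) ?\<Omega>) = ?\<Omega>" by (auto simp: over_def)
  have bij: "bij_betw \<Theta> (points Q) ?\<Omega>" and
    \<Theta>s: "smooth_map_on Q ?Y (points Q) \<Theta>" and \<Theta>'s: "smooth_map_on ?Y Q (points ?Y) (inv_into (points Q) \<Theta>)"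
    using \<Theta> ptsY by (auto simp: symplectomorphism_def diffeomorphism_def)
  let ?\<Theta>' = "inv_into (points Q) \<Theta>"
  have inv\<Theta>: "?\<Theta>' (\<Theta> q) = q" if "q \<in> points Q" for q
    using bij_betw_inv_into_left[OF bij that] .
  have \<Theta>inv: "\<Theta> (?\<Theta>' x) = x" "?\<Theta>' x \<in> points Q" if "x \<in> ?\<Omega>" for x
    using bij_betw_inv_into_right[OF bij that] bij_betw_apply[OF bij_betw_inv_into[OF bij] that] by auto
  have \<Theta>in: "\<Theta> q \<in> ?\<Omega>" if "q \<in> points Q" for q
    using bij_betw_apply[OF bij that] .
  have Fc: "continuous_map (mtop X) (mtop X) F"
    using smooth_map_on_points_continuous[OF F(1)] .
  have F\<Omega>: "F x \<in> ?\<Omega>" if "x \<in> ?\<Omega>" for x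
    using that F(3)[of x] continuous_map_image_subset_topspace[OF Fc] by (auto simp: over_def)
  have \<Theta>c: "continuous_map (mtop Q) (subtopology (mtop X) ?\<Omega>) \<Theta>"
    using smooth_map_on_points_continuous[OF \<Theta>s] by simp
  define \<Gamma> where "\<Gamma> q = ?\<Theta>' (F (\<Theta> q))" for q
  have \<Gamma>: "\<Gamma> q \<in> points Q" "\<Theta> (\<Gamma> q) = F (\<Theta> q)" if "q \<in> points Q" for q
    using \<Theta>inv[OF F\<Omega>[OF \<Theta>in[OF that]]] by (auto simp: \<Gamma>_def)
  have fst\<Gamma>: "fst (\<Gamma> q) = fst q" if "q \<in> points Q" for q
    using f\<Theta>[OF \<Gamma>(1)[OF that]] f\<Theta>[OF that] \<Gamma>(2)[OF that] F(3)[of "\<Theta> q"] \<Theta>in[OF that] by (simp add: over_def)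
  have \<Gamma>c: "continuous_map (mtop Q) (mtop Q) \<Gamma>"
  proof -
    have "continuous_map (subtopology (mtop X) ?\<Omega>) (subtopology (mtop X) ?\<Omega>) F"
      unfolding continuous_map_in_subtopology using F\<Omega> ptsY continuous_map_from_subtopology[OF Fc] by auto
    moreover have "continuous_map (subtopology (mtop X) ?\<Omega>) (mtop Q) ?\<Theta>'"
      using smooth_map_on_points_continuous[OF \<Theta>'s] by simp
    ultimately have "continuous_map (mtop Q) (mtop Q) (?\<Theta>' \<circ> (F \<circ> \<Theta>))"
      using \<Theta>c by (intro continuous_map_compose)
    then show ?thesis by (simp add: \<Gamma>_def[abs_def] o_def)
  qed
  have ub: "u b \<in> u ` U" using b by simp
  let ?p0 = "(u b, y0)"
  have p0: "?\<pi> ?p0 \<in> points Q" using param_in_points[OF c] ub by simp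
  have "fst (\<Gamma> (?\<pi> ?p0)) = b"
    using fst\<Gamma>[OF p0] fst_param[OF c, of ?p0] ub inv_chart[OF c b] by simp
  then obtain y1 where y1: "\<Gamma> (?\<pi> ?p0) = ?\<pi> (u b, y1)"
    using param_surj[OF c \<Gamma>(1)[OF p0]] b by metis
  \<comment> \<open>\<open>O0\<close> and \<open>O1\<close> are windows in which the parametrisation
    is injective, around the point and around its image; \<open>y1\<close> is some fibre coordinate
    of the image.\<close>
  define O0 where "O0 = u ` U \<times> ball y0 (1/2)"
  define O1 where "O1 = u ` U \<times> ball y1 (1/2)"
  note O0 = param_chart[OF c, of y0, folded O0_def]
  note O1 = param_chart[OF c, of y1, folded O1_def]
  let ?\<chi> = "inv_into O1 ?\<pi>"
  have sub: "O0 \<subseteq> u ` U \<times> UNIV" "O1 \<subseteq> u ` U \<times> UNIV" by (auto simp: O0_def O1_def)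
  let ?z0 = "\<Theta> (?\<pi> ?p0)"
  have z0: "?z0 \<in> points X" "F ?z0 \<in> points X"
    using \<Theta>in[OF p0] F\<Omega>[OF \<Theta>in[OF p0]] by (auto simp: over_def)
  have cover: "points X = (\<Union>(U, \<phi>)\<in>atlas X. U)" and charts: "\<And>c. c \<in> atlas X \<Longrightarrow> top_chart (mtop X) c"
    using X by (auto simp: smooth_manifold_def)
  obtain V \<psi> where d: "(V, \<psi>) \<in> atlas X" "?z0 \<in> V" using z0(1) cover by auto
  obtain V' \<psi>' where d': "(V', \<psi>') \<in> atlas X" "F ?z0 \<in> V'" using z0(2) cover by auto
  have dY: "(V \<inter> ?\<Omega>, \<psi>) \<in> atlas ?Y" "(V' \<inter> ?\<Omega>, \<psi>') \<in> atlas ?Y"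
    using d(1) d'(1) by (auto intro: rev_image_eqI)
  \<comment> \<open>\<open>S\<close> keeps the three relevant points in one chart each: a chart of
    \<open>X\<close> at the point, one at its image under \<open>F\<close>, and the window
    \<open>O1\<close> of the quotient.\<close>
  define S where "S = {q \<in> points Q. \<Theta> q \<in> V} \<inter> {q \<in> points Q. F (\<Theta> q) \<in> V'} \<inter> {q \<in> points Q. \<Gamma> q \<in> ?\<pi> ` O1}"
  have "openin (mtop Q) S"
  proof -
    have c1: "continuous_map (mtop Q) (mtop X) \<Theta>" using \<Theta>c continuous_map_into_fulltopology by blast
    have c2: "continuous_map (mtop Q) (mtop X) (\<lambda>q. F (\<Theta> q))"
      using continuous_map_compose[OF c1 Fc] by (simp add: o_def)
    show ?thesis
      unfolding S_def
      using openin_continuous_map_preimage[OF c1 top_chartD(1)[OF charts[OF d(1)]]]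
        openin_continuous_map_preimage[OF c2 top_chartD(1)[OF charts[OF d'(1)]]]
        openin_continuous_map_preimage[OF \<Gamma>c openin_param_image[OF c O1(1) sub(2)]]
      by (intro openin_Int)
  qed
  then have "open {p \<in> u ` U \<times> UNIV. ?\<pi> p \<in> S}"
    using c unfolding openin_cotangent_quotient by auto
  define N where "N = O0 \<inter> {p \<in> u ` U \<times> UNIV. ?\<pi> p \<in> S}"
  have openN: "open N"
    unfolding N_def using O0(1) \<open>open {p \<in> u ` U \<times> UNIV. ?\<pi> p \<in> S}\<close> by (rule open_Int)
  have "(u b, y1) \<in> O1" using ub by (simp add: O1_def)
  then have "?\<pi> ?p0 \<in> S"
    using p0 d(2) d'(2) y1 by (auto simp: S_def)
  then have p0N: "?p0 \<in> N" using ub by (simp add: N_def O0_def)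
  define G where "G p = ?\<chi> (\<Gamma> (?\<pi> p))" for p
  have NU: "fst p \<in> u ` U" if "p \<in> N" for p using that by (auto simp: N_def)
  have N_pts: "?\<pi> p \<in> points Q" if "p \<in> N" for p using param_in_points[OF c NU[OF that]] .
  have NS: "\<Theta> (?\<pi> p) \<in> V" "F (\<Theta> (?\<pi> p)) \<in> V'" "\<Gamma> (?\<pi> p) \<in> ?\<pi> ` O1" if "p \<in> N" for p
    using that by (auto simp: N_def S_def)
  have G: "G p \<in> O1" "?\<pi> (G p) = \<Gamma> (?\<pi> p)" if "p \<in> N" for p
    using NS(3)[OF that] by (auto simp: G_def inv_into_into f_inv_into_f)
  have fstG: "fst (G p) = fst p" if "p \<in> N" for p
  proof -
    have GU: "fst (G p) \<in> u ` U" using G(1)[OF that] by (auto simp: O1_def)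
    have "inv_into U u (fst (G p)) = inv_into U u (fst p)"
      using fst\<Gamma>[OF N_pts[OF that]] G(2)[OF that] fst_param[OF c NU[OF that]] fst_param[OF c GU] by simp
    then show ?thesis using GU NU[OF that] inv_into_injective by metis
  qed
  have derG: "\<exists>D. (G has_derivative D) (at p) \<and> (\<forall>w. snd (D (0, w)) = s *\<^sub>R w)" if p: "p \<in> N" for p
  proof -
    have in_\<Omega>: "\<Theta> (?\<pi> q) \<in> ?\<Omega>" "F (\<Theta> (?\<pi> q)) \<in> ?\<Omega>" if "q \<in> N" for q
      using \<Theta>in[OF N_pts[OF that]] F\<Omega> by auto
    have in_X: "\<Theta> (?\<pi> q) \<in> points X" if "q \<in> N" for q
      using in_\<Omega>(1)[OF that] by (simp add: over_def)
    obtain D0 where D0: "((\<lambda>q. \<psi> (\<Theta> (?\<pi> q))) has_derivative D0) (at p)"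
      "\<And>v w. form X \<psi> (\<Theta> (?\<pi> p)) (D0 v) (D0 w) = std_form v w"
      using symplectomorphism_param[OF c \<Theta> dY(1) NU[OF p]] NS(1)[OF p] in_\<Omega>(1)[OF p] by auto
    have "fst (G p) \<in> u ` U" using G(1)[OF p] by (auto simp: O1_def)
    moreover have \<Theta>G: "\<Theta> (?\<pi> (G q)) = F (\<Theta> (?\<pi> q))" if "q \<in> N" for q
      using G(2)[OF that] \<Gamma>(2)[OF N_pts[OF that]] by simp
    ultimately obtain D1 where D1: "((\<lambda>q. \<psi>' (\<Theta> (?\<pi> q))) has_derivative D1) (at (G p))"
      "\<And>v w. form X \<psi>' (F (\<Theta> (?\<pi> p))) (D1 v) (D1 w) = std_form v w"
      using symplectomorphism_param[OF c \<Theta> dY(2), of "G p"] NS(2)[OF p] in_\<Omega>(2)[OF p] p by auto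
    let ?F = "\<psi>' \<circ> F \<circ> inv_into V \<psi>"
    have invV: "inv_into V \<psi> (\<psi> x) = x" if "x \<in> V" for x
      using that top_chartD(3)[OF charts[OF d(1)]] by simp
    have invV': "inv_into (V' \<inter> ?\<Omega>) \<psi>' (\<psi>' x) = x" if "x \<in> V' \<inter> ?\<Omega>" for x
      using that inj_on_subset[OF top_chartD(3)[OF charts[OF d'(1)]], of "V' \<inter> ?\<Omega>"] by simp
    let ?DF = "coord_deriv F (V, \<psi>) \<psi>' (\<Theta> (?\<pi> p))"
    have DF: "(?F has_derivative ?DF) (at (\<psi> (\<Theta> (?\<pi> p))))"
      by (rule smooth_map_on_has_derivative[OF F(1) d(1) d'(1) NS(1)[OF p] in_X[OF p] NS(2)[OF p]])
    \<comment> \<open>\<open>?R\<close> reads the inverse of \<Theta> in charts. Its derivative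
      shows that \<open>G\<close> is differentiable; what is needed about the derivative of
      \<open>G\<close> comes from \<open>D1D\<close>.\<close>
    let ?R = "?\<chi> \<circ> ?\<Theta>' \<circ> inv_into (V' \<inter> ?\<Omega>) \<psi>'"
    obtain DR where DR: "(?R has_derivative DR) (at (\<psi>' (F (\<Theta> (?\<pi> p)))))"
      using smooth_map_on_has_derivative[OF \<Theta>'s dY(2) O1(3), of "F (\<Theta> (?\<pi> p))"]
        NS(2,3)[OF p] in_\<Omega>(2)[OF p] ptsY by (auto simp: \<Gamma>_def)
    have FD: "((\<lambda>q. ?F (\<psi> (\<Theta> (?\<pi> q)))) has_derivative (\<lambda>v. ?DF (D0 v))) (at p)"
      by (rule has_derivative_compose[OF D0(1) DF])
    have F_at: "?F (\<psi> (\<Theta> (?\<pi> q))) = \<psi>' (F (\<Theta> (?\<pi> q)))" if "q \<in> N" for q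
      using invV[OF NS(1)[OF that]] by simp
    have "((\<lambda>q. ?R (?F (\<psi> (\<Theta> (?\<pi> q))))) has_derivative (\<lambda>v. DR (?DF (D0 v)))) (at p)"
      by (rule has_derivative_compose[OF FD]) (simp only: F_at[OF p] DR)
    then have DG: "(G has_derivative (\<lambda>v. DR (?DF (D0 v)))) (at p)"
      using openN p
    proof (rule has_derivative_transform_within_open)
      fix q assume q: "q \<in> N"
      then show "?R (?F (\<psi> (\<Theta> (?\<pi> q)))) = G q"
        using F_at[OF q] invV'[of "F (\<Theta> (?\<pi> q))"] NS(2)[OF q] in_\<Omega>(2)[OF q] by (simp add: G_def \<Gamma>_def)
    qed
    let ?D = "\<lambda>v. DR (?DF (D0 v))"
    have "((\<lambda>q. \<psi>' (\<Theta> (?\<pi> (G q)))) has_derivative (\<lambda>v. D1 (?D v))) (at p)"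
      by (rule has_derivative_compose[OF DG D1(1)])
    then have "((\<lambda>q. ?F (\<psi> (\<Theta> (?\<pi> q)))) has_derivative (\<lambda>v. D1 (?D v))) (at p)"
      using openN p by (rule has_derivative_transform_within_open) (use \<Theta>G F_at in simp)
    \<comment> \<open>Both sides differentiate the same map, since \<Theta> after \<open>G\<close>
      is \<open>F\<close> after \<Theta> in the parameters.\<close>
    then have D1D: "D1 (?D v) = ?DF (D0 v)" for v
      using has_derivative_unique[OF _ FD] by metis
    \<comment> \<open>\<open>D1\<close> and \<open>D0\<close> carry \<open>std_form\<close> to the
      form of \<open>X\<close>, and the differential of \<open>F\<close> between them contributes
      the factor \<open>s\<close>.\<close>
    have "std_form (?D v) (?D w) = s * std_form v w" for v w
      using D1(2)[of "?D v" "?D w"] D0(2)[of v w]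
        pulls_back_formD[OF F(2) d(1) d'(1) NS(1)[OF p] NS(2)[OF p], of "D0 v" "D0 w"]
      by (simp only: D1D)
    moreover have "fst (?D v) = fst v" for v
    proof -
      have "((\<lambda>q. fst (G q)) has_derivative (\<lambda>v. fst (?D v))) (at p)"
        using DG by (rule has_derivative_fst)
      then have "(fst has_derivative (\<lambda>v. fst (?D v))) (at p)"
        using openN p by (rule has_derivative_transform_within_open) (use fstG in simp)
      moreover have "(fst has_derivative fst) (at p)"
        by (rule bounded_linear_imp_has_derivative[OF bounded_linear_fst])
      ultimately show ?thesis using has_derivative_unique by metis
    qed
    ultimately have "snd (?D (0, w)) = s *\<^sub>R w" for w
      by (rule std_form_scaling_vertical[of ?D])
    then show ?thesis using DG by blast
  qed
  obtain \<epsilon> where \<epsilon>: "\<epsilon> > 0" "\<And>y. y \<in> ball y0 \<epsilon> \<Longrightarrow> (u b, y) \<in> N"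
  proof -
    have "open ((\<lambda>y. (u b, y)) -` N)"
      using openN by (rule open_vimage) (intro continuous_intros)
    then obtain \<epsilon> where "\<epsilon> > 0" "ball y0 \<epsilon> \<subseteq> (\<lambda>y. (u b, y)) -` N"
      using p0N open_contains_ball by (metis vimageI)
    then show thesis using that by blast
  qed
  have "((\<lambda>y. snd (G (u b, y)) - s *\<^sub>R y) has_derivative (\<lambda>h. 0)) (at y within ball y0 \<epsilon>)"
    if y: "y \<in> ball y0 \<epsilon>" for y
  proof -
    obtain D where D: "(G has_derivative D) (at (u b, y))" "\<And>w. snd (D (0, w)) = s *\<^sub>R w"
      using derG[OF \<epsilon>(2)[OF y]] by blast
    have "((\<lambda>y. (u b, y)) has_derivative (\<lambda>h. (0, h))) (at y)"
      by (intro has_derivative_Pair) auto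
    from has_derivative_snd[OF has_derivative_compose[OF this D(1)]]
    have "((\<lambda>y. snd (G (u b, y))) has_derivative (\<lambda>h. s *\<^sub>R h)) (at y)"
      by (simp only: D(2))
    from has_derivative_diff[OF this has_derivative_scaleR_right[OF has_derivative_ident]]
    have "((\<lambda>y. snd (G (u b, y)) - s *\<^sub>R y) has_derivative (\<lambda>h. s *\<^sub>R h - s *\<^sub>R h)) (at y)" .
    then show ?thesis by (simp add: has_derivative_at_withinI)
  qed
  then obtain a where a: "\<And>y. y \<in> ball y0 \<epsilon> \<Longrightarrow> snd (G (u b, y)) - s *\<^sub>R y = a"
    using has_derivative_zero_constant[of "ball y0 \<epsilon>" "\<lambda>y. snd (G (u b, y)) - s *\<^sub>R y"] by auto
  have "F (\<Theta> (?\<pi> (u b, y))) = \<Theta> (?\<pi> (u b, a + s *\<^sub>R y))" if "y \<in> ball y0 \<epsilon>" for y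
  proof -
    have N: "(u b, y) \<in> N" using \<epsilon>(2)[OF that] .
    have "G (u b, y) = (u b, a + s *\<^sub>R y)"
      using fstG[OF N] a[OF that] by (simp add: prod_eq_iff algebra_simps)
    then show ?thesis
      using G(2)[OF N] \<Gamma>(2)[OF N_pts[OF N]] by simp
  qed
  then show ?thesis using \<epsilon>(1) by blast
qed

text \<open>Two such formulas with constants \<open>a'\<close> and \<open>a\<close> agree at a point
  exactly when \<open>a' - a\<close> is integral, a condition that does not involve
  \<open>y\<close>. Hence the set where the formula with the constant found at 0 holds is open and
  closed in the space of fibre coordinates, which is connected.\<close>

proposition conformal_fibre_map:
  fixes X :: "('a, (real^'n) \<times> (real^'n)) symp"
  assumes X: "smooth_manifold X"
    and \<Theta>: "symplectomorphism Q (open_sub X (over X f W)) \<Theta>" and f\<Theta>: "\<And>q. q \<in> points Q \<Longrightarrow> f (\<Theta> q) = fst q"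
    and F: "smooth_map_on X X (points X) F" "pulls_back_form X X s F" "\<And>x. x \<in> points X \<Longrightarrow> f (F x) = f x"
    and c: "(U, u) \<in> \<A>" and b: "b \<in> U"
  obtains a where "\<And>y. F (\<Theta> (cotangent_param \<A> (U, u) (u b, y))) =
    \<Theta> (cotangent_param \<A> (U, u) (u b, a + s *\<^sub>R y))"
proof -
  let ?\<pi> = "\<lambda>y. cotangent_param \<A> (U, u) (u b, y)"
  note local = conformal_fibre_map_local[OF assms]
  have inj: "\<Theta> (?\<pi> y) = \<Theta> (?\<pi> y') \<longleftrightarrow> (\<forall>i. (y - y') $ i \<in> \<int>)" for y y'
  proof -
    have "inj_on \<Theta> (points Q)"
      using \<Theta> by (auto simp: symplectomorphism_def diffeomorphism_def bij_betw_def)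
    then have "\<Theta> (?\<pi> y) = \<Theta> (?\<pi> y') \<longleftrightarrow> ?\<pi> y = ?\<pi> y'"
      using param_in_points[OF c, of "(u b, y)"] param_in_points[OF c, of "(u b, y')"] b by (auto dest: inj_onD)
    then show ?thesis using param_eq_iff[OF c, of "u b" "u b"] b by simp
  qed
  obtain a where a: "F (\<Theta> (?\<pi> 0)) = \<Theta> (?\<pi> a)"
    using local[of 0] by (metis (no_types, lifting) add.right_neutral centre_in_ball scaleR_zero_right)
  define E where "E = {y. F (\<Theta> (?\<pi> y)) = \<Theta> (?\<pi> (a + s *\<^sub>R y))}"
  have E: "\<exists>\<epsilon>>0. \<forall>y\<in>ball y0 \<epsilon>. y \<in> E \<longleftrightarrow> y0 \<in> E" for y0
  proof -
    obtain \<epsilon> a' where \<epsilon>: "\<epsilon> > 0" "\<And>y. y \<in> ball y0 \<epsilon> \<Longrightarrow> F (\<Theta> (?\<pi> y)) = \<Theta> (?\<pi> (a' + s *\<^sub>R y))"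
      using local[of y0] by blast
    have "y \<in> E \<longleftrightarrow> (\<forall>i. (a' - a) $ i \<in> \<int>)" if "y \<in> ball y0 \<epsilon>" for y
      using \<epsilon>(2)[OF that] inj[of "a' + s *\<^sub>R y" "a + s *\<^sub>R y"] by (simp add: E_def)
    then show ?thesis using \<epsilon>(1) by (metis centre_in_ball)
  qed
  have "open E" unfolding open_contains_ball using E by (metis subsetI)
  moreover have "open (- E)" unfolding open_contains_ball using E by (metis ComplD ComplI subsetI)
  moreover have "0 \<in> E" using a by (simp add: E_def)
  ultimately have "E = UNIV"
    using connected_UNIV by (metis clopen closed_def empty_iff)
  then show thesis using that[of a] by (auto simp: E_def)
qed

end

section \<open>Negative fibrations\<close>

text \<open>Either \<open>G\<close> lies in \<open>C\<close>, or \<open>G - C\<close> is a nonempty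
  open set covered by the remaining closed sets. It serves to find an open set on which a piecewise
  smooth map coincides with one of its pieces.\<close>

lemma finite_closed_cover_interior:
  assumes "finite \<C>" and "openin T G" and "G \<noteq> {}" and "\<And>C. C \<in> \<C> \<Longrightarrow> closedin T C" and "G \<subseteq> \<Union>\<C>"
  shows "\<exists>C\<in>\<C>. \<exists>H. openin T H \<and> H \<noteq> {} \<and> H \<subseteq> G \<inter> C"
  using assms
proof (induction arbitrary: G rule: finite_induct)
  case (insert C \<C>)
  show ?case
  proof (cases "G \<subseteq> C")
    case True
    then show ?thesis using insert.prems by blast
  next
    case False
    then have "G - C \<noteq> {}" "openin T (G - C)" "G - C \<subseteq> \<Union>\<C>"
      using insert.prems openin_diff by blast+
    then obtain C' H where "C' \<in> \<C>" "openin T H" "H \<noteq> {}" "H \<subseteq> (G - C) \<inter> C'"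
      using insert.IH[of "G - C"] insert.prems(3) by blast
    then show ?thesis by blast
  qed
qed auto

section \<open>Continuity and local sections of the negative model\<close>

lemma continuous_on_vec_components:
  "(\<And>i. continuous_on A (\<lambda>x. f x $ i)) \<Longrightarrow> continuous_on A f"
  using continuous_on_vec_lambda[of A "\<lambda>i x. f x $ i"] by (simp add: vec_lambda_eta)

lemma continuous_on_vector_2:
  fixes f g :: "'a::topological_space \<Rightarrow> 'b::real_normed_vector"
  assumes "continuous_on A f" and "continuous_on A g"
  shows "continuous_on A (\<lambda>x. vector [f x, g x] :: 'b^2)"
proof (rule continuous_on_vec_components)
  fix i :: 2
  have "i = 1 \<or> i = 2" using exhaust_2 by blast
  then show "continuous_on A (\<lambda>x. (vector [f x, g x] :: 'b^2) $ i)"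
    using assms by (elim disjE) simp_all
qed

lemma continuous_on_vector_3:
  fixes f g h :: "'a::topological_space \<Rightarrow> 'b::real_normed_vector"
  assumes "continuous_on A f" and "continuous_on A g" and "continuous_on A h"
  shows "continuous_on A (\<lambda>x. vector [f x, g x, h x] :: 'b^3)"
proof (rule continuous_on_vec_components)
  fix i :: 3
  have "i = 1 \<or> i = 2 \<or> i = 3" using exhaust_3 by blast
  then show "continuous_on A (\<lambda>x. (vector [f x, g x, h x] :: 'b^3) $ i)"
    using assms by (elim disjE) simp_all
qed

text \<open>Each branch divides by the larger of the two norms, so one quotient serves both, and its
  continuity is in doubt only where both entries vanish.\<close>

lemma gamma_eq: "gamma z = z $ 1 * z $ 2 / of_real (max (norm (z $ 1)) (norm (z $ 2)))"
proof -
  have "mu z \<ge> 0 \<longleftrightarrow> norm (z $ 2) \<le> norm (z $ 1)"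
    by (simp add: mu_def abs_le_square_iff[symmetric])
  then show ?thesis by (auto simp: gamma_def max_def)
qed

lemma continuous_on_gamma: "continuous_on UNIV gamma"
proof -
  have "isCont gamma z" for z
  proof (cases "max (norm (z $ 1)) (norm (z $ 2)) = 0")
    case True
    then have z: "z $ 1 = 0" "z $ 2 = 0" by (auto simp: max_def split: if_splits)
    \<comment> \<open>The norm of \<open>gamma w\<close> is the smaller of the two norms. At
      \<open>z\<close> itself the quotient is 0/0, which has the value 0, as the limit
      demands.\<close>
    have "norm (gamma w) \<le> norm (w $ 2)" for w
      by (simp add: gamma_eq norm_mult norm_divide divide_le_eq mult_mono max_def split: if_splits)
    moreover have "((\<lambda>w. norm (w $ 2)) \<longlongrightarrow> 0) (at z)"
    proof -
      have "isCont (\<lambda>w. norm (w $ 2)) z" by (intro continuous_intros)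
      then show ?thesis using z by (simp add: isCont_def)
    qed
    ultimately have "(gamma \<longlongrightarrow> 0) (at z)"
      by (intro Lim_null_comparison[of gamma "\<lambda>w. norm (w $ 2)"]) auto
    then show ?thesis using z by (simp add: isCont_def gamma_eq)
  next
    case False
    have "isCont (\<lambda>z. z $ 1 * z $ 2 / of_real (max (norm (z $ 1)) (norm (z $ 2)))) z"
      using False by (intro continuous_intros) auto
    then show ?thesis by (simp add: gamma_eq[abs_def])
  qed
  then show ?thesis by (simp add: continuous_at_imp_continuous_on)
qed

lemma continuous_on_reduce: "continuous_on UNIV reduce"
  unfolding reduce_def[abs_def] by (intro continuous_on_vector_2 continuous_on_gamma continuous_intros)

lemma continuous_on_mu: "continuous_on UNIV mu"
  unfolding mu_def[abs_def] by (intro continuous_intros) auto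

lemma leg_pinching_mapD:
  assumes "leg_pinching_map \<Phi>"
  shows "bij \<Phi>" and "continuous_on UNIV \<Phi>" and "continuous_on UNIV (inv \<Phi>)"
proof -
  have "diffeomorphism cspace cspace \<Phi>"
    using assms by (simp add: leg_pinching_map_def symplectomorphism_def)
  then have "bij_betw \<Phi> (points cspace) (points cspace)" and "smooth_map_on cspace cspace (points cspace) \<Phi>"
    and "smooth_map_on cspace cspace (points cspace) (inv_into (points cspace) \<Phi>)"
    by (simp_all only: diffeomorphism_def)
  then show "bij \<Phi>" and "continuous_on UNIV \<Phi>" and "continuous_on UNIV (inv \<Phi>)"
    using smooth_map_on_points_continuous[of cspace cspace] by (auto simp: cspace_def)
qed

text \<open>Where \<open>mu\<close> is nonzero the model can be inverted by hand. The last two base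
  coordinates prescribe the moduli of the components of \<open>\<Phi> (reduce z)\<close>, whose
  arguments are kept; the inverse of \<Phi> then prescribes \<open>gamma\<close> and the third
  entry. Of the first two entries the one of larger norm keeps its phase \<open>e\<close>, and
  \<open>mu\<close> and \<open>gamma\<close> determine the rest.\<close>

lemma negative_model_map_section:
  assumes \<Phi>: "leg_pinching_map \<Phi>" and ne: "\<Phi> (reduce z) $ 1 \<noteq> 0" "\<Phi> (reduce z) $ 2 \<noteq> 0" and mu: "mu z \<noteq> 0"
  obtains N j where "open N" "negative_model_map \<Phi> z \<in> N" "continuous_on N j" "j (negative_model_map \<Phi> z) = z"
    and "\<And>b. b \<in> N \<Longrightarrow> negative_model_map \<Phi> (j b) = b"
proof -
  note \<Phi>' = leg_pinching_mapD[OF \<Phi>]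
  define v where "v = \<Phi> (reduce z)"
  \<comment> \<open>A positive factor leaves the argument of a component alone and makes the
    logarithm of its modulus the prescribed coordinate.\<close>
  define v' :: "real^3 \<Rightarrow> complex^2" where
    "v' b = vector [of_real (exp (b $ 2 - ln (norm (v $ 1)))) * v $ 1, of_real (exp (b $ 3 - ln (norm (v $ 2)))) * v $ 2]" for b
  define u where "u b = inv \<Phi> (v' b)" for b
  have "continuous_on UNIV v'"
    unfolding v'_def by (intro continuous_on_vector_2 continuous_intros)
  then have contu: "continuous_on A u" for A
    unfolding u_def using continuous_on_compose2[OF \<Phi>'(3)] continuous_on_subset by blast
  have \<Phi>u: "\<Phi> (u b) = v' b" for b
    using \<Phi>'(1) by (simp add: u_def bij_is_surj surj_f_inv_f)
  have ln_v': "ln (norm (v' b $ 1)) = b $ 2" "ln (norm (v' b $ 2)) = b $ 3" for b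
    using ne by (simp_all add: v'_def v_def norm_mult ln_mult)
  define b0 where "b0 = negative_model_map \<Phi> z"
  have b0: "b0 $ 1 = mu z" "b0 $ 2 = ln (norm (v $ 1))" "b0 $ 3 = ln (norm (v $ 2))"
    by (simp_all add: b0_def negative_model_map_def v_def)
  have "v' b0 = v"
    by (simp add: vec_eq_iff forall_2 v'_def b0)
  then have u0: "u b0 = reduce z"
    using \<Phi>'(1) by (simp add: u_def v_def bij_is_inj)
  then have u0': "u b0 $ 1 = gamma z" "u b0 $ 2 = z $ 3" by (simp_all add: reduce_def)
  have model_eq: "negative_model_map \<Phi> w = b" if "mu w = b $ 1" "gamma w = u b $ 1" "w $ 3 = u b $ 2" for w b
  proof -
    have "reduce w = u b"
      using that by (simp add: reduce_def vec_eq_iff forall_2)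
    then have "\<Phi> (reduce w) = v' b" using \<Phi>u by simp
    then show ?thesis
      using that(1) by (simp add: negative_model_map_def ln_v' vec_eq_iff[of _ b] forall_3)
  qed
  show thesis
  proof (cases "mu z > 0")
    case True
    define e where "e = z $ 1 / of_real (norm (z $ 1))"
    have z1: "z $ 1 \<noteq> 0" using True by (auto simp: mu_def)
    then have e: "norm e = 1" "e \<noteq> 0" by (auto simp: e_def norm_divide)
    \<comment> \<open>For positive \<open>mu\<close>, \<open>gamma\<close> is \<open>e\<close> times
      the second entry. So the second entry is recovered by dividing by \<open>e\<close>, and
      \<open>mu\<close> gives the squared norm of the first as twice \<open>mu\<close> plus the
      squared norm of \<open>gamma\<close>.\<close>
    define j :: "real^3 \<Rightarrow> complex^3" where
      "j b = vector [of_real (sqrt (2 * b $ 1 + (norm (u b $ 1))\<^sup>2)) * e, u b $ 1 / e, u b $ 2]" for b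
    have "open {b :: real^3. 0 < b $ 1}" by (intro open_Collect_less continuous_intros)
    moreover have "b0 \<in> {b. 0 < b $ 1}" using True b0 by simp
    moreover have "continuous_on {b. 0 < b $ 1} j"
      unfolding j_def by (intro continuous_on_vector_3 continuous_intros contu) (simp_all add: e)
    moreover have "j b0 = z"
    proof -
      have "(norm (gamma z))\<^sup>2 = (norm (z $ 2))\<^sup>2"
        using True z1 by (simp add: gamma_def norm_mult norm_divide)
      then have "2 * mu z + (norm (gamma z))\<^sup>2 = (norm (z $ 1))\<^sup>2"
        by (simp add: mu_def diff_divide_distrib)
      then have "sqrt (2 * mu z + (norm (gamma z))\<^sup>2) = norm (z $ 1)" by simp
      then show ?thesis
        using True z1 by (simp add: vec_eq_iff forall_3 j_def u0' b0 e_def gamma_def)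
    qed
    moreover have "negative_model_map \<Phi> (j b) = b" if "b \<in> {b. 0 < b $ 1}" for b
    proof (rule model_eq)
      have pos: "0 < 2 * b $ 1 + (norm (u b $ 1))\<^sup>2" using that by (simp add: add_pos_nonneg)
      then show mu: "mu (j b) = b $ 1"
        by (simp add: mu_def j_def norm_mult norm_divide e power_mult_distrib)
      have "norm (j b $ 1) = sqrt (2 * b $ 1 + (norm (u b $ 1))\<^sup>2)"
        using pos by (simp add: j_def norm_mult e)
      then show "gamma (j b) = u b $ 1"
        using pos that mu e(2) by (simp add: gamma_def j_def)
      show "j b $ 3 = u b $ 2" by (simp add: j_def)
    qed
    ultimately show thesis using that unfolding b0_def by blast
  next
    case False
    then have neg: "mu z < 0" using mu by simp
    define e where "e = z $ 2 / of_real (norm (z $ 2))"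
    have z2: "z $ 2 \<noteq> 0" using neg by (auto simp: mu_def)
    then have e: "norm e = 1" "e \<noteq> 0" by (auto simp: e_def norm_divide)
    \<comment> \<open>The roles of the first two entries are exchanged, since the second now has the
      larger norm.\<close>
    define j :: "real^3 \<Rightarrow> complex^3" where
      "j b = vector [u b $ 1 / e, of_real (sqrt ((norm (u b $ 1))\<^sup>2 - 2 * b $ 1)) * e, u b $ 2]" for b
    have "open {b :: real^3. b $ 1 < 0}" by (intro open_Collect_less continuous_intros)
    moreover have "b0 \<in> {b. b $ 1 < 0}" using neg b0 by simp
    moreover have "continuous_on {b. b $ 1 < 0} j"
      unfolding j_def by (intro continuous_on_vector_3 continuous_intros contu) (simp_all add: e)
    moreover have "j b0 = z"
    proof -
      have "(norm (gamma z))\<^sup>2 = (norm (z $ 1))\<^sup>2"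
        using neg z2 by (simp add: gamma_def norm_mult norm_divide)
      then have "(norm (gamma z))\<^sup>2 - 2 * mu z = (norm (z $ 2))\<^sup>2"
        by (simp add: mu_def diff_divide_distrib)
      then have "sqrt ((norm (gamma z))\<^sup>2 - 2 * mu z) = norm (z $ 2)" by simp
      then show ?thesis
        using neg z2 by (simp add: vec_eq_iff forall_3 j_def u0' b0 e_def gamma_def)
    qed
    moreover have "negative_model_map \<Phi> (j b) = b" if "b \<in> {b. b $ 1 < 0}" for b
    proof (rule model_eq)
      have pos: "0 < (norm (u b $ 1))\<^sup>2 - 2 * b $ 1"
        using that by (simp add: less_le_trans[OF _ zero_le_power2])
      then show mu: "mu (j b) = b $ 1"
        by (simp add: mu_def j_def norm_mult norm_divide e power_mult_distrib)
      have "norm (j b $ 2) = sqrt ((norm (u b $ 1))\<^sup>2 - 2 * b $ 1)"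
        using pos by (simp add: j_def norm_mult e)
      then show "gamma (j b) = u b $ 1"
        using pos that mu e(2) by (simp add: gamma_def j_def)
      show "j b $ 3 = u b $ 2" by (simp add: j_def)
    qed
    ultimately show thesis using that unfolding b0_def by blast
  qed
qed

text \<open>Along a real translation of the first entry \<open>mu\<close> is a quadratic polynomial
  with second difference \<open>t\<^sup>2\<close>, so it cannot vanish at \<open>z0\<close> and at
  both points symmetric around it.\<close>

lemma mu_nonzero_dense:
  assumes "open G" and "G \<noteq> {}"
  obtains z where "z \<in> G" "mu z \<noteq> 0"
proof -
  obtain z0 where z0: "z0 \<in> G" using assms(2) by blast
  define c :: "real \<Rightarrow> complex^3" where "c t = z0 + axis 1 (of_real t)" for t
  have "continuous_on UNIV c"
  proof (rule continuous_on_vec_components)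
    fix i :: 3
    show "continuous_on UNIV (\<lambda>t. c t $ i)"
      by (cases "i = 1") (auto simp: c_def axis_def intro!: continuous_intros)
  qed
  then have "open (c -` G)"
    using assms(1) by (intro open_vimage) auto
  moreover have "0 \<in> c -` G" using z0 by (simp add: c_def axis_def vec_eq_iff plus_vec_def vec_lambda_eta)
  ultimately obtain t where t: "t > 0" "c t \<in> G" "c (- t) \<in> G"
  proof -
    obtain \<epsilon> where \<epsilon>: "\<epsilon> > 0" "cball 0 \<epsilon> \<subseteq> c -` G"
      using \<open>open (c -` G)\<close> \<open>0 \<in> c -` G\<close> open_contains_cball by metis
    then have "\<epsilon> \<in> cball 0 \<epsilon>" "- \<epsilon> \<in> cball 0 \<epsilon>" by auto
    then show thesis using \<epsilon> that by blast
  qed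
  have mu_c: "mu (c t) = mu z0 + t * Re (z0 $ 1) + t\<^sup>2 / 2" for t
  proof -
    have "(norm (z0 $ 1 + of_real t))\<^sup>2 = (norm (z0 $ 1))\<^sup>2 + 2 * t * Re (z0 $ 1) + t\<^sup>2"
      by (simp add: cmod_power2) (simp add: power2_eq_square algebra_simps)
    then show ?thesis by (simp add: mu_def c_def axis_def field_simps)
  qed
  have "mu z0 \<noteq> 0 \<or> mu (c t) \<noteq> 0 \<or> mu (c (- t)) \<noteq> 0"
    using mu_c[of t] mu_c[of "- t"] t(1) by auto
  then show thesis using that z0 t by blast
qed

lemma open_negative_model_domain:
  assumes "leg_pinching_map \<Phi>"
  shows "open {z. \<Phi> (reduce z) $ 1 \<noteq> 0 \<and> \<Phi> (reduce z) $ 2 \<noteq> 0}"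
proof -
  have "continuous_on UNIV (\<lambda>z. \<Phi> (reduce z))"
    using continuous_on_compose2[OF leg_pinching_mapD(2)[OF assms] continuous_on_reduce] by auto
  then show ?thesis
    by (intro open_Collect_conj open_Collect_neq continuous_on_component continuous_on_const)
qed

lemma mtop_negative_model_space:
  "mtop (negative_model_space \<Phi>) = top_of_set {z. \<Phi> (reduce z) $ 1 \<noteq> 0 \<and> \<Phi> (reduce z) $ 2 \<noteq> 0}"
  by (simp add: negative_model_space_def cspace_def)

lemma continuous_map_negative_model_map:
  assumes "leg_pinching_map \<Phi>"
  shows "continuous_map (mtop (negative_model_space \<Phi>)) euclidean (negative_model_map \<Phi>)"
proof -
  let ?M = "{z. \<Phi> (reduce z) $ 1 \<noteq> 0 \<and> \<Phi> (reduce z) $ 2 \<noteq> 0}"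
  have "continuous_on UNIV (\<lambda>z. \<Phi> (reduce z))"
    using continuous_on_compose2[OF leg_pinching_mapD(2)[OF assms] continuous_on_reduce] by auto
  then have \<Phi>: "continuous_on ?M (\<lambda>z. \<Phi> (reduce z))" using continuous_on_subset by blast
  have mu: "continuous_on ?M mu" using continuous_on_mu continuous_on_subset by blast
  have "continuous_on ?M (negative_model_map \<Phi>)"
    unfolding negative_model_map_def[abs_def]
    by (intro continuous_on_vector_3 mu continuous_on_ln continuous_on_norm continuous_on_component \<Phi>) auto
  then show ?thesis by (simp add: mtop_negative_model_space)
qed

text \<open>Given a local section \<open>j\<close> through a point of \<open>G\<close>, every base
  point that \<open>j\<close> sends into \<open>G\<close> lies in the image.\<close>

lemma negative_model_map_image_interior:
  assumes \<Phi>: "leg_pinching_map \<Phi>" and G: "openin (mtop (negative_model_space \<Phi>)) G" "G \<noteq> {}"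
  obtains V where "open V" "V \<noteq> {}" "V \<subseteq> negative_model_map \<Phi> ` G"
proof -
  have "open G"
    using G(1) open_negative_model_domain[OF \<Phi>] openin_open_trans unfolding mtop_negative_model_space by blast
  then obtain z where z: "z \<in> G" "mu z \<noteq> 0" using G(2) mu_nonzero_dense by blast
  have "\<Phi> (reduce z) $ 1 \<noteq> 0" "\<Phi> (reduce z) $ 2 \<noteq> 0"
    using openin_subset[OF G(1)] z(1) unfolding mtop_negative_model_space by auto
  then obtain N j where N: "open N" "negative_model_map \<Phi> z \<in> N" "continuous_on N j"
    "j (negative_model_map \<Phi> z) = z" and j: "\<And>b. b \<in> N \<Longrightarrow> negative_model_map \<Phi> (j b) = b"
    using negative_model_map_section[OF \<Phi> _ _ z(2)] by blast
  show thesis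
  proof (rule that)
    show "open (N \<inter> j -` G)" using continuous_open_preimage N(1,3) \<open>open G\<close> by blast
    show "N \<inter> j -` G \<noteq> {}" using N z(1) by blast
    show "N \<inter> j -` G \<subseteq> negative_model_map \<Phi> ` G" using j by (force intro: image_eqI)
  qed
qed

lemma homeomorphic_mapD:
  assumes "homeomorphic_map (subtopology T N) T' h" and "openin T N"
  shows "inj_on h N" and "h ` N = topspace T'" and "continuous_map (subtopology T N) T' h"
    and "openin T G \<Longrightarrow> G \<subseteq> N \<Longrightarrow> openin T' (h ` G)"
    and "openin T' V \<Longrightarrow> openin T {x \<in> N. h x \<in> V}"
proof -
  have top: "topspace (subtopology T N) = N"
    using openin_subset[OF assms(2)] by (simp add: Int_absorb1)
  show "inj_on h N"
    using homeomorphic_imp_injective_map[OF assms(1)] by (simp only: top)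
  show "h ` N = topspace T'"
    using homeomorphic_imp_surjective_map[OF assms(1)] by (simp only: top)
  show cont: "continuous_map (subtopology T N) T' h"
    using homeomorphic_imp_continuous_map[OF assms(1)] .
  show "openin T' (h ` G)" if "openin T G" "G \<subseteq> N"
  proof -
    have "openin (subtopology T N) G" using that openin_subtopology by blast
    then show ?thesis using homeomorphic_imp_open_map[OF assms(1)] by (simp add: open_map_def)
  qed
  show "openin T {x \<in> N. h x \<in> V}" if "openin T' V"
  proof -
    have "openin (subtopology T N) {x \<in> N. h x \<in> V}"
      using openin_continuous_map_preimage[OF cont that] by (simp only: top)
    then show ?thesis using assms(2) openin_trans_full by blast
  qed
qed

text \<open>
  Points off the singular set are handled by piecewise smoothness. On the singular set
  nothing is known about smoothness; there the image is computed in the topological model, which has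
  local sections off the nowhere dense set \<open>mu = 0\<close>.
\<close>

proposition negative_fibration_image_interior:
  fixes X :: "('a, (real^3) \<times> (real^3)) symp"
  assumes neg: "lagrangian_negative_fibration X B' f" and G: "openin (mtop X) G" "G \<noteq> {}"
  obtains V where "open V" "V \<noteq> {}" "V \<subseteq> f ` G"
proof -
  let ?B = "open_sub euclid B'"
  have B': "open B'" and fib: "lagrangian_fibration X ?B f" and pw: "piecewise_smooth X ?B f"
    using neg by (auto simp: lagrangian_negative_fibration_def Let_def)
  have mtopB: "mtop ?B = top_of_set B'" by (simp add: euclid_def)
  have open_B: "open V" if "openin (mtop ?B) V" for V
    using that B' openin_open_trans unfolding mtopB by blast
  show thesis
  proof (cases "G \<subseteq> crit X ?B f")
    case False
    then obtain x where x: "x \<in> G" "x \<in> points X - crit X ?B f"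
      using openin_subset[OF G(1)] by blast
    have "\<forall>x\<in>points X - crit X ?B f. \<exists>W \<F>. openin (mtop X) W \<and> x \<in> W \<and> finite \<F> \<and> W \<subseteq> \<Union>(fst ` \<F>) \<and>
        (\<forall>(C, g)\<in>\<F>. closedin (mtop X) C \<and> smooth_map_on X ?B W g \<and> (\<forall>y\<in>W \<inter> C. f y = g y))"
      using pw by (simp add: piecewise_smooth_def)
    from bspec[OF this x(2)] obtain W \<F> where W: "openin (mtop X) W" "x \<in> W" "finite \<F>" "W \<subseteq> \<Union>(fst ` \<F>)"
      and \<F>': "\<forall>(C, g)\<in>\<F>. closedin (mtop X) C \<and> smooth_map_on X ?B W g \<and> (\<forall>y\<in>W \<inter> C. f y = g y)"
      by blast
    have \<F>: "closedin (mtop X) C \<and> smooth_map_on X ?B W g \<and> (\<forall>y\<in>W \<inter> C. f y = g y)" if "(C, g) \<in> \<F>" for C g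
      using bspec[OF \<F>' that] by simp
    \<comment> \<open>Of the finitely many closed pieces covering \<open>W\<close>, one contains a
      nonempty open part of \<open>G\<close>; there \<open>f\<close> is a single smooth map.\<close>
    have "\<exists>C\<in>fst ` \<F>. \<exists>H. openin (mtop X) H \<and> H \<noteq> {} \<and> H \<subseteq> (G \<inter> W) \<inter> C"
    proof (rule finite_closed_cover_interior)
      show "openin (mtop X) (G \<inter> W)" using G(1) W(1) by (rule openin_Int)
      show "closedin (mtop X) C" if "C \<in> fst ` \<F>" for C using that \<F> by auto
    qed (use W x(1) in auto)
    then obtain C H where CH: "C \<in> fst ` \<F>" "openin (mtop X) H" "H \<noteq> {}" "H \<subseteq> (G \<inter> W) \<inter> C" by blast
    from CH(1) obtain g where "(C, g) \<in> \<F>" by force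
    note H = this CH(2-4)
    have "smooth_map_on X ?B W g" and "H \<subseteq> W" and "\<And>y. y \<in> H \<Longrightarrow> f y = g y"
      using \<F>[OF H(1)] H(4) by auto
    then obtain V where "openin (mtop ?B) V" "V \<noteq> {}" "V \<subseteq> f ` H"
      using smooth_lagrangian_fibration_image_interior[OF fib _ H(2,3), of W g] by metis
    then show thesis using that[of V] open_B H(4) by blast
  next
    case True
    obtain \<Phi> where \<Phi>: "leg_pinching_map \<Phi>" and conj: "topologically_conjugate_near_discriminants X ?B f
           (negative_model_space \<Phi>) euclid (negative_model_map \<Phi>)"
      using neg by (auto simp: lagrangian_negative_fibration_def Let_def)
    let ?Y = "negative_model_space \<Phi>" and ?g = "negative_model_map \<Phi>"
    obtain N N' H h where N: "openin (mtop ?B) N" "discriminant X ?B f \<subseteq> N" and N': "openin (mtop euclid) N'"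
      and H: "homeomorphic_map (subtopology (mtop X) (over X f N)) (subtopology (mtop ?Y) (over ?Y ?g N')) H"
      and h: "homeomorphic_map (subtopology (mtop ?B) N) (subtopology (mtop euclid) N') h"
      and comm: "\<forall>x\<in>over X f N. ?g (H x) = h (f x)"
      using conj unfolding topologically_conjugate_near_discriminants_def by auto
    have "open N'" using N' by (simp add: euclid_def)
    have oN: "openin (mtop X) (over X f N)"
      unfolding over_def using fib N(1)
      by (intro openin_continuous_map_preimage) (auto simp: lagrangian_fibration_def)
    have oN': "openin (mtop ?Y) (over ?Y ?g N')"
      unfolding over_def using \<open>open N'\<close>
      by (intro openin_continuous_map_preimage[OF continuous_map_negative_model_map[OF \<Phi>]]) simp
    \<comment> \<open>Here the inclusion in the singular set enters: \<open>f\<close> maps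
      \<open>G\<close> into the discriminant, near which the conjugacy is defined.\<close>
    have GN: "G \<subseteq> over X f N"
      using True N(2) openin_subset[OF G(1)] by (auto simp: over_def discriminant_def)
    have "openin (subtopology (mtop ?Y) (over ?Y ?g N')) (H ` G)"
      using homeomorphic_mapD(4)[OF H oN G(1) GN] .
    then have "openin (mtop ?Y) (H ` G)" using oN' openin_trans_full by blast
    then obtain V where V: "open V" "V \<noteq> {}" "V \<subseteq> ?g ` H ` G"
      using negative_model_map_image_interior[OF \<Phi>] G(2) by blast
    have "?g ` H ` G = h ` f ` G"
      unfolding image_image using comm GN by (intro image_cong) auto
    then have im: "V \<subseteq> h ` f ` G" using V(3) by simp
    have fGN: "f ` G \<subseteq> N" using GN by (auto simp: over_def)
    have hN: "h ` N = N'" using homeomorphic_mapD(2)[OF h N(1)] by (simp add: euclid_def)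
    have "openin (subtopology (mtop euclid) N') V"
    proof -
      have "V \<subseteq> N'" using im fGN hN by blast
      then show ?thesis using V(1) by (simp add: euclid_def open_subset)
    qed
    then have "open {b \<in> N. h b \<in> V}" using homeomorphic_mapD(5)[OF h N(1)] open_B by blast
    moreover have "{b \<in> N. h b \<in> V} \<noteq> {}" using V(2) im fGN by blast
    moreover have "{b \<in> N. h b \<in> V} \<subseteq> f ` G"
      using homeomorphic_mapD(1)[OF h N(1)] im fGN by (force dest: inj_onD)
    ultimately show thesis by (rule that)
  qed
qed

section \<open>Density of the smooth torus fibres\<close>

lemma integral_affine_atlas_restrict:
  assumes \<A>: "integral_affine_atlas T W' \<A>" and W: "openin T W" "W \<subseteq> W'"
  shows "integral_affine_atlas T W (restrict_atlas \<A> W)"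
  unfolding integral_affine_atlas_def
proof (intro conjI ballI)
  show "openin T W" by fact
  have "(\<Union>(U, u)\<in>restrict_atlas \<A> W. U) = (\<Union>(U, u)\<in>\<A>. U) \<inter> W"
    by (auto simp: restrict_atlas_def)
  then show "(\<Union>(U, u)\<in>restrict_atlas \<A> W. U) = W"
    using \<A> W(2) by (simp add: integral_affine_atlas_def Int_absorb1)
next
  fix c assume "c \<in> restrict_atlas \<A> W"
  then obtain U u where c: "(U, u) \<in> \<A>" "c = (U \<inter> W, u)" by (auto simp: restrict_atlas_def)
  then have chart: "top_chart T (U, u)" using \<A> by (simp add: integral_affine_atlas_def)
  then have hom: "homeomorphic_map (subtopology T U) (top_of_set (u ` U)) u" by (simp add: top_chart_def)
  have UW: "openin T (U \<inter> W)" using top_chartD(1)[OF chart] W(1) by (rule openin_Int)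
  have "homeomorphic_map (subtopology (subtopology T U) (U \<inter> W)) (subtopology (top_of_set (u ` U)) (u ` (U \<inter> W))) u"
  proof (rule homeomorphic_map_subtopologies[OF hom])
    have "topspace (subtopology T U) = U"
      using openin_subset[OF top_chartD(1)[OF chart]] by (simp add: Int_absorb1)
    then show "u ` (topspace (subtopology T U) \<inter> (U \<inter> W)) = topspace (top_of_set (u ` U)) \<inter> u ` (U \<inter> W)"
      by auto
  qed
  moreover have "u ` U \<inter> u ` (U \<inter> W) = u ` (U \<inter> W)" by blast
  ultimately have "homeomorphic_map (subtopology T (U \<inter> W)) (top_of_set (u ` (U \<inter> W))) u"
    by (simp add: subtopology_subtopology)
  then show "top_chart T c"
    using UW top_chart_open_image[OF chart UW] c(2) by (simp add: top_chart_def)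
next
  fix c assume "c \<in> restrict_atlas \<A> W"
  then obtain U u where c: "(U, u) \<in> \<A>" "c = (U \<inter> W, u)" by (auto simp: restrict_atlas_def)
  have "\<forall>(U, u)\<in>\<A>. \<forall>(V, v)\<in>\<A>. \<forall>x\<in>U \<inter> V. affinely_related T id u v x"
    using \<A> by (simp add: integral_affine_atlas_def)
  from bspec[OF this c(1)] have related: "\<forall>(V, v)\<in>\<A>. \<forall>x\<in>U \<inter> V. affinely_related T id u v x" by simp
  have "affinely_related T id u v x" if "(V, v) \<in> \<A>" "x \<in> U" "x \<in> V" for V v x
    using bspec[OF related that(1)] that(2,3) by simp
  then show "case c of (U, u) \<Rightarrow> \<forall>(V, v)\<in>restrict_atlas \<A> W. \<forall>x\<in>U \<inter> V. affinely_related T id u v x"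
    using c(2) by (auto simp: restrict_atlas_def)
qed

proposition anti_symplectomorphism_over_dense:
  fixes X :: "('a, (real^'n) \<times> (real^'n)) symp" and B :: "('b, real^'n) manifold"
  assumes X: "smooth_manifold X" and \<A>: "integral_affine_atlas (mtop B) W (restrict_atlas \<A> W)"
    and quot: "cotangent_quotient_over X B f \<A> W"
    and dense: "points X \<subseteq> mtop X closure_of over X f W"
    and \<phi>: "anti_symplectomorphism X \<phi>" "\<And>x. x \<in> points X \<Longrightarrow> f (\<phi> x) = f x"
  shows "\<forall>x\<in>points X. \<phi> (\<phi> x) = x"
    and "\<forall>t. symplectomorphism X X t \<and> (\<forall>x\<in>points X. f (t x) = f x) \<longrightarrow>
      (\<forall>x\<in>points X. \<phi> (inv_into (points X) t x) = t (\<phi> x))"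
proof -
  interpret integral_affine "mtop B" W "restrict_atlas \<A> W"
    using \<A> by unfold_locales
  obtain \<Theta> where \<Theta>: "symplectomorphism Q (open_sub X (over X f W)) \<Theta>"
    and f\<Theta>: "\<And>q. q \<in> points Q \<Longrightarrow> f (\<Theta> q) = fst q"
    using quot unfolding cotangent_quotient_over_def by blast
  have \<phi>': "smooth_map_on X X (points X) \<phi>" "pulls_back_form X X (-1) \<phi>"
    using \<phi>(1) by (auto simp: anti_symplectomorphism_def diffeomorphism_def)
  have \<phi>c: "continuous_map (mtop X) (mtop X) \<phi>"
    using smooth_map_on_points_continuous[OF \<phi>'(1)] .
  have haus: "Hausdorff_space (mtop X)" using X by (simp add: smooth_manifold_def)
  have bij: "bij_betw \<Theta> (points Q) (over X f W)"
  proof -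
    have "topspace (subtopology (mtop X) (over X f W)) = over X f W" by (auto simp: over_def)
    then show ?thesis using \<Theta> by (simp add: symplectomorphism_def diffeomorphism_def)
  qed
  have coords: "\<exists>U u b y. (U, u) \<in> restrict_atlas \<A> W \<and> b \<in> U \<and>
      x = \<Theta> (cotangent_param (restrict_atlas \<A> W) (U, u) (u b, y))"
    if x: "x \<in> over X f W" for x
  proof -
    have "x \<in> \<Theta> ` points Q" using bij x by (simp add: bij_betw_def)
    then obtain q where q: "q \<in> points Q" "x = \<Theta> q" by blast
    have "fst q \<in> W" using f\<Theta>[OF q(1)] q(2) x by (simp add: over_def)
    then have "fst q \<in> (\<Union>(U, u)\<in>restrict_atlas \<A> W. U)"
      using affine_atlas by (simp add: integral_affine_atlas_def)
    then obtain U u where U: "(U, u) \<in> restrict_atlas \<A> W" "fst q \<in> U" by auto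
    then obtain y where y: "q = cotangent_param (restrict_atlas \<A> W) (U, u) (u (fst q), y)"
      using param_surj[OF U(1) q(1) U(2)] by blast
    have "x = \<Theta> (cotangent_param (restrict_atlas \<A> W) (U, u) (u (fst q), y))"
      unfolding y[symmetric] by (rule q(2))
    with U show ?thesis by blast
  qed
  show "\<forall>x\<in>points X. \<phi> (\<phi> x) = x"
  \<comment> \<open>Continuous maps into a Hausdorff space that agree on a set agree on its
    closure.\<close>
  proof (rule ballI, rule forall_in_closure_of_eq[where X = "mtop X" and Y = "mtop X" and f = "\<lambda>x. \<phi> (\<phi> x)" and g = "\<lambda>x. x"])
    fix x assume x: "x \<in> points X"
    show "x \<in> mtop X closure_of over X f W" using x dense by blast
    show "continuous_map (mtop X) (mtop X) (\<lambda>x. \<phi> (\<phi> x))"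
      using continuous_map_compose[OF \<phi>c \<phi>c] by (simp add: o_def)
    show "\<phi> (\<phi> x) = x" if "x \<in> over X f W" for x
    proof -
      obtain U u b y where U: "(U, u) \<in> restrict_atlas \<A> W" "b \<in> U"
        and xy: "x = \<Theta> (cotangent_param (restrict_atlas \<A> W) (U, u) (u b, y))"
        using coords[OF \<open>x \<in> over X f W\<close>] by blast
      obtain a where a: "\<And>y. \<phi> (\<Theta> (cotangent_param (restrict_atlas \<A> W) (U, u) (u b, y))) =
          \<Theta> (cotangent_param (restrict_atlas \<A> W) (U, u) (u b, a + (-1) *\<^sub>R y))"
        using conformal_fibre_map[OF X \<Theta> f\<Theta> \<phi>' \<phi>(2) U] by blast
      \<comment> \<open>On the torus this is a - (a - y) = y.\<close>
      show ?thesis by (simp add: xy a)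
    qed
  qed (use haus in auto)
  show "\<forall>t. symplectomorphism X X t \<and> (\<forall>x\<in>points X. f (t x) = f x) \<longrightarrow>
      (\<forall>x\<in>points X. \<phi> (inv_into (points X) t x) = t (\<phi> x))"
  proof (intro allI impI ballI; elim conjE)
    fix t x
    assume t: "symplectomorphism X X t" "\<forall>x\<in>points X. f (t x) = f x" and x: "x \<in> points X"
    have t': "smooth_map_on X X (points X) t" "pulls_back_form X X 1 t" and tb: "bij_betw t (points X) (points X)"
      using t(1) by (auto simp: symplectomorphism_def diffeomorphism_def)
    have tc: "continuous_map (mtop X) (mtop X) t"
      using smooth_map_on_points_continuous[OF t'(1)] .
    define z where "z = inv_into (points X) t x"
    have z: "z \<in> points X" "t z = x"
      using bij_betw_inv_into_right[OF tb x] bij_betw_apply[OF bij_betw_inv_into[OF tb] x] by (auto simp: z_def)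
    \<comment> \<open>With \<open>z\<close> the preimage of \<open>x\<close>, the claim becomes an
      identity between continuous maps that no longer mentions the inverse of
      \<open>t\<close>.\<close>
    have "\<phi> z = t (\<phi> (t z))"
    proof (rule forall_in_closure_of_eq[where X = "mtop X" and Y = "mtop X" and f = \<phi> and g = "\<lambda>z. t (\<phi> (t z))"])
      show "z \<in> mtop X closure_of over X f W" using z(1) dense by blast
      show "continuous_map (mtop X) (mtop X) (\<lambda>z. t (\<phi> (t z)))"
        using continuous_map_compose[OF continuous_map_compose[OF tc \<phi>c] tc] by (simp add: o_def)
      show "\<phi> z = t (\<phi> (t z))" if "z \<in> over X f W" for z
      proof -
        obtain U u b y where U: "(U, u) \<in> restrict_atlas \<A> W" "b \<in> U"
          and zy: "z = \<Theta> (cotangent_param (restrict_atlas \<A> W) (U, u) (u b, y))"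
          using coords[OF \<open>z \<in> over X f W\<close>] by blast
        obtain a where a: "\<And>y. \<phi> (\<Theta> (cotangent_param (restrict_atlas \<A> W) (U, u) (u b, y))) =
            \<Theta> (cotangent_param (restrict_atlas \<A> W) (U, u) (u b, a + (-1) *\<^sub>R y))"
          using conformal_fibre_map[OF X \<Theta> f\<Theta> \<phi>' \<phi>(2) U] by blast
        obtain a' where a': "\<And>y. t (\<Theta> (cotangent_param (restrict_atlas \<A> W) (U, u) (u b, y))) =
            \<Theta> (cotangent_param (restrict_atlas \<A> W) (U, u) (u b, a' + 1 *\<^sub>R y))"
          using conformal_fibre_map[OF X \<Theta> f\<Theta> t' bspec[OF t(2)] U] by blast
        \<comment> \<open>The right side is a' + (a - (a' + y)), so the translation
          \<open>a'\<close> cancels.\<close>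
        show ?thesis by (simp add: zy a a' algebra_simps)
      qed
    qed (use haus \<phi>c in auto)
    then show "\<phi> (inv_into (points X) t x) = t (\<phi> x)" using z(2) by (simp add: z_def)
  qed
qed

text \<open>The condition is on open sets of \<open>X\<close>, because a set without interior in the
  base could still have a preimage with interior.\<close>

lemma over_complement_dense:
  assumes f: "continuous_map (mtop X) (mtop B) f"
    and Z: "\<And>G. openin (mtop X) G \<Longrightarrow> f ` G \<subseteq> Z \<Longrightarrow> G = {}"
  shows "points X \<subseteq> mtop X closure_of over X f (points B - Z)"
proof
  fix x assume x: "x \<in> points X"
  have "\<exists>y. y \<in> over X f (points B - Z) \<and> y \<in> G" if G: "x \<in> G" "openin (mtop X) G" for G
  proof -
    obtain y where y: "y \<in> G" "f y \<notin> Z" using Z[OF G(2)] G(1) by blast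
    have "y \<in> points X" using y(1) openin_subset[OF G(2)] by blast
    then show ?thesis
      using y continuous_map_image_subset_topspace[OF f] by (auto simp: over_def)
  qed
  then show "x \<in> mtop X closure_of over X f (points B - Z)"
    using x by (auto simp: in_closure_of)
qed

section \<open>Subsets of the base without interior\<close>

lemma affine_local_iso_interior:
  assumes iso: "affine_local_iso T \<Delta> \<A> x (top_of_set B') \<Delta>' \<A>' x'" and "open B'"
    and V: "openin T V" "x \<in> V" "V \<subseteq> \<Delta>"
  obtains V' where "open V'" "V' \<noteq> {}" "V' \<subseteq> \<Delta>'"
proof -
  obtain N N' h where N: "openin T N" "x \<in> N" "openin (top_of_set B') N'"
    and h: "homeomorphic_map (subtopology T N) (subtopology (top_of_set B') N') h" "h ` (N \<inter> \<Delta>) = N' \<inter> \<Delta>'"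
    using iso unfolding affine_local_iso_def by blast
  have "openin (subtopology (top_of_set B') N') (h ` (V \<inter> N))"
    using homeomorphic_mapD(4)[OF h(1) N(1)] V(1) N(1) by blast
  then have "open (h ` (V \<inter> N))"
    using N(3) \<open>open B'\<close> openin_trans_full openin_open_trans by blast
  moreover have "h ` (V \<inter> N) \<noteq> {}" using V(2) N(2) by blast
  moreover have "h ` (V \<inter> N) \<subseteq> \<Delta>'" using V(3) h(2) by blast
  ultimately show thesis by (rule that)
qed

text \<open>Containment in a hyperplane is a crude bound, but it treats edge points and positive
  vertices alike and already excludes interior points.\<close>

lemma affine_model_discriminant_hyperplane:
  assumes "affine_model generic_singular_fibration B' \<Delta>' \<A>' \<or> affine_model positive_fibration B' \<Delta>' \<A>'"
  shows "open B' \<and> \<Delta>' \<subseteq> {b. b $ 1 = 0}"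
  using assms
proof
  assume "affine_model generic_singular_fibration B' \<Delta>' \<A>'"
  then obtain \<rho> where \<rho>: "B' = {b. (b $ 1)\<^sup>2 + (b $ 2)\<^sup>2 < \<rho>\<^sup>2 \<and> 0 < b $ 3 \<and> b $ 3 < 1}"
    and "\<Delta>' = {b. b $ 1 = 0 \<and> b $ 2 = 0 \<and> 0 < b $ 3 \<and> b $ 3 < 1}"
    by (auto simp: affine_model_def generic_singular_fibration_def)
  moreover have "open {b :: real^3. (b $ 1)\<^sup>2 + (b $ 2)\<^sup>2 < \<rho>\<^sup>2 \<and> 0 < b $ 3 \<and> b $ 3 < 1}"
    by (intro open_Collect_conj open_Collect_less continuous_intros)
  ultimately show ?thesis by auto
next
  assume "affine_model positive_fibration B' \<Delta>' \<A>'"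
  then obtain c r where "B' = ball c r" and "\<Delta>' = in_plane tripod \<inter> B'"
    by (auto simp: affine_model_def positive_fibration_def)
  then show ?thesis by (auto simp: in_plane_def)
qed

text \<open>Read through \<open>k\<close>, an open part of the disc would be an open subset of
  three-space embedded in the plane. Only the topology of the disc is given, so the contradiction is
  again invariance of dimension.\<close>

lemma homeomorphic_disc_interior_empty:
  fixes D :: "'b set"
  assumes Nb: "openin T Nb" and k: "homeomorphic_map (subtopology T Nb) (euclidean :: (real^3) topology) k"
    and D: "subtopology T D homeomorphic_space top_of_set (cball (0 :: real^2) 1)"
    and V: "openin T V" "V \<subseteq> Nb" "V \<subseteq> D"
  shows "V = {}"
proof (rule ccontr)
  assume "V \<noteq> {}"
  have topNb: "topspace (subtopology T Nb) = Nb"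
    using openin_subset[OF Nb] by (simp add: Int_absorb1)
  obtain k' where k': "homeomorphic_maps (subtopology T Nb) euclidean k k'"
    using k homeomorphic_map_maps by blast
  then have k'c: "continuous_map euclidean (subtopology T Nb) k'" and k'k: "\<And>x. x \<in> Nb \<Longrightarrow> k' (k x) = x"
    using openin_subset[OF Nb] by (auto simp: homeomorphic_maps_def)
  obtain m where m: "homeomorphic_map (subtopology T D) (top_of_set (cball (0 :: real^2) 1)) m"
    using D homeomorphic_space by blast
  have openkV: "open (k ` V)"
    using homeomorphic_mapD(4)[OF k Nb V(1,2)] by simp
  have kV: "k' b \<in> V" "k' b \<in> Nb" "k (k' b) = b" if "b \<in> k ` V" for b
    using that k'k V(2) by auto
  have "continuous_map (top_of_set (k ` V)) (subtopology T D) k'"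
    unfolding continuous_map_in_subtopology
  proof
    show "continuous_map (top_of_set (k ` V)) T k'"
      using k'c continuous_map_from_subtopology continuous_map_into_fulltopology by blast
    show "k' \<in> topspace (top_of_set (k ` V)) \<rightarrow> D" using kV(1) V(3) by auto
  qed
  from continuous_map_compose[OF this homeomorphic_imp_continuous_map[OF m]]
  have "continuous_on (k ` V) (m \<circ> k')" by (simp add: continuous_map_in_subtopology)
  moreover have "inj_on (m \<circ> k') (k ` V)"
  proof (rule inj_onI)
    fix b c assume bc: "b \<in> k ` V" "c \<in> k ` V" "(m \<circ> k') b = (m \<circ> k') c"
    have "k' b \<in> topspace (subtopology T D)" "k' c \<in> topspace (subtopology T D)"
      using kV(1)[OF bc(1)] kV(1)[OF bc(2)] V(3) openin_subset[OF V(1)] by auto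
    then have "k' b = k' c"
      using bc(3) homeomorphic_imp_injective_map[OF m] by (auto dest: inj_onD)
    then show "b = c" using kV(3) bc by metis
  qed
  ultimately have "DIM(real^3) \<le> DIM(real^2)"
    using invariance_of_dimension openkV \<open>V \<noteq> {}\<close> by blast
  then show False by simp
qed

text \<open>Inside one of the disjoint neighbourhoods \<open>Nb p\<close>, a set covered by the
  discs lies in \<open>D p\<close> alone. If the set reaches off the discs, that part is open, lies
  in \<Delta> and avoids the negative vertices, which belong to their discs; so a local model with
  discriminant in a hyperplane is available at its points.\<close>

lemma dim6_degenerate_base_interior_empty:
  assumes simple: "simple_affine_3manifold B \<Delta> P N \<A>" and thick: "localized_thickening (mtop B) \<Delta> P N \<Delta>th D"
    and openD: "openin (mtop B) (points B - (\<Union>p\<in>N. D p))"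
    and V: "openin (mtop B) V" "V \<subseteq> \<Delta> \<union> (\<Union>p\<in>N. D p)"
  shows "V = {}"
proof (rule ccontr)
  assume "V \<noteq> {}"
  obtain Nb where Nb: "disjoint_family_on Nb N" "\<And>p. p \<in> N \<Longrightarrow> openin (mtop B) (Nb p)"
    "\<And>p. p \<in> N \<Longrightarrow> p \<in> D p" "\<And>p. p \<in> N \<Longrightarrow> D p \<subseteq> Nb p"
    "\<And>p. p \<in> N \<Longrightarrow> subtopology (mtop B) (D p) homeomorphic_space top_of_set (cball (0 :: real^2) 1)"
    "\<And>p. p \<in> N \<Longrightarrow> \<exists>k. homeomorphic_map (subtopology (mtop B) (Nb p)) (euclidean :: (real^3) topology) k"
    using thick unfolding localized_thickening_def by metis
  show False
  proof (cases "V \<subseteq> (\<Union>p\<in>N. D p)")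
    case True
    then obtain y p where yp: "y \<in> V" "p \<in> N" "y \<in> D p" using \<open>V \<noteq> {}\<close> by blast
    obtain k where k: "homeomorphic_map (subtopology (mtop B) (Nb p)) (euclidean :: (real^3) topology) k"
      using Nb(6)[OF yp(2)] by blast
    have "V \<inter> Nb p \<subseteq> D p"
    proof
      fix z assume z: "z \<in> V \<inter> Nb p"
      then obtain q where q: "q \<in> N" "z \<in> D q" using True by blast
      then have "z \<in> Nb q" using Nb(4) by blast
      then have "q = p" using z q(1) yp(2) Nb(1) by (auto simp: disjoint_family_on_def)
      then show "z \<in> D p" using q by simp
    qed
    then have "V \<inter> Nb p = {}"
      using homeomorphic_disc_interior_empty[OF Nb(2)[OF yp(2)] k Nb(5)[OF yp(2)]] V(1) Nb(2)[OF yp(2)] by blast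
    then show False using yp Nb(4) by blast
  next
    case False
    define V' where "V' = V \<inter> (points B - (\<Union>p\<in>N. D p))"
    have V': "openin (mtop B) V'" unfolding V'_def using V(1) openD by (rule openin_Int)
    obtain y where y: "y \<in> V'" using False openin_subset[OF V(1)] by (auto simp: V'_def)
    have sub: "V' \<subseteq> \<Delta>" using V(2) by (auto simp: V'_def)
    have gen: "\<forall>x\<in>\<Delta> - (P \<union> N). \<exists>B' \<Delta>' \<A>' x'. affine_model generic_singular_fibration B' \<Delta>' \<A>' \<and>
        affine_local_iso (mtop B) \<Delta> \<A> x (top_of_set B') \<Delta>' \<A>' x'"
      and pos: "\<forall>x\<in>P. \<exists>B' \<Delta>' \<A>'. affine_model positive_fibration B' \<Delta>' \<A>' \<and>
        affine_local_iso (mtop B) \<Delta> \<A> x (top_of_set B') \<Delta>' \<A>' 0"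
      using simple by (simp_all add: simple_affine_3manifold_def)
    have "y \<notin> N" using y Nb(3) by (auto simp: V'_def)
    then have "\<exists>B' \<Delta>' \<A>' x'. (affine_model generic_singular_fibration B' \<Delta>' \<A>' \<or>
        affine_model positive_fibration B' \<Delta>' \<A>') \<and>
        affine_local_iso (mtop B) \<Delta> \<A> y (top_of_set B') \<Delta>' \<A>' x'"
    proof (cases "y \<in> P")
      case True
      then show ?thesis using bspec[OF pos] by blast
    next
      case False
      then have "y \<in> \<Delta> - (P \<union> N)" using y sub \<open>y \<notin> N\<close> by blast
      then show ?thesis using bspec[OF gen] by blast
    qed
    then obtain B' \<Delta>' \<A>' x' where m: "affine_model generic_singular_fibration B' \<Delta>' \<A>' \<or>
        affine_model positive_fibration B' \<Delta>' \<A>'"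
      and iso: "affine_local_iso (mtop B) \<Delta> \<A> y (top_of_set B') \<Delta>' \<A>' x'" by blast
    obtain V'' where "open V''" "V'' \<noteq> {}" "V'' \<subseteq> \<Delta>'"
      using affine_local_iso_interior[OF iso _ V' y sub] affine_model_discriminant_hyperplane[OF m] by blast
    then show False
      using affine_model_discriminant_hyperplane[OF m] interior_maximal[of V'' "{b. b $ 1 = 0}"]
        interior_standard_hyperplane[of 1 0] by blast
  qed
qed

lemma smooth_chart_homeomorphism:
  assumes "smooth_chart B (N, \<beta>)"
  shows "openin (mtop B) N" and "open (\<beta> ` N)" and "inj_on \<beta> N"
    and "open V \<Longrightarrow> openin (mtop B) {b \<in> N. \<beta> b \<in> V}"
proof -
  show N: "openin (mtop B) N" and "open (\<beta> ` N)" using assms by (auto simp: smooth_chart_def)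
  have topN: "topspace (subtopology (mtop B) N) = N"
    using openin_subset[OF N] by (simp add: Int_absorb1)
  have d: "diffeomorphism (open_sub B N) (open_sub euclid (\<beta> ` N)) \<beta>"
    using assms by (simp add: smooth_chart_def)
  then have b: "bij_betw \<beta> N (points (open_sub euclid (\<beta> ` N)))"
    unfolding diffeomorphism_def open_sub_simps(1) topN by blast
  then show "inj_on \<beta> N" by (simp add: bij_betw_def)
  have "continuous_map (mtop (open_sub B N)) (mtop (open_sub euclid (\<beta> ` N))) \<beta>"
    using d smooth_map_on_points_continuous unfolding diffeomorphism_def by blast
  then have c: "continuous_map (subtopology (mtop B) N) euclidean \<beta>"
    by (simp add: euclid_def continuous_map_in_subtopology)
  show "openin (mtop B) {b \<in> N. \<beta> b \<in> V}" if "open V"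
  proof -
    have "openin (subtopology (mtop B) N) {b \<in> topspace (subtopology (mtop B) N). \<beta> b \<in> V}"
      by (rule openin_continuous_map_preimage[OF c]) (use that in simp)
    then have "openin (subtopology (mtop B) N) {b \<in> N. \<beta> b \<in> V}"
      by (simp only: topN)
    then show ?thesis using N openin_trans_full by blast
  qed
qed

lemma class_C_dim6_dense:
  assumes fib: "lagrangian_fibration X B f"
    and simple: "simple_affine_3manifold B \<Delta> P N \<A>" and thick: "localized_thickening (mtop B) \<Delta> P N \<Delta>th D"
    and smooth: "smooth_map_on X B (points X - over X f (\<Union>p\<in>N. D p)) f"
    and neg: "\<forall>p\<in>N. type_near lagrangian_negative_fibration X B f (D p)"
    and \<sigma>: "smooth_image_section X B f \<sigma>"
  shows "openin (mtop B) (points B - (\<Delta> \<union> (\<Union>p\<in>N. D p)))"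
    and "points X \<subseteq> mtop X closure_of over X f (points B - (\<Delta> \<union> (\<Union>p\<in>N. D p)))"
proof -
  let ?D = "\<Union>p\<in>N. D p"
  have openX: "openin (mtop X) (points X - over X f ?D)" using smooth by (simp add: smooth_map_on_def)
  have \<sigma>c: "continuous_map (mtop B) (mtop X) \<sigma>" and f\<sigma>: "\<And>b. b \<in> points B \<Longrightarrow> f (\<sigma> b) = b"
    using \<sigma> by (auto simp: smooth_image_section_def)
  \<comment> \<open>That the union of the discs is closed comes from the fibration: smoothness off
    the discs includes openness of that part of \<open>X\<close>, and the section pulls it back to
    the base.\<close>
  have openD: "openin (mtop B) (points B - ?D)"
  proof -
    have "{b \<in> points B. \<sigma> b \<in> points X - over X f ?D} = points B - ?D"
      using f\<sigma> continuous_map_image_subset_topspace[OF \<sigma>c] by (auto simp: over_def)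
    then show ?thesis using openin_continuous_map_preimage[OF \<sigma>c openX] by simp
  qed
  have "openin (mtop B) (points B - \<Delta>)"
    using simple by (auto simp: simple_affine_3manifold_def closedin_def)
  moreover have "points B - (\<Delta> \<union> ?D) = (points B - \<Delta>) \<inter> (points B - ?D)" by blast
  ultimately show "openin (mtop B) (points B - (\<Delta> \<union> ?D))" using openD by (simp add: openin_Int)
  note base_empty = dim6_degenerate_base_interior_empty[OF simple thick openD]
  have fc: "continuous_map (mtop X) (mtop B) f" using fib by (simp add: lagrangian_fibration_def)
  show "points X \<subseteq> mtop X closure_of over X f (points B - (\<Delta> \<union> ?D))"
  proof (rule over_complement_dense[OF fc])
    fix G assume G: "openin (mtop X) G" "f ` G \<subseteq> \<Delta> \<union> ?D"
    show "G = {}"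
    proof (rule ccontr)
      assume "G \<noteq> {}"
      show False
      \<comment> \<open>If \<open>G\<close> reaches off the discs, \<open>f\<close> is smooth on
        that part. Otherwise \<open>G\<close> meets the preimage of a neighbourhood of one disc,
        over which \<open>f\<close> is a negative fibration.\<close>
      proof (cases "G \<subseteq> over X f ?D")
        case False
        let ?H = "G \<inter> (points X - over X f ?D)"
        have H: "openin (mtop X) ?H" using G(1) openX by (rule openin_Int)
        have "?H \<noteq> {}" using False openin_subset[OF G(1)] by blast
        then obtain V where "openin (mtop B) V" "V \<noteq> {}" "V \<subseteq> f ` ?H"
          using smooth_lagrangian_fibration_image_interior[OF fib smooth H] by blast
        then show False using base_empty[of V] G(2) by blast
      next
        case True
        obtain x where "x \<in> G" using \<open>G \<noteq> {}\<close> by blast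
        then have "f x \<in> ?D" using True by (auto simp: over_def)
        then obtain p where "p \<in> N" "f x \<in> D p" by blast
        note xp = \<open>x \<in> G\<close> this
        obtain M \<beta> where M: "D p \<subseteq> M" "smooth_chart B (M, \<beta>)"
          "lagrangian_negative_fibration (open_sub X (over X f M)) (\<beta> ` M) (\<beta> \<circ> f)"
          using bspec[OF neg xp(2)] unfolding type_near_def by blast
        note \<beta> = smooth_chart_homeomorphism[OF M(2)]
        let ?H = "G \<inter> over X f M"
        have "openin (mtop (open_sub X (over X f M))) ?H" using G(1) by (simp add: openin_subtopology_Int)
        moreover have "?H \<noteq> {}" using xp M(1) openin_subset[OF G(1)] by (auto simp: over_def)
        ultimately obtain V where V: "open V" "V \<noteq> {}" "V \<subseteq> (\<beta> \<circ> f) ` ?H"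
          using negative_fibration_image_interior[OF M(3)] by blast
        have fM: "f ` ?H \<subseteq> M" by (auto simp: over_def)
        have "{b \<in> M. \<beta> b \<in> V} \<subseteq> f ` ?H"
        proof
          fix b assume b: "b \<in> {b \<in> M. \<beta> b \<in> V}"
          then obtain x where x: "x \<in> ?H" "\<beta> b = \<beta> (f x)" using V(3) by auto
          then have "b = f x" using b fM \<beta>(3) by (auto dest: inj_onD)
          then show "b \<in> f ` ?H" using x(1) by blast
        qed
        moreover have "{b \<in> M. \<beta> b \<in> V} \<noteq> {}"
        proof -
          obtain x where "x \<in> ?H" "\<beta> (f x) \<in> V" using V(2,3) by force
          then show ?thesis using fM by blast
        qed
        ultimately show False using base_empty[OF \<beta>(4)[OF V(1)]] G(2) by blast
      qed
    qed
  qed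
qed

text \<open>As \<Delta> is discrete, a nonempty open set mapped into \<Delta> would contain a
  nonempty open set lying in a single fibre.\<close>

lemma class_C_dim4_dense:
  assumes fib: "lagrangian_fibration X B f" and simple: "simple_affine_2manifold B \<Delta> \<A>"
  shows "points X \<subseteq> mtop X closure_of over X f (points B - \<Delta>)"
proof -
  have fc: "continuous_map (mtop X) (mtop B) f" using fib by (simp add: lagrangian_fibration_def)
  show ?thesis
  proof (rule over_complement_dense[OF fc])
    fix G assume G: "openin (mtop X) G" "f ` G \<subseteq> \<Delta>"
    show "G = {}"
    proof (rule ccontr)
      assume "G \<noteq> {}"
      then obtain x where x: "x \<in> G" by blast
      then obtain U where U: "openin (mtop B) U" "U \<inter> \<Delta> = {f x}"
        using simple G(2) unfolding simple_affine_2manifold_def by blast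
      let ?H = "G \<inter> {x \<in> points X. f x \<in> U}"
      have "openin (mtop X) ?H"
        using G(1) openin_continuous_map_preimage[OF fc U(1)] by (rule openin_Int)
      moreover have "?H \<subseteq> over X f {f x}" using U(2) G(2) by (auto simp: over_def)
      ultimately have "?H = {}" by (rule lagrangian_fibre_interior_empty[OF fib])
      moreover have "x \<in> ?H" using x U(2) openin_subset[OF G(1)] by blast
      ultimately show False by blast
    qed
  qed
qed

theorem proposition1p10:
  fixes X :: "('a, (real^3) \<times> (real^3)) symp" and B :: "('b, real^3) manifold" and f :: "'a \<Rightarrow> 'b"
    and X' :: "('c, (real^2) \<times> (real^2)) symp" and B' :: "('d, real^2) manifold" and f' :: "'c \<Rightarrow> 'd"
  shows
    "(class_C_dim6 X B f \<longrightarrow>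
       (\<forall>\<phi>. anti_symplectomorphism X \<phi> \<and> (\<forall>x\<in>points X. f (\<phi> x) = f x) \<longrightarrow>
          (\<forall>x\<in>points X. \<phi> (\<phi> x) = x) \<and>
          (\<forall>t. symplectomorphism X X t \<and> (\<forall>x\<in>points X. f (t x) = f x) \<longrightarrow>
             (\<forall>x\<in>points X. \<phi> (inv_into (points X) t x) = t (\<phi> x))))) \<and>
     (class_C_dim4 X' B' f' \<longrightarrow>
       (\<forall>\<phi>. anti_symplectomorphism X' \<phi> \<and> (\<forall>x\<in>points X'. f' (\<phi> x) = f' x) \<longrightarrow>
          (\<forall>x\<in>points X'. \<phi> (\<phi> x) = x) \<and>
          (\<forall>t. symplectomorphism X' X' t \<and> (\<forall>x\<in>points X'. f' (t x) = f' x) \<longrightarrow>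
             (\<forall>x\<in>points X'. \<phi> (inv_into (points X') t x) = t (\<phi> x)))))"
proof (rule conjI; intro impI allI; elim conjE)
  fix \<phi>
  assume C: "class_C_dim6 X B f" and \<phi>: "anti_symplectomorphism X \<phi>" "\<forall>x\<in>points X. f (\<phi> x) = f x"
  obtain \<Delta> P N \<A> \<Delta>th D \<sigma> where fib: "lagrangian_fibration X B f"
    and c: "simple_affine_3manifold B \<Delta> P N \<A>" "localized_thickening (mtop B) \<Delta> P N \<Delta>th D"
      "smooth_map_on X B (points X - over X f (\<Union>p\<in>N. D p)) f"
      "\<forall>p\<in>N. type_near lagrangian_negative_fibration X B f (D p)"
      "smooth_image_section X B f \<sigma>"
    and quot: "cotangent_quotient_over X B f \<A> (points B - (\<Delta> \<union> (\<Union>p\<in>N. D p)))"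
    using C unfolding class_C_dim6_def by (elim exE conjE) (rule that)
  have X: "smooth_manifold X"
    using fib by (simp add: lagrangian_fibration_def symplectic_manifold_def)
  note dense = class_C_dim6_dense[OF fib c]
  have \<A>: "integral_affine_atlas (mtop B) (points B - \<Delta>) \<A>"
    using c(1) by (simp add: simple_affine_3manifold_def)
  have "integral_affine_atlas (mtop B) (points B - (\<Delta> \<union> (\<Union>p\<in>N. D p)))
      (restrict_atlas \<A> (points B - (\<Delta> \<union> (\<Union>p\<in>N. D p))))"
    using integral_affine_atlas_restrict[OF \<A> dense(1)] by blast
  from anti_symplectomorphism_over_dense[OF X this quot dense(2) \<phi>(1) bspec[OF \<phi>(2)]]
  show "(\<forall>x\<in>points X. \<phi> (\<phi> x) = x) \<and> (\<forall>t. symplectomorphism X X t \<and> (\<forall>x\<in>points X. f (t x) = f x) \<longrightarrow>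
      (\<forall>x\<in>points X. \<phi> (inv_into (points X) t x) = t (\<phi> x)))"
    by (rule conjI)
next
  fix \<phi>
  assume C: "class_C_dim4 X' B' f'" and \<phi>: "anti_symplectomorphism X' \<phi>" "\<forall>x\<in>points X'. f' (\<phi> x) = f' x"
  obtain \<Delta> \<A> where fib: "lagrangian_fibration X' B' f'" and simple: "simple_affine_2manifold B' \<Delta> \<A>"
    and quot: "cotangent_quotient_over X' B' f' \<A> (points B' - \<Delta>)"
    using C unfolding class_C_dim4_def by (elim exE conjE) (rule that)
  have X: "smooth_manifold X'"
    using fib by (simp add: lagrangian_fibration_def symplectic_manifold_def)
  have \<A>: "integral_affine_atlas (mtop B') (points B' - \<Delta>) \<A>"
    using simple by (simp add: simple_affine_2manifold_def)
  then have "openin (mtop B') (points B' - \<Delta>)" by (simp add: integral_affine_atlas_def)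
  then have "integral_affine_atlas (mtop B') (points B' - \<Delta>) (restrict_atlas \<A> (points B' - \<Delta>))"
    using integral_affine_atlas_restrict[OF \<A>] by blast
  from anti_symplectomorphism_over_dense[OF X this quot class_C_dim4_dense[OF fib simple] \<phi>(1) bspec[OF \<phi>(2)]]
  show "(\<forall>x\<in>points X'. \<phi> (\<phi> x) = x) \<and> (\<forall>t. symplectomorphism X' X' t \<and> (\<forall>x\<in>points X'. f' (t x) = f' x) \<longrightarrow>
      (\<forall>x\<in>points X'. \<phi> (inv_into (points X') t x) = t (\<phi> x)))"
    by (rule conjI)
qed

end
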